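(* Let $\mu\in\mathcal{M}$ be supported on an open set $U\subseteq\mathbb{R}^{d}$ and let $f:U\to V\subseteq\mathbb{R}^{d}$ be a $C^1$ diffeomorphism onto an open set $V$. Let $x\in U\cap\operatorname{supp}\mu$. Suppose that $\langle\mu\rangle^{\square}_{x,T_i}\to P$ for some sequence of times $T_i\to\infty$, where $P$ is a (restricted) fractal distribution with extended version $\widetilde P$. Then $\langle f\mu\rangle^{\square}_{f(x),T_i}\to (Df(x))^{\square}\widetilde P$, where $(Df(x))^{\square}\widetilde P$ is the push-forward of $\widetilde P$ under $\theta\mapsto (Df(x)\theta)^{\square}$. In particular, if $\mu$ generates at $x$ a fractal distribution $P_x$, then $f\mu$ generates $Df(x)^{*}P_x$ at $f(x)$, where $Df(x)^*$ denotes push-forward under $\theta\mapsto (Df(x)\theta)^*$.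
   Context: Fix $d\ge 1$. $\mathbb{R}^d$ carries the sup-norm; $B_r(x)$ is the closed ball, $B_r=B_r(0)$, so $B_1=[-1,1]^d$. $\mathcal{M}$ is the space of Radon measures on $\mathbb{R}^d$ with the weak topology (tested against continuous compactly supported functions). "Distribution" means a Borel probability measure on a space of measures. For $\mu\in\mathcal{M}$ with $\mu(B_1)>0$ put $\mu^*=\frac{1}{\mu(B_1)}\mu$, $\mu^{\square}=\mu^*|_{B_1}$ (restriction), $\mathcal{M}^*=\{\mu:\mu(B_1)=1\}$, $\mathcal{M}^{\square}=\mathcal{P}(B_1)$; for a distribution $P$, $P^{\square}$ is its push-forward under $\mu\mapsto\mu^{\square}$. Maps of $\mathbb{R}^d$ act on measures by push-forward. Let $T_x(y)=y-x$ and $S_t(y)=e^t y$; $T_x^*\mu=(T_x\mu)^*$, $S_t^*\mu=(S_t\mu)^*$, $S^{\square}_t\mu=(S_t\mu)^{\square}$. $S^*=(S^*_t)_{t\in\mathbb{R}}$ is an $\mathbb{R}$-action on $\{\mu\in\mathcal{M}^*:0\in\operatorname{supp}\mu\}$; $S^*$-invariant distributions are understood to be concentrated on this set. For $U\subseteq\mathbb{R}^d$, $\langle\mu\rangle_U^*=\int_U\delta_{T_x^*\mu}\,d\mu(x)$. A distribution $P$ on $\mathcal{M}^*$ is quasi-Palm if for every bounded open neighborhood $U$ of $0$, $P\sim\int\langle\mu\rangle^*_U\,dP(\mu)$ ($\sim$: same null sets). A fractal distribution (FD) is a probability distribution on $\mathcal{M}^*$ that is $S^*$-invariant and quasi-Palm.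 The map $P\mapsto P^{\square}$ is injective on $S^*$-invariant distributions; $P^\square$ is the restricted version of $P$, $P$ the extended version of $P^{\square}$, and a restricted FD is a distribution of the form $P^{\square}$ with $P$ an FD. For $\mu\in\mathcal{M}$ and $x\in\operatorname{supp}\mu$ let $\mu^{\square}_{x,t}=S^{\square}_t(T_x\mu)$ and $\langle\mu\rangle^{\square}_{x,T}=\frac1T\int_0^T\delta_{\mu^{\square}_{x,t}}\,dt\in\mathcal{P}(\mathcal{M}^{\square})$ (weak topology). $\mu$ generates a distribution at $x$ if $\langle\mu\rangle^{\square}_{x,T}$ converges to it as $T\to\infty$ (for an FD $P$ on $\mathcal{M}^*$, "generates $P$" means convergence to $P^{\square}$). The push-forward $f\mu$ is a measure on $V$; if it is not locally finite near $\partial V$, so that $(f\mu)^{\square}_{f(x),t}$ is undefined for $t$ in some bounded interval $[0,t_0]$, these $t$ are omitted from the average, which does not affect limits. *)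

theory Defs
  imports "HOL-Probability.Probability"
begin

section \<open>Borel probability measures on a topological space and their weak topology\<close>

definition borel_of :: "'a topology \<Rightarrow> 'a measure" where
  "borel_of X = sigma (topspace X) {S. openin X S}"

definition prob_measures :: "'a topology \<Rightarrow> 'a measure set" where
  "prob_measures X = {P. sets P = sets (borel_of X) \<and> prob_space P}"

text \<open>The coarsest topology on \<open>S\<close> for which every evaluation
  \<open>\<mu> \<mapsto> \<integral> \<phi> d\<mu>\<close>, \<open>\<phi> \<in> \<Phi>\<close>, is continuous.\<close>

definition test_topology :: "'a measure set \<Rightarrow> ('a \<Rightarrow> real) set \<Rightarrow> 'a measure topology" where
  "test_topology S \<Phi> =
     pullback_topology S (\<lambda>\<mu>. \<lambda>\<phi>\<in>\<Phi>. integral\<^sup>L \<mu> \<phi>) (product_topology (\<lambda>_. euclideanreal) \<Phi>)"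

definition weak_topology :: "'a topology \<Rightarrow> 'a measure topology" where
  "weak_topology X = test_topology (prob_measures X)
     {\<phi>. continuous_map X euclideanreal \<phi> \<and> bounded (\<phi> ` topspace X)}"

lemma topspace_test_topology [simp]: "topspace (test_topology S \<Phi>) = S"
  by (auto simp: test_topology_def topspace_pullback_topology)

lemma limitin_test_topology:
  "limitin (test_topology S \<Phi>) M N F \<longleftrightarrow>
     N \<in> S \<and> (\<forall>\<^sub>F i in F. M i \<in> S) \<and>
     (\<forall>\<phi>\<in>\<Phi>. ((\<lambda>i. integral\<^sup>L (M i) \<phi>) \<longlongrightarrow> integral\<^sup>L N \<phi>) F)"
  (is "?L \<longleftrightarrow> ?R")
proof -
  define ev where "ev = (\<lambda>\<mu>. \<lambda>\<phi>\<in>\<Phi>. integral\<^sup>L \<mu> \<phi> :: real)"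
  define Y where "Y = product_topology (\<lambda>_. euclideanreal) \<Phi>"
  have op: "openin (test_topology S \<Phi>) W \<longleftrightarrow> (\<exists>O'. openin Y O' \<and> W = ev -` O' \<inter> S)" for W
    by (simp add: test_topology_def openin_pullback_topology ev_def Y_def)
  have top: "ev \<mu> \<in> topspace Y" for \<mu>
    by (auto simp: Y_def ev_def)
  have Y: "limitin Y (\<lambda>i. ev (M i)) (ev N) F \<longleftrightarrow>
     (\<forall>\<phi>\<in>\<Phi>. ((\<lambda>i. integral\<^sup>L (M i) \<phi>) \<longlongrightarrow> integral\<^sup>L N \<phi>) F)"
    using top[of N] by (auto simp: Y_def limitin_componentwise ev_def)
  show ?thesis
  proof
    assume L: ?L
    then have "N \<in> S" and ev_S: "\<forall>\<^sub>F i in F. M i \<in> S"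
      using limitin_topspace[OF L] L by (auto simp: limitin_def dest: spec[of _ S]
        intro: openin_topspace[of "test_topology S \<Phi>", simplified])
    moreover have "limitin Y (\<lambda>i. ev (M i)) (ev N) F"
      unfolding limitin_def
    proof (intro conjI allI impI top)
      fix O' assume O': "openin Y O' \<and> ev N \<in> O'"
      then have "openin (test_topology S \<Phi>) (ev -` O' \<inter> S)" "N \<in> ev -` O' \<inter> S"
        using op \<open>N \<in> S\<close> by auto
      with L have "\<forall>\<^sub>F i in F. M i \<in> ev -` O' \<inter> S" by (auto simp: limitin_def)
      then show "\<forall>\<^sub>F i in F. ev (M i) \<in> O'" by (rule eventually_mono) auto
    qed
    ultimately show ?R using Y by simp
  next
    assume R: ?R
    with Y have lim: "limitin Y (\<lambda>i. ev (M i)) (ev N) F" by simp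
    show ?L
      unfolding limitin_def
    proof (intro conjI allI impI)
      fix W assume W: "openin (test_topology S \<Phi>) W \<and> N \<in> W"
      then obtain O' where O': "openin Y O'" "W = ev -` O' \<inter> S" using op by blast
      with W lim have "\<forall>\<^sub>F i in F. ev (M i) \<in> O'" by (auto simp: limitin_def)
      moreover have "\<forall>\<^sub>F i in F. M i \<in> S" using R by simp
      ultimately show "\<forall>\<^sub>F i in F. M i \<in> W"
        by eventually_elim (use O' in auto)
    qed (use R in simp)
  qed
qed


section \<open>Measures on Euclidean space\<close>

definition sup_cball :: "real \<Rightarrow> real ^ 'd \<Rightarrow> (real ^ 'd) set" where
  "sup_cball r x = {y. infnorm (y - x) \<le> r}"

abbreviation B1 :: "(real ^ 'd) set" where
  "B1 \<equiv> sup_cball 1 0"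

text \<open>On a Euclidean space every locally finite Borel measure is regular.\<close>

definition radon :: "(real ^ 'd) measure set" where
  "radon = {\<mu>. sets \<mu> = sets borel \<and> (\<forall>K. compact K \<longrightarrow> emeasure \<mu> K < \<infinity>)}"

definition radon_topology :: "(real ^ 'd) measure topology" where
  "radon_topology = test_topology radon
     {\<phi>. continuous_on UNIV \<phi> \<and> compact (closure {y. \<phi> y \<noteq> 0})}"

definition supp :: "(real ^ 'd) measure \<Rightarrow> (real ^ 'd) set" where
  "supp \<mu> = {x. \<forall>N. open N \<and> x \<in> N \<longrightarrow> 0 < emeasure \<mu> N}"

definition normalizable :: "(real ^ 'd) measure \<Rightarrow> bool" where
  "normalizable \<mu> \<longleftrightarrow> 0 < emeasure \<mu> B1 \<and> emeasure \<mu> B1 < \<infinity>"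

text \<open>\<open>star \<mu>\<close> is $\mu^*$.  The Dirac mass at \<open>0\<close> is an arbitrary value for measures that cannot be
  normalized; it makes \<open>star\<close> and the maps built from it total and measurable.\<close>

definition star :: "(real ^ 'd) measure \<Rightarrow> (real ^ 'd) measure" where
  "star \<mu> = (if normalizable \<mu> then scale_measure (inverse (emeasure \<mu> B1)) \<mu> else return borel 0)"

definition box :: "(real ^ 'd) measure \<Rightarrow> (real ^ 'd) measure" where
  "box \<mu> = restrict_space (star \<mu>) B1"

definition Mstar :: "(real ^ 'd) measure topology" where
  "Mstar = subtopology radon_topology {\<mu>. emeasure \<mu> B1 = 1}"

text \<open>The points of \<open>Mbox\<close> are measures whose underlying space is \<open>B1\<close>, not \<open>UNIV\<close>.\<close>

definition Mbox :: "(real ^ 'd) measure topology" where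
  "Mbox = weak_topology (top_of_set B1)"

definition translate :: "real ^ 'd \<Rightarrow> (real ^ 'd) measure \<Rightarrow> (real ^ 'd) measure" where
  "translate x \<mu> = distr \<mu> borel (\<lambda>y. y - x)"

definition zoom :: "real \<Rightarrow> (real ^ 'd) measure \<Rightarrow> (real ^ 'd) measure" where
  "zoom t \<mu> = distr \<mu> borel (\<lambda>y. exp t *\<^sub>R y)"


section \<open>Fractal distributions\<close>

definition zoom_invariant :: "(real ^ 'd) measure measure \<Rightarrow> bool" where
  "zoom_invariant P \<longleftrightarrow>
     (AE \<mu> in P. 0 \<in> supp \<mu>) \<and> (\<forall>t. distr P (borel_of Mstar) (\<lambda>\<mu>. star (zoom t \<mu>)) = P)"

text \<open>$\langle\mu\rangle^*_U = \int_U \delta_{T_x^*\mu}\,d\mu(x)$, which has total mass \<open>\<mu>(U)\<close>.\<close>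

definition star_orbit :: "(real ^ 'd) set \<Rightarrow> (real ^ 'd) measure \<Rightarrow> (real ^ 'd) measure measure" where
  "star_orbit U \<mu> = distr (restrict_space \<mu> U) (borel_of Mstar) (\<lambda>x. star (translate x \<mu>))"

definition mean_star_orbit ::
    "(real ^ 'd) set \<Rightarrow> (real ^ 'd) measure measure \<Rightarrow> (real ^ 'd) measure measure" where
  "mean_star_orbit U P = measure_of (topspace Mstar) (sets (borel_of Mstar))
     (\<lambda>A. \<integral>\<^sup>+\<mu>. emeasure (star_orbit U \<mu>) A \<partial>P)"

definition quasi_palm :: "(real ^ 'd) measure measure \<Rightarrow> bool" where
  "quasi_palm P \<longleftrightarrow>
     (\<forall>U. open U \<and> bounded U \<and> 0 \<in> U \<longrightarrow> null_sets P = null_sets (mean_star_orbit U P))"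

definition fractal_distribution :: "(real ^ 'd) measure measure \<Rightarrow> bool" where
  "fractal_distribution P \<longleftrightarrow> P \<in> prob_measures Mstar \<and> zoom_invariant P \<and> quasi_palm P"

definition restricted_version :: "(real ^ 'd) measure measure \<Rightarrow> (real ^ 'd) measure measure" where
  "restricted_version P = distr P (borel_of Mbox) box"


section \<open>Sceneries\<close>

definition scenery :: "(real ^ 'd) measure \<Rightarrow> real ^ 'd \<Rightarrow> real \<Rightarrow> (real ^ 'd) measure" where
  "scenery \<mu> x t = box (zoom t (translate x \<mu>))"

text \<open>Times at which the scenery is undefined are omitted from the average.  If \<open>\<mu>\<close> is Radon and
  \<open>x \<in> supp \<mu>\<close> there are none, and this is $\frac1T\int_0^T \delta_{\mu^\square_{x,t}}\,dt$.\<close>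

definition scenery_distribution ::
    "(real ^ 'd) measure \<Rightarrow> real ^ 'd \<Rightarrow> real \<Rightarrow> (real ^ 'd) measure measure" where
  "scenery_distribution \<mu> x T =
     distr (uniform_measure lborel {t \<in> {0..T}. normalizable (zoom t (translate x \<mu>))})
       (borel_of Mbox) (scenery \<mu> x)"

text \<open>Here \<open>P\<close> is a distribution on \<open>Mstar\<close>.\<close>

definition generates :: "(real ^ 'd) measure \<Rightarrow> real ^ 'd \<Rightarrow> (real ^ 'd) measure measure \<Rightarrow> bool" where
  "generates \<mu> x P \<longleftrightarrow>
     limitin (weak_topology Mbox) (scenery_distribution \<mu> x) (restricted_version P) at_top"


section \<open>Images of measures and distributions\<close>

definition C1_on :: "(real ^ 'd) set \<Rightarrow> (real ^ 'd \<Rightarrow> real ^ 'd) \<Rightarrow> bool" where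
  "C1_on U f \<longleftrightarrow> (\<exists>D :: real ^ 'd \<Rightarrow> ((real ^ 'd) \<Rightarrow>\<^sub>L (real ^ 'd)).
     (\<forall>x\<in>U. (f has_derivative blinfun_apply (D x)) (at x)) \<and> continuous_on U D)"

definition C1_diffeomorphism ::
    "(real ^ 'd) set \<Rightarrow> (real ^ 'd) set \<Rightarrow> (real ^ 'd \<Rightarrow> real ^ 'd) \<Rightarrow> bool" where
  "C1_diffeomorphism U V f \<longleftrightarrow> bij_betw f U V \<and> C1_on U f \<and> C1_on V (the_inv_into U f)"

text \<open>The push-forward of \<open>\<mu>\<close>, assumed to be supported on \<open>U\<close>, under a map defined on \<open>U\<close>;
  it is extended by zero to a measure on the whole space, where it need not be locally finite.\<close>

definition push_on ::
    "(real ^ 'd) set \<Rightarrow> (real ^ 'd \<Rightarrow> real ^ 'd) \<Rightarrow> (real ^ 'd) measure \<Rightarrow> (real ^ 'd) measure" where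
  "push_on U f \<mu> = distr (restrict_space \<mu> U) borel f"

definition linear_star ::
    "(real ^ 'd \<Rightarrow> real ^ 'd) \<Rightarrow> (real ^ 'd) measure measure \<Rightarrow> (real ^ 'd) measure measure" where
  "linear_star A P = distr P (borel_of Mstar) (\<lambda>\<theta>. star (distr \<theta> borel A))"

definition linear_box ::
    "(real ^ 'd \<Rightarrow> real ^ 'd) \<Rightarrow> (real ^ 'd) measure measure \<Rightarrow> (real ^ 'd) measure measure" where
  "linear_box A P = distr P (borel_of Mbox) (\<lambda>\<theta>. box (distr \<theta> borel A))"

end

theory Submission
  imports Defs
begin

text \<open>Write \<open>A = Df(x)\<close> and let \<open>a(t)\<close>, \<open>b(t)\<close> be the sceneries of \<open>\<mu>\<close> at \<open>x\<close> and of \<open>f\<mu>\<close> at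
  \<open>f(x)\<close>.  If \<open>exp s\<close> exceeds a local Lipschitz constant of the inverse of \<open>f\<close> at \<open>f(x)\<close>, then for
  large \<open>u\<close> the measure \<open>b(u + s)\<close> is the normalized restriction of the image of \<open>a(u)\<close> under the
  blow-up \<open>v \<mapsto> exp (u + s) (f(x + exp (-u) v) - f(x))\<close>, which tends to \<open>exp s A\<close> uniformly on \<open>B1\<close>.
  The resulting maps on measures converge continuously to the one induced by \<open>exp s A\<close> at every
  \<open>\<theta>\<close> that charges the parallelepiped \<open>{z. infnorm (exp s A z) \<le> 1}\<close> but not its boundary.
  Almost every \<open>\<theta>\<close> is of this kind: the expected (truncated) mass of the boundary is at most that
  of a slightly larger dilate of it, by invariance, and these dilates lie in shells that decrease
  to the empty set.  A continuous mapping theorem for continuously convergent functions then identifies the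
  limit of the averages over \<open>b\<close>, and invariance removes the factor \<open>exp s\<close>.\<close>

section \<open>Test topologies as pullbacks along countably many evaluations\<close>

text \<open>The time shift is forced by the restriction to \<open>B1\<close>: the preimage of
  \<open>B1\<close> under \<open>A\<close> need not lie in \<open>B1\<close>, and \<open>s\<close>
  shrinks it until \<open>a(u)\<close> holds all the mass that \<open>b(u + s)\<close> sees. The
  maps taking \<open>a(u)\<close> to \<open>b(u + s)\<close> vary with \<open>u\<close> and are
  discontinuous, because restricting and normalizing breaks continuity where the boundary of
  \<open>B1\<close> is charged or \<open>B1\<close> is null. So weak convergence of the averages
  cannot be applied to them directly. It is applied to a bounded continuous function of
  \<open>a(u)\<close> that lies below the value of the test function at \<open>b(u + s)\<close> for
  all large \<open>u\<close> and whose integral is almost the expected one. Lower bounds suffice,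
  since the negated test function supplies the upper ones. The shift and the omitted initial times
  change time integrals by a bounded amount, which disappears after division by the length of the
  interval. Spaces of measures are reached through countably many evaluations, that is through a map
  into \<open>nat \<Rightarrow> real\<close>: this supplies the metric for the Lipschitz
  approximation and also reduces measurability to coordinates.\<close>

lemma continuous_map_test_topology_eval:
  assumes "\<phi> \<in> \<Phi>"
  shows "continuous_map (test_topology S \<Phi>) euclideanreal (\<lambda>\<mu>. integral\<^sup>L \<mu> \<phi>)"
proof -
  let ?ev = "\<lambda>\<mu>. \<lambda>\<phi>\<in>\<Phi>. integral\<^sup>L \<mu> \<phi> :: real"
  have "continuous_map (test_topology S \<Phi>) euclideanreal ((\<lambda>w. w \<phi>) \<circ> ?ev)"
    unfolding test_topology_def
    by (rule continuous_map_pullback) (use assms in \<open>auto intro: continuous_map_product_coordinates\<close>)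
  then show ?thesis using assms by (simp add: comp_def)
qed

text \<open>The error is measured against \<open>\<psi> m\<close> and not against a constant, so it
  is controlled by one evaluation, which is bounded near any given measure even if total masses are
  not. The gain is that the topology comes from the metric space
  \<open>nat \<Rightarrow> real\<close>.\<close>

lemma test_topology_eq_pullback:
  fixes \<psi> :: "nat \<Rightarrow> 'a \<Rightarrow> real"
  assumes \<psi>: "\<And>k. \<psi> k \<in> \<Phi>"
    and int: "\<And>\<mu> \<phi>. \<mu> \<in> S \<Longrightarrow> \<phi> \<in> \<Phi> \<Longrightarrow> integrable \<mu> \<phi>"
    and approx: "\<And>\<phi>. \<phi> \<in> \<Phi> \<Longrightarrow>
      \<exists>m. \<forall>\<epsilon>>0. \<exists>k. \<forall>\<mu>\<in>S. \<forall>z\<in>space \<mu>. \<bar>\<phi> z - \<psi> k z\<bar> \<le> \<epsilon> * \<psi> m z"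
  shows "test_topology S \<Phi> = pullback_topology S (\<lambda>\<mu> k. integral\<^sup>L \<mu> (\<psi> k)) euclidean"
    (is "_ = pullback_topology S ?e euclidean")
proof -
  let ?X = "pullback_topology S ?e euclidean"
  have top: "topspace ?X = S" by (simp add: topspace_pullback_topology)
  have cont: "continuous_map (test_topology S \<Phi>) euclidean ?e"
    unfolding euclidean_product_topology[symmetric] continuous_map_componentwise_UNIV
    using \<psi> by (auto intro: continuous_map_test_topology_eval)
  have 1: "openin (test_topology S \<Phi>) W" if W: "openin ?X W" for W
  proof -
    obtain G where G: "openin euclidean G \<and> W = ?e -` G \<inter> S"
      using W unfolding openin_pullback_topology ..
    then have "W = {\<mu> \<in> topspace (test_topology S \<Phi>). ?e \<mu> \<in> G}" by (simp add: set_eq_iff conj_commute)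
    then show ?thesis using cont G unfolding continuous_map_def by (metis (no_types, lifting))
  qed
  have eval: "continuous_map ?X euclideanreal (\<lambda>\<mu>. integral\<^sup>L \<mu> \<phi>)" if \<phi>: "\<phi> \<in> \<Phi>" for \<phi>
  proof -
    obtain m where m: "\<forall>\<epsilon>>0. \<exists>k. \<forall>\<mu>\<in>S. \<forall>z\<in>space \<mu>. \<bar>\<phi> z - \<psi> k z\<bar> \<le> \<epsilon> * \<psi> m z"
      using approx[OF \<phi>] ..
    have nbhd: "\<exists>W'. openin ?X W' \<and> \<mu> \<in> W' \<and> W' \<subseteq> {\<nu> \<in> S. integral\<^sup>L \<nu> \<phi> \<in> G}"
      if "open G" "\<mu> \<in> S" "integral\<^sup>L \<mu> \<phi> \<in> G" for G :: "real set" and \<mu> :: "'a measure"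
    proof -
      obtain r where r: "r > 0" "ball (integral\<^sup>L \<mu> \<phi>) r \<subseteq> G"
        using \<open>open G\<close> \<open>integral\<^sup>L \<mu> \<phi> \<in> G\<close> openE by blast
      \<comment> \<open>\<open>M\<close> bounds the integral of \<open>\<psi> m\<close> on the
        neighbourhood \<open>Og\<close>. With \<open>\<epsilon> * M = r / 4\<close>, replacing
        \<open>\<phi>\<close> by \<open>\<psi> k\<close> costs at most \<open>r / 4\<close> at each
        of the two measures, and the variation of the integral of \<open>\<psi> k\<close> costs less
        than another \<open>r / 4\<close>.\<close>
      define M where "M = \<bar>integral\<^sup>L \<mu> (\<psi> m)\<bar> + 1"
      have M: "M > 0" "integral\<^sup>L \<mu> (\<psi> m) < M" by (auto simp: M_def)
      define \<epsilon> where "\<epsilon> = r / (4 * M)"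
      have \<epsilon>: "\<epsilon> > 0" "\<epsilon> * M = r / 4" using r M by (auto simp: \<epsilon>_def field_simps)
      obtain k where k: "\<And>\<nu> z. \<nu> \<in> S \<Longrightarrow> z \<in> space \<nu> \<Longrightarrow> \<bar>\<phi> z - \<psi> k z\<bar> \<le> \<epsilon> * \<psi> m z"
        using m[rule_format, OF \<epsilon>(1)] by metis
      have diff: "\<bar>integral\<^sup>L \<nu> \<phi> - integral\<^sup>L \<nu> (\<psi> k)\<bar> \<le> \<epsilon> * integral\<^sup>L \<nu> (\<psi> m)" if "\<nu> \<in> S" for \<nu>
      proof -
        have [simp]: "integrable \<nu> \<phi>" "\<And>k. integrable \<nu> (\<psi> k)"
          using int that \<phi> \<psi> by auto
        have "\<bar>integral\<^sup>L \<nu> \<phi> - integral\<^sup>L \<nu> (\<psi> k)\<bar> = \<bar>\<integral>z. \<phi> z - \<psi> k z \<partial>\<nu>\<bar>" by simp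
        also have "\<dots> \<le> (\<integral>z. \<bar>\<phi> z - \<psi> k z\<bar> \<partial>\<nu>)" by (rule integral_abs_bound)
        also have "\<dots> \<le> (\<integral>z. \<epsilon> * \<psi> m z \<partial>\<nu>)"
          by (rule integral_mono) (use k[OF that] in auto)
        finally show ?thesis by simp
      qed
      define Og where "Og = {w :: nat \<Rightarrow> real. w m < M \<and> \<bar>w k - integral\<^sup>L \<mu> (\<psi> k)\<bar> < r / 4}"
      have "open Og"
        unfolding Og_def
        by (intro open_Collect_conj open_Collect_less continuous_on_rabs continuous_on_diff
            continuous_on_const continuous_on_product_coordinates)
      moreover have "?e \<mu> \<in> Og" using M r by (auto simp: Og_def)
      moreover have "integral\<^sup>L \<nu> \<phi> \<in> G" if "\<nu> \<in> S" "?e \<nu> \<in> Og" for \<nu>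
      proof -
        have "\<epsilon> * integral\<^sup>L \<nu> (\<psi> m) \<le> \<epsilon> * M" "\<epsilon> * integral\<^sup>L \<mu> (\<psi> m) \<le> \<epsilon> * M"
          using that \<epsilon> M by (auto simp: Og_def)
        moreover have "\<bar>integral\<^sup>L \<nu> (\<psi> k) - integral\<^sup>L \<mu> (\<psi> k)\<bar> < r / 4"
          using that by (simp add: Og_def)
        ultimately have "\<bar>integral\<^sup>L \<nu> \<phi> - integral\<^sup>L \<mu> \<phi>\<bar> < r"
          using diff[OF \<open>\<nu> \<in> S\<close>] diff[OF \<open>\<mu> \<in> S\<close>] \<epsilon>(2) by linarith
        then show ?thesis using r(2) by (auto simp: dist_real_def subset_iff)
      qed
      ultimately show ?thesis
        using \<open>\<mu> \<in> S\<close> by (intro exI[of _ "?e -` Og \<inter> S"]) (auto simp: openin_pullback_topology)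
    qed
    show ?thesis
      using nbhd unfolding continuous_map_def top
      by (intro conjI allI impI, simp, subst openin_subopen) auto
  qed
  have cont2: "continuous_map ?X (test_topology S \<Phi>) id"
    unfolding test_topology_def
  proof (rule continuous_map_pullback')
    show "continuous_map ?X (product_topology (\<lambda>_. euclideanreal) \<Phi>)
        ((\<lambda>\<mu>. \<lambda>\<phi>\<in>\<Phi>. integral\<^sup>L \<mu> \<phi>) \<circ> id)"
      unfolding continuous_map_componentwise using eval
      by (auto simp: comp_def extensional_def)
  qed (simp add: top)
  have 2: "openin ?X W" if "openin (test_topology S \<Phi>) W" for W
  proof -
    have "openin ?X {\<mu> \<in> topspace ?X. id \<mu> \<in> W}"
      using cont2 that unfolding continuous_map_def by blast
    moreover have "{\<mu> \<in> topspace ?X. id \<mu> \<in> W} = W"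
      using openin_subset[OF that] top by auto
    ultimately show ?thesis by simp
  qed
  show ?thesis unfolding topology_eq using 1 2 by blast
qed

section \<open>Borel sigma-algebras of topologies\<close>

lemma space_borel_of [simp]: "space (borel_of X) = topspace X"
  unfolding borel_of_def by (rule space_measure_of) (auto dest: openin_subset)

lemma sets_borel_of: "sets (borel_of X) = sigma_sets (topspace X) {S. openin X S}"
  unfolding borel_of_def by (rule sets_measure_of) (auto dest: openin_subset)

text \<open>Open sets generate \<open>borel_of X\<close>, and each is a preimage of an open set
  under \<open>e\<close>. A measure-valued map thus needs checking only after composition with
  \<open>e\<close>, in practice on countably many integrals.\<close>

lemma measurable_borel_of_pullback:
  fixes e :: "'a \<Rightarrow> 'b::topological_space"
  assumes X: "\<And>W. openin X W \<Longrightarrow> \<exists>G. open G \<and> W = e -` G \<inter> topspace X"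
    and F: "\<And>m. m \<in> space M \<Longrightarrow> F m \<in> topspace X"
    and e: "(\<lambda>m. e (F m)) \<in> borel_measurable M"
  shows "F \<in> measurable M (borel_of X)"
  unfolding borel_of_def
proof (rule measurable_measure_of)
  show "F -` W \<inter> space M \<in> sets M" if W: "W \<in> {S. openin X S}" for W
  proof -
    obtain G where G: "open G" "W = e -` G \<inter> topspace X" using W X by blast
    then have "F -` W \<inter> space M = (\<lambda>m. e (F m)) -` G \<inter> space M" using F by auto
    also have "\<dots> \<in> sets M" using e G(1) by measurable
    finally show ?thesis .
  qed
qed (use F openin_subset in auto)

lemma continuous_map_borel_of_measurable:
  fixes \<phi> :: "'a \<Rightarrow> 'b::topological_space"
  assumes "continuous_map X euclidean \<phi>"
  shows "\<phi> \<in> borel_measurable (borel_of X)"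
proof (rule borel_measurableI)
  fix G :: "'b set" assume "open G"
  then have "openin X {x \<in> topspace X. \<phi> x \<in> G}" using assms by (simp add: continuous_map_def)
  moreover have "\<phi> -` G \<inter> space (borel_of X) = {x \<in> topspace X. \<phi> x \<in> G}" by auto
  ultimately show "\<phi> -` G \<inter> space (borel_of X) \<in> sets (borel_of X)" by (simp add: sets_borel_of)
qed

lemma sets_borel_of_top_of_set:
  fixes S :: "'a::topological_space set"
  assumes "S \<in> sets borel"
  shows "sets (borel_of (top_of_set S)) = sets (restrict_space borel S)"
proof -
  have "sets (restrict_space borel S) = (\<inter>) S ` sigma_sets UNIV {G. open G}"
    by (simp add: sets_restrict_space borel_def)
  also have "\<dots> = sigma_sets S ((\<inter>) S ` {G. open G})"
    using assms by (intro sigma_sets_Int) (simp_all add: borel_def)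
  also have "(\<inter>) S ` {G. open G} = {W. openin (top_of_set S) W}"
    by (auto simp: openin_open)
  finally show ?thesis by (simp add: sets_borel_of)
qed

section \<open>A countable family of test functions\<close>

text \<open>The ring generated by the coordinates and the rational constants, built in stages: each
  stage is visibly countable, and two members always share a stage.\<close>

primrec rational_poly_layer :: "nat \<Rightarrow> ('a::euclidean_space \<Rightarrow> real) set" where
  "rational_poly_layer 0 = (\<lambda>q z. q) ` \<rat> \<union> (\<lambda>b z. z \<bullet> b) ` Basis"
| "rational_poly_layer (Suc n) = rational_poly_layer n
     \<union> (\<lambda>(f, g) z. f z + g z) ` (rational_poly_layer n \<times> rational_poly_layer n)
     \<union> (\<lambda>(f, g) z. f z * g z) ` (rational_poly_layer n \<times> rational_poly_layer n)"

definition rational_poly :: "('a::euclidean_space \<Rightarrow> real) set" where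
  "rational_poly = (\<Union>n. rational_poly_layer n)"

lemma countable_rational_poly: "countable (rational_poly :: ('a::euclidean_space \<Rightarrow> real) set)"
proof -
  have "countable (rational_poly_layer n :: ('a \<Rightarrow> real) set)" for n
    by (induction n) (auto intro: countable_rat countable_finite)
  then show ?thesis by (simp add: rational_poly_def)
qed

lemma rational_poly_layer_mono: "m \<le> n \<Longrightarrow> rational_poly_layer m \<subseteq> rational_poly_layer n"
  by (rule lift_Suc_mono_le) auto

lemma rational_poly_closed:
  assumes "f \<in> rational_poly" "g \<in> rational_poly"
  shows "(\<lambda>z. f z + g z) \<in> rational_poly" "(\<lambda>z. f z * g z) \<in> rational_poly"
proof -
  obtain m n where "f \<in> rational_poly_layer m" "g \<in> rational_poly_layer n"
    using assms by (auto simp: rational_poly_def)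
  then have "f \<in> rational_poly_layer (max m n)" "g \<in> rational_poly_layer (max m n)"
    using rational_poly_layer_mono by (meson max.cobounded1 max.cobounded2 subsetD)+
  then have "(\<lambda>z. f z + g z) \<in> rational_poly_layer (Suc (max m n))"
    "(\<lambda>z. f z * g z) \<in> rational_poly_layer (Suc (max m n))" by force+
  then show "(\<lambda>z. f z + g z) \<in> rational_poly" "(\<lambda>z. f z * g z) \<in> rational_poly"
    unfolding rational_poly_def by blast+
qed

lemma rational_poly_const: "q \<in> \<rat> \<Longrightarrow> (\<lambda>z. q) \<in> rational_poly"
  unfolding rational_poly_def by (rule UN_I[of 0]) auto

lemma rational_poly_continuous:
  assumes "f \<in> rational_poly"
  shows "continuous_on UNIV f"
proof -
  have "f \<in> rational_poly_layer n \<Longrightarrow> continuous_on UNIV f" for n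
    by (induction n arbitrary: f) (auto intro!: continuous_intros)
  then show ?thesis using assms by (auto simp: rational_poly_def)
qed

definition rat_approximable :: "'a::euclidean_space set \<Rightarrow> ('a \<Rightarrow> real) \<Rightarrow> bool" where
  "rat_approximable K f \<longleftrightarrow> (\<forall>\<epsilon>>0. \<exists>p\<in>rational_poly. \<forall>z\<in>K. \<bar>f z - p z\<bar> \<le> \<epsilon>)"

lemma rat_approximableE:
  assumes "rat_approximable K f" "\<epsilon> > 0"
  obtains p where "p \<in> rational_poly" "\<And>z. z \<in> K \<Longrightarrow> \<bar>f z - p z\<bar> \<le> \<epsilon>"
  using assms unfolding rat_approximable_def by auto

lemma rat_approximable_add:
  assumes "rat_approximable K f" "rat_approximable K g"
  shows "rat_approximable K (\<lambda>z. f z + g z)"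
  unfolding rat_approximable_def
proof (intro allI impI)
  fix \<epsilon> :: real assume "\<epsilon> > 0"
  then have "\<epsilon> / 2 > 0" by simp
  obtain p where p: "p \<in> rational_poly" "\<And>z. z \<in> K \<Longrightarrow> \<bar>f z - p z\<bar> \<le> \<epsilon> / 2"
    using rat_approximableE[OF assms(1) \<open>\<epsilon> / 2 > 0\<close>] by metis
  obtain q where q: "q \<in> rational_poly" "\<And>z. z \<in> K \<Longrightarrow> \<bar>g z - q z\<bar> \<le> \<epsilon> / 2"
    using rat_approximableE[OF assms(2) \<open>\<epsilon> / 2 > 0\<close>] by metis
  have "\<bar>f z + g z - (p z + q z)\<bar> \<le> \<epsilon>" if "z \<in> K" for z
    using p(2)[OF that] q(2)[OF that] by linarith
  then show "\<exists>p\<in>rational_poly. \<forall>z\<in>K. \<bar>f z + g z - p z\<bar> \<le> \<epsilon>"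
    by (intro bexI[OF _ rational_poly_closed(1)[OF p(1) q(1)]]) simp
qed

lemma rat_approximable_mult:
  assumes "rat_approximable K f" "rat_approximable K g" "compact K"
    "continuous_on K f" "continuous_on K g"
  shows "rat_approximable K (\<lambda>z. f z * g z)"
  unfolding rat_approximable_def
proof (intro allI impI)
  fix \<epsilon> :: real assume \<epsilon>: "\<epsilon> > 0"
  have "bounded (f ` K)" "bounded (g ` K)"
    using assms by (auto intro: compact_imp_bounded compact_continuous_image)
  then obtain C1 C2 where C: "\<And>z. z \<in> K \<Longrightarrow> \<bar>f z\<bar> \<le> C1" "\<And>z. z \<in> K \<Longrightarrow> \<bar>g z\<bar> \<le> C2"
    unfolding bounded_iff by auto
  define M where "M = \<bar>C1\<bar> + \<bar>C2\<bar> + 1"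
  have fM: "\<bar>f z\<bar> \<le> M" and gM: "\<bar>g z\<bar> \<le> M" if "z \<in> K" for z
    using C(1)[OF that] C(2)[OF that] by (auto simp: M_def)
  have M: "M \<ge> 1" by (simp add: M_def)
  \<comment> \<open>The bound \<open>\<delta> \<le> 1\<close> gives
    \<open>\<bar>p z\<bar> \<le> M + 1\<close>, so the product errs by at most
    \<open>\<delta> * M + (M + 1) * \<delta> = \<delta> * (2 * M + 1)\<close>.\<close>
  define \<delta> where "\<delta> = min 1 (\<epsilon> / (2 * M + 1))"
  have \<delta>: "\<delta> > 0" "\<delta> \<le> 1" "\<delta> * (2 * M + 1) \<le> \<epsilon>"
  proof -
    have "\<delta> * (2 * M + 1) \<le> \<epsilon> / (2 * M + 1) * (2 * M + 1)"
      using M by (intro mult_right_mono) (auto simp: \<delta>_def)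
    then show "\<delta> * (2 * M + 1) \<le> \<epsilon>" using M by simp
  qed (use \<epsilon> M in \<open>auto simp: \<delta>_def\<close>)
  obtain p where p: "p \<in> rational_poly" "\<And>z. z \<in> K \<Longrightarrow> \<bar>f z - p z\<bar> \<le> \<delta>"
    using rat_approximableE[OF assms(1) \<delta>(1)] by metis
  obtain q where q: "q \<in> rational_poly" "\<And>z. z \<in> K \<Longrightarrow> \<bar>g z - q z\<bar> \<le> \<delta>"
    using rat_approximableE[OF assms(2) \<delta>(1)] by metis
  have "\<bar>f z * g z - p z * q z\<bar> \<le> \<epsilon>" if z: "z \<in> K" for z
  proof -
    have "\<bar>p z\<bar> \<le> M + 1" using p(2)[OF z] fM[OF z] \<delta> by linarith
    have "f z * g z - p z * q z = (f z - p z) * g z + p z * (g z - q z)" by (simp add: algebra_simps)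
    also have "\<bar>\<dots>\<bar> \<le> \<bar>f z - p z\<bar> * \<bar>g z\<bar> + \<bar>p z\<bar> * \<bar>g z - q z\<bar>"
      by (metis abs_mult abs_triangle_ineq)
    also have "\<dots> \<le> \<delta> * M + (M + 1) * \<delta>"
      using p(2)[OF z] q(2)[OF z] gM[OF z] \<open>\<bar>p z\<bar> \<le> M + 1\<close> M \<delta> by (intro add_mono mult_mono) auto
    finally show ?thesis using \<delta>(3) by (simp add: algebra_simps)
  qed
  then show "\<exists>p\<in>rational_poly. \<forall>z\<in>K. \<bar>f z * g z - p z\<bar> \<le> \<epsilon>"
    by (intro bexI[OF _ rational_poly_closed(2)[OF p(1) q(1)]]) simp
qed

lemma rat_approximable_const: "rat_approximable K (\<lambda>z. c)"
  unfolding rat_approximable_def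
proof (intro allI impI)
  fix \<epsilon> :: real assume "\<epsilon> > 0"
  then obtain q where "q \<in> \<rat>" "c < q" "q < c + \<epsilon>" using Rats_dense_in_real[of c "c + \<epsilon>"] by auto
  then show "\<exists>p\<in>rational_poly. \<forall>z\<in>K. \<bar>c - p z\<bar> \<le> \<epsilon>"
    by (intro bexI[of _ "\<lambda>z. q"] rational_poly_const) auto
qed

text \<open>Polynomial functions are generated by linear functionals and real constants. Expanding a
  functional in the basis leaves only coordinates, which are members already, and real constants,
  which are limits of rational ones.\<close>

lemma rat_approximable_polynomial:
  fixes f :: "'a::euclidean_space \<Rightarrow> real"
  assumes "real_polynomial_function f" "compact K"
  shows "rat_approximable K f"
  using assms(1)
proof induction
  case (linear f)
  interpret bounded_linear f by fact
  have coord: "rat_approximable K (\<lambda>z. z \<bullet> b)" if "b \<in> Basis" for b :: 'a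
  proof -
    have "(\<lambda>z. z \<bullet> b) \<in> rational_poly"
      using that unfolding rational_poly_def by (intro UN_I[of 0]) auto
    then show ?thesis unfolding rat_approximable_def
      by (intro allI impI bexI[of _ "\<lambda>z. z \<bullet> b"]) auto
  qed
  have "rat_approximable K (\<lambda>z. \<Sum>b\<in>B. (z \<bullet> b) * f b)" if "B \<subseteq> Basis" for B
    using finite_subset[OF that finite_Basis] that
  proof (induction B rule: finite_induct)
    case (insert b B)
    then have "rat_approximable K (\<lambda>z. (z \<bullet> b) * f b + (\<Sum>b\<in>B. (z \<bullet> b) * f b))"
      by (intro rat_approximable_add rat_approximable_mult rat_approximable_const coord assms(2)
          continuous_intros) auto
    then show ?case using insert.hyps by simp
  qed (simp add: rat_approximable_const)
  moreover have "f z = (\<Sum>b\<in>Basis. (z \<bullet> b) * f b)" for z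
    by (subst euclidean_representation[of z, symmetric]) (simp add: sum scaleR)
  ultimately show ?case by (metis (no_types, lifting) ext order_refl)
next
  case (mult f g)
  then show ?case
    by (intro rat_approximable_mult assms(2))
      (auto intro: continuous_on_polymonial_function simp: real_polynomial_function_eq)
qed (auto intro: rat_approximable_const rat_approximable_add)

definition C_compact :: "('a::euclidean_space \<Rightarrow> real) set" where
  "C_compact = {\<phi>. continuous_on UNIV \<phi> \<and> compact (closure {y. \<phi> y \<noteq> 0})}"

definition cutoff :: "real \<Rightarrow> 'a::real_normed_vector \<Rightarrow> real" where
  "cutoff r z = max 0 (min 1 (r + 1 - norm z))"

lemma cutoff_simps: "0 \<le> cutoff r z" "cutoff r z \<le> 1" "norm z \<le> r \<Longrightarrow> cutoff r z = 1"
    "norm z \<ge> r + 1 \<Longrightarrow> cutoff r z = 0"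
  by (auto simp: cutoff_def)

lemma continuous_cutoff [continuous_intros]: "continuous_on S (cutoff r)"
  unfolding cutoff_def by (intro continuous_intros)

lemma C_compactI:
  fixes \<phi> :: "'a::euclidean_space \<Rightarrow> real"
  assumes "continuous_on UNIV \<phi>" "\<And>z. norm z > r \<Longrightarrow> \<phi> z = 0"
  shows "\<phi> \<in> C_compact"
proof -
  have "{y. \<phi> y \<noteq> 0} \<subseteq> cball 0 r" using assms(2) by (auto simp: not_less[symmetric])
  then have "bounded {y. \<phi> y \<noteq> 0}" using bounded_cball bounded_subset by blast
  then show ?thesis using assms(1) by (simp add: C_compact_def)
qed

text \<open>The radius is a natural number so that the cutoffs built from it form a countable
  family.\<close>

lemma C_compact_bounds:
  fixes \<phi> :: "'a::euclidean_space \<Rightarrow> real"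
  assumes "\<phi> \<in> C_compact"
  obtains N C where "\<And>z. norm z > real N \<Longrightarrow> \<phi> z = 0" "\<And>z. \<bar>\<phi> z\<bar> \<le> C"
proof -
  let ?K = "closure {y. \<phi> y \<noteq> 0}"
  have K: "compact ?K" and cont: "continuous_on ?K \<phi>"
    using assms by (auto simp: C_compact_def intro: continuous_on_subset)
  obtain r where r: "\<And>z. z \<in> ?K \<Longrightarrow> norm z \<le> r"
    using compact_imp_bounded[OF K] unfolding bounded_iff by blast
  obtain C where C: "\<And>z. z \<in> ?K \<Longrightarrow> \<bar>\<phi> z\<bar> \<le> C"
    using compact_imp_bounded[OF compact_continuous_image[OF cont K]] unfolding bounded_iff by auto
  have out: "\<phi> z = 0" if "z \<notin> ?K" for z
    using that closure_subset[of "{y. \<phi> y \<noteq> 0}"] by blast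
  show ?thesis
  proof
    show "\<phi> z = 0" if "norm z > real (nat \<lceil>r\<rceil>)" for z
      using that r out by (metis le_less_trans less_irrefl of_nat_ceiling)
    show "\<bar>\<phi> z\<bar> \<le> max C 0" for z
      using C[of z] out[of z] by (cases "z \<in> ?K") auto
  qed
qed

text \<open>Every \<open>\<phi>\<close> is approximated by a sequence of test functions that are dominated by a
  single one; this is what makes the evaluation at \<open>\<phi>\<close> continuous for measures of
  unbounded mass.\<close>

definition test_sequence :: "(nat \<Rightarrow> 'a::euclidean_space \<Rightarrow> real) \<Rightarrow> bool" where
  "test_sequence \<psi> \<longleftrightarrow> (\<forall>k. \<psi> k \<in> C_compact) \<and>
     (\<forall>\<phi>\<in>C_compact. \<exists>m. \<forall>\<epsilon>>0. \<exists>k. \<forall>z. \<bar>\<phi> z - \<psi> k z\<bar> \<le> \<epsilon> * \<psi> m z)"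

text \<open>The family consists of rational polynomials times cutoffs at integer radii. If
  \<open>\<phi>\<close> vanishes beyond radius \<open>N\<close>, it equals its product with the
  cutoff at \<open>N\<close>, so an \<open>\<epsilon>\<close>-approximation by a polynomial becomes
  an error of \<open>\<epsilon>\<close> times that cutoff, and the cutoff itself is the member with
  polynomial \<open>1\<close>. The approximation is needed up to radius \<open>N + 1\<close>, where
  the cutoff ends.\<close>

lemma test_sequence_exists: "\<exists>\<psi> :: nat \<Rightarrow> 'a::euclidean_space \<Rightarrow> real. test_sequence \<psi>"
proof -
  define \<Psi> :: "('a \<Rightarrow> real) set" where
    "\<Psi> = (\<lambda>(p, N) z. p z * cutoff (real N) z) ` (rational_poly \<times> (UNIV :: nat set))"
  have "countable \<Psi>" by (simp add: \<Psi>_def countable_rational_poly)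
  have in\<Psi>: "(\<lambda>z. p z * cutoff (real N) z) \<in> \<Psi>" if "p \<in> rational_poly" for p N
    unfolding \<Psi>_def by (rule image_eqI[of _ _ "(p, N)"]) (use that in auto)
  have ne: "\<Psi> \<noteq> {}" using in\<Psi>[OF rational_poly_const[of 1]] by auto
  define \<psi> where "\<psi> = from_nat_into \<Psi>"
  have range: "range \<psi> = \<Psi>" using \<open>countable \<Psi>\<close> ne by (simp add: \<psi>_def range_from_nat_into)
  have "\<psi> k \<in> C_compact" for k
  proof -
    obtain p N where "p \<in> rational_poly" "\<psi> k = (\<lambda>z. p z * cutoff (real N) z)"
    proof -
      have "\<psi> k \<in> \<Psi>" using range by blast
      then show thesis using that by (auto simp: \<Psi>_def)
    qed
    then show ?thesis
      by (simp, intro C_compactI[of _ "real N + 1"] continuous_on_mult rational_poly_continuous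
          continuous_cutoff) (auto simp: cutoff_simps)
  qed
  moreover have "\<exists>m. \<forall>\<epsilon>>0. \<exists>k. \<forall>z. \<bar>\<phi> z - \<psi> k z\<bar> \<le> \<epsilon> * \<psi> m z" if \<phi>: "\<phi> \<in> C_compact" for \<phi>
  proof -
    obtain N C where N: "\<And>z. norm z > real N \<Longrightarrow> \<phi> z = 0" "\<And>z. \<bar>\<phi> z\<bar> \<le> C"
      by (rule C_compact_bounds[OF \<phi>]) blast
    obtain m where m: "\<psi> m = (\<lambda>z. 1 * cutoff (real N) z)"
      using in\<Psi>[OF rational_poly_const[of 1], of N] unfolding range[symmetric] by auto
    have "\<exists>k. \<forall>z. \<bar>\<phi> z - \<psi> k z\<bar> \<le> \<epsilon> * \<psi> m z" if \<epsilon>: "\<epsilon> > 0" for \<epsilon>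
    proof -
      let ?K = "cball (0::'a) (real N + 1)"
      have "\<epsilon> / 2 > 0" "continuous_on ?K \<phi>"
        using \<epsilon> \<phi> by (auto simp: C_compact_def intro: continuous_on_subset)
      obtain g where g: "real_polynomial_function g" "\<And>z. z \<in> ?K \<Longrightarrow> \<bar>\<phi> z - g z\<bar> < \<epsilon> / 2"
        using Stone_Weierstrass_real_polynomial_function[OF compact_cball \<open>continuous_on ?K \<phi>\<close> \<open>\<epsilon> / 2 > 0\<close>]
        by metis
      obtain p where p: "p \<in> rational_poly" "\<And>z. z \<in> ?K \<Longrightarrow> \<bar>g z - p z\<bar> \<le> \<epsilon> / 2"
        using rat_approximableE[OF rat_approximable_polynomial[OF g(1) compact_cball] \<open>\<epsilon> / 2 > 0\<close>]
        by metis
      obtain k where k: "\<psi> k = (\<lambda>z. p z * cutoff (real N) z)"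
        using in\<Psi>[OF p(1), of N] unfolding range[symmetric] by auto
      have "\<bar>\<phi> z - \<psi> k z\<bar> \<le> \<epsilon> * \<psi> m z" for z
      proof (cases "z \<in> ?K")
        case True
        have "\<phi> z = \<phi> z * cutoff (real N) z"
          using N[of z] cutoff_simps(3)[of z "real N"] by (cases "norm z > real N") auto
        then have "\<bar>\<phi> z - \<psi> k z\<bar> = \<bar>\<phi> z - p z\<bar> * cutoff (real N) z"
          unfolding k by (metis abs_mult abs_of_nonneg cutoff_simps(1) left_diff_distrib)
        also have "\<dots> \<le> \<epsilon> * cutoff (real N) z"
          using g(2)[OF True] p(2)[OF True] by (intro mult_right_mono cutoff_simps) linarith
        finally show ?thesis by (simp add: m)
      qed (auto simp: k m N cutoff_simps)
      then show ?thesis by blast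
    qed
    then show ?thesis by blast
  qed
  ultimately show ?thesis unfolding test_sequence_def by blast
qed

section \<open>Continuously convergent functions\<close>

lemma prob_measuresD:
  assumes "P \<in> prob_measures X"
  shows "sets P = sets (borel_of X)" "prob_space P"
  using assms by (auto simp: prob_measures_def)

lemma continuous_map_bounded_integrable:
  assumes "prob_space Q" and b: "b \<in> measurable Q (borel_of X)"
    and H: "continuous_map X euclideanreal H" "\<And>\<theta>. \<theta> \<in> topspace X \<Longrightarrow> \<bar>H \<theta>\<bar> \<le> C"
  shows "integrable Q (\<lambda>\<omega>. H (b \<omega>))"
proof -
  interpret prob_space Q by fact
  have "(\<lambda>\<omega>. H (b \<omega>)) \<in> borel_measurable Q"
    by (rule measurable_compose[OF b continuous_map_borel_of_measurable[OF H(1)]])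
  moreover have "b \<omega> \<in> topspace X" if "\<omega> \<in> space Q" for \<omega>
    using measurable_space[OF b that] by simp
  ultimately show ?thesis
    using H(2) by (intro integrable_const_bound[of _ C]) auto
qed

text \<open>The approximant is the inf-convolution of \<open>h t\<close>, \<open>t \<ge> n\<close>, with \<open>n\<close> times the metric
  pulled back by \<open>e\<close>: it is Lipschitz, lies below every \<open>h t\<close> with \<open>t \<ge> n\<close>, and tends to \<open>g\<close>
  at every point at which \<open>h t\<close> converges continuously to \<open>g\<close>.\<close>

lemma continuous_lower_approximant:
  fixes e :: "'a \<Rightarrow> 'b::metric_space" and h :: "real \<Rightarrow> 'a \<Rightarrow> real"
  assumes X: "X = pullback_topology S e euclidean"
    and Q: "prob_space Q" and b: "b \<in> measurable Q (borel_of X)"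
    and bd: "\<And>t \<theta>. \<theta> \<in> S \<Longrightarrow> \<bar>h t \<theta>\<bar> \<le> C"
    and g: "g \<in> borel_measurable Q"
    and lim: "AE \<omega> in Q. \<forall>t \<tau>. filterlim t at_top sequentially \<longrightarrow> (\<forall>n. \<tau> n \<in> S) \<longrightarrow>
      limitin X \<tau> (b \<omega>) sequentially \<longrightarrow> (\<lambda>n. h (t n) (\<tau> n)) \<longlonglongrightarrow> g \<omega>"
    and \<epsilon>: "\<epsilon> > 0"
  obtains H t0 where "continuous_map X euclideanreal H" "\<And>\<theta>. \<theta> \<in> S \<Longrightarrow> \<bar>H \<theta>\<bar> \<le> C"
    "\<And>\<theta> t. \<theta> \<in> S \<Longrightarrow> t \<ge> t0 \<Longrightarrow> H \<theta> \<le> h t \<theta>" "integral\<^sup>L Q g - \<epsilon> \<le> (\<integral>\<omega>. H (b \<omega>) \<partial>Q)"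
proof -
  have top: "topspace X = S" by (simp add: X topspace_pullback_topology)
  interpret prob_space Q by (rule Q)
  have bS: "b \<omega> \<in> S" if "\<omega> \<in> space Q" for \<omega>
    using measurable_space[OF b that] top by simp
  then have Sne: "S \<noteq> {}" using not_empty by blast
  define I :: "nat \<Rightarrow> (real \<times> 'a) set" where "I n = {real n..} \<times> S" for n
  \<comment> \<open>The infimum is a function on the whole metric codomain, not only on the range of
    \<open>e\<close>; its Lipschitz continuity there makes \<open>H n\<close> continuous on
    \<open>X\<close> by composition.\<close>
  define K where "K n w = (INF (t, \<eta>)\<in>I n. h t \<eta> + real n * dist w (e \<eta>))" for n w
  have Ine: "I n \<noteq> {}" for n using Sne by (auto simp: I_def)
  have lower: "- C \<le> h t \<eta> + real n * dist w (e \<eta>)" if "\<eta> \<in> S" for t \<eta> n w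
    using bd[OF that, of t] zero_le_dist[of w "e \<eta>"] mult_nonneg_nonneg[of "real n" "dist w (e \<eta>)"] by linarith
  have bdd: "bdd_below ((\<lambda>(t, \<eta>). h t \<eta> + real n * dist w (e \<eta>)) ` I n)" for n w
    by (rule bdd_belowI[of _ "- C"]) (use lower in \<open>auto simp: I_def\<close>)
  have K_le: "K n w \<le> h t \<eta> + real n * dist w (e \<eta>)" if "t \<ge> real n" "\<eta> \<in> S" for n w t \<eta>
    unfolding K_def using cINF_lower[OF bdd, of "(t, \<eta>)" n w] that by (auto simp: I_def)
  have K_ge: "- C \<le> K n w" for n w
    unfolding K_def by (rule cINF_greatest[OF Ine]) (use lower in \<open>auto simp: I_def\<close>)
  have K_lip: "K n w \<le> K n w' + real n * dist w w'" for n w w'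
  proof -
    have "K n w - real n * dist w w' \<le> K n w'"
      unfolding K_def[of n w']
    proof (rule cINF_greatest[OF Ine], clarify)
      fix t \<eta> assume "(t, \<eta>) \<in> I n"
      then have "K n w \<le> h t \<eta> + real n * dist w (e \<eta>)" by (intro K_le) (auto simp: I_def)
      moreover have "real n * dist w (e \<eta>) \<le> real n * (dist w w' + dist w' (e \<eta>))"
        by (intro mult_left_mono dist_triangle) auto
      ultimately show "K n w - real n * dist w w' \<le> h t \<eta> + real n * dist w' (e \<eta>)"
        by (simp add: algebra_simps)
    qed
    then show ?thesis by simp
  qed
  have K_cont: "continuous_on UNIV (K n)" for n
  proof -
    have "\<bar>K n w - K n w'\<bar> \<le> real n * dist w w'" for w w'
      using K_lip[of n w w'] K_lip[of n w' w] by (simp add: dist_commute)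
    then have "(real n)-lipschitz_on UNIV (K n)"
      by (intro lipschitz_onI) (auto simp: dist_real_def)
    then show ?thesis by (rule lipschitz_on_continuous_on)
  qed
  define H where "H n \<theta> = K n (e \<theta>)" for n \<theta>
  have H_cont: "continuous_map X euclideanreal (H n)" for n
    using continuous_map_pullback[of euclidean euclideanreal "K n" S e] K_cont[of n]
    by (simp add: X H_def[abs_def] comp_def)
  have H_le: "H n \<theta> \<le> h t \<theta>" if "\<theta> \<in> S" "t \<ge> real n" for n \<theta> t
    using K_le[OF that(2,1), of "e \<theta>"] by (simp add: H_def)
  have H_bd: "\<bar>H n \<theta>\<bar> \<le> C" if "\<theta> \<in> S" for n \<theta>
    using H_le[OF that order_refl, of n] bd[OF that, of "real n"] K_ge[of n "e \<theta>"] by (simp add: H_def)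
  have conv: "(\<lambda>n. H n \<theta>) \<longlonglongrightarrow> y"
    if \<theta>: "\<theta> \<in> S" and L: "\<And>t \<tau>. filterlim t at_top sequentially \<Longrightarrow> (\<And>n. \<tau> n \<in> S) \<Longrightarrow>
      limitin X \<tau> \<theta> sequentially \<Longrightarrow> (\<lambda>n. h (t n) (\<tau> n)) \<longlonglongrightarrow> y" for \<theta> y
  proof -
    \<comment> \<open>Near-minimizers of the infimum at \<open>\<theta>\<close>. As \<open>h\<close>
      is bounded by \<open>C\<close>, the penalty stays below \<open>2 * C + 1\<close>, so these
      points converge to \<open>\<theta>\<close> while their times exceed \<open>n\<close>.
      Continuous convergence then bounds \<open>H n \<theta>\<close> from below in the limit; the
      admissible pair of time \<open>n\<close> and point \<open>\<theta>\<close> bounds it from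
      above.\<close>
    have "\<exists>p\<in>I n. h (fst p) (snd p) + real n * dist (e \<theta>) (e (snd p)) < H n \<theta> + inverse (real (Suc n))" for n
      using cInf_lessD[of "(\<lambda>(t, \<eta>). h t \<eta> + real n * dist (e \<theta>) (e \<eta>)) ` I n"
          "H n \<theta> + inverse (real (Suc n))"] Ine
      by (auto simp: H_def K_def case_prod_unfold)
    then obtain p where p: "\<And>n. p n \<in> I n"
      "\<And>n. h (fst (p n)) (snd (p n)) + real n * dist (e \<theta>) (e (snd (p n))) < H n \<theta> + inverse (real (Suc n))"
      by metis
    have pt: "fst (p n) \<ge> real n" and pS: "snd (p n) \<in> S" for n using p(1)[of n] by (auto simp: I_def)
    have "filterlim (\<lambda>n. fst (p n)) at_top sequentially"
      using filterlim_at_top_mono[OF filterlim_real_sequentially] pt by simp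
    moreover have "limitin X (\<lambda>n. snd (p n)) \<theta> sequentially"
    proof -
      have le: "real n * dist (e \<theta>) (e (snd (p n))) \<le> 2 * C + 1" for n
      proof -
        have "inverse (real (Suc n)) \<le> 1" by (simp add: inverse_le_1_iff)
        then show ?thesis using p(2)[of n] H_bd[OF \<theta>, of n] bd[OF pS[of n], of "fst (p n)"] by linarith
      qed
      have ev: "\<forall>\<^sub>F n in sequentially. dist (e (snd (p n))) (e \<theta>) \<le> (2 * C + 1) / real n"
        using eventually_gt_at_top[of 0]
        by eventually_elim (use le in \<open>simp add: field_simps dist_commute\<close>)
      have "(\<lambda>n. dist (e (snd (p n))) (e \<theta>)) \<longlonglongrightarrow> 0"
        by (rule tendsto_sandwich[OF _ ev tendsto_const lim_const_over_n])
          (intro always_eventually allI zero_le_dist)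
      then have e_lim: "(\<lambda>n. e (snd (p n))) \<longlonglongrightarrow> e \<theta>" by (subst tendsto_dist_iff)
      show ?thesis unfolding limitin_def
      proof (intro conjI allI impI)
        fix W assume W: "openin X W \<and> \<theta> \<in> W"
        then have "\<exists>G. openin euclidean G \<and> W = e -` G \<inter> S"
          unfolding X openin_pullback_topology by (rule conjunct1)
        then obtain G where G: "openin euclidean G \<and> W = e -` G \<inter> S" ..
        then have "\<forall>\<^sub>F n in sequentially. e (snd (p n)) \<in> G"
          using W by (intro topological_tendstoD[OF e_lim]) auto
        then show "\<forall>\<^sub>F n in sequentially. snd (p n) \<in> W"
          by (rule eventually_mono) (use G pS in simp)
      qed (use \<theta> top in simp)
    qed
    ultimately have "(\<lambda>n. h (fst (p n)) (snd (p n))) \<longlonglongrightarrow> y"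
      by (rule L[OF _ pS])
    then have 1: "(\<lambda>n. h (fst (p n)) (snd (p n)) - inverse (real (Suc n))) \<longlonglongrightarrow> y"
      using tendsto_diff[OF _ LIMSEQ_inverse_real_of_nat] by (metis diff_zero)
    have 2: "(\<lambda>n. h (real n) \<theta>) \<longlonglongrightarrow> y"
      using L[of "\<lambda>n. real n" "\<lambda>_. \<theta>"] \<theta> top filterlim_real_sequentially by simp
    have 3: "h (fst (p n)) (snd (p n)) - inverse (real (Suc n)) \<le> H n \<theta>" for n
    proof -
      have "0 \<le> real n * dist (e \<theta>) (e (snd (p n)))" by simp
      then show ?thesis using p(2)[of n] by linarith
    qed
    show ?thesis
      by (rule tendsto_sandwich[OF _ _ 1 2]) (use 3 H_le[OF \<theta>] in auto)
  qed
  have H_int: "integrable Q (\<lambda>\<omega>. H n (b \<omega>))" for n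
    by (rule continuous_map_bounded_integrable[OF Q b H_cont]) (use H_bd top in blast)
  have "(\<lambda>n. \<integral>\<omega>. H n (b \<omega>) \<partial>Q) \<longlonglongrightarrow> integral\<^sup>L Q g"
  proof (rule integral_dominated_convergence[where w = "\<lambda>_. C"])
    show "AE \<omega> in Q. (\<lambda>n. H n (b \<omega>)) \<longlonglongrightarrow> g \<omega>"
      using lim AE_space
    proof eventually_elim
      case (elim \<omega>)
      show ?case by (rule conv[OF bS[OF elim(2)]]) (use elim(1) in blast)
    qed
    show "AE \<omega> in Q. norm (H n (b \<omega>)) \<le> C" for n
      using AE_space by eventually_elim (use H_bd bS in simp)
  qed (use g H_int in auto)
  then have "\<forall>\<^sub>F n in sequentially. integral\<^sup>L Q g - \<epsilon> < (\<integral>\<omega>. H n (b \<omega>) \<partial>Q)"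
    using \<epsilon> by (intro order_tendstoD) auto
  then obtain n where "integral\<^sup>L Q g - \<epsilon> < (\<integral>\<omega>. H n (b \<omega>) \<partial>Q)"
    by (auto simp: eventually_sequentially)
  then show thesis
    using H_cont[of n] H_bd[of _ n] H_le[of _ n] by (intro that[of "H n" "real n"]) auto
qed

section \<open>Time averages\<close>

text \<open>Times missing from \<open>N\<close> lie below \<open>t0\<close>. Their removal and the
  shift by \<open>s\<close> each alter the integral by a bounded amount, and the lengths
  \<open>T i\<close> tend to infinity.\<close>

lemma average_shift_lower_bound:
  fixes u v :: "real \<Rightarrow> real"
  assumes [measurable]: "u \<in> borel_measurable borel" "v \<in> borel_measurable borel" "N \<in> sets borel"
    and C: "\<And>t. \<bar>u t\<bar> \<le> C" "\<And>t. \<bar>v t\<bar> \<le> C"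
    and N: "{t0..} \<subseteq> N" and t0: "t0 \<ge> 0" and s: "s \<ge> 0"
    and uv: "\<And>t. t \<ge> t0 \<Longrightarrow> u t \<le> v (t + s)"
    and T: "filterlim T at_top F"
    and L: "((\<lambda>i. (LINT t:{0..T i}|lborel. u t) / T i) \<longlongrightarrow> L) F"
    and \<epsilon>: "\<epsilon> > 0"
  shows "\<forall>\<^sub>F i in F. L - \<epsilon> \<le> (LINT t:{0..T i} \<inter> N|lborel. v t) / measure lborel ({0..T i} \<inter> N)"
proof -
  have C0: "C \<ge> 0" using C(1)[of 0] by linarith
  \<comment> \<open>On \<open>{0..t0 + s}\<close> neither the comparison nor membership in
    \<open>N\<close> is available and both integrands are bounded by \<open>C\<close>, which costs
    \<open>2 * C * (t0 + s)\<close>. The shifted integral also runs over \<open>{T..T + s}\<close>,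
    which costs \<open>C * s\<close>.\<close>
  define K where "K = C * (2 * t0 + 3 * s)"
  have K0: "K \<ge> 0" using C0 t0 s by (simp add: K_def)
  have fin: "emeasure lborel A < \<infinity>" if "A \<subseteq> {a..b}" for A and a b :: real
  proof -
    have "emeasure lborel A \<le> emeasure lborel {a..b}" using that by (intro emeasure_mono) auto
    also have "\<dots> < \<infinity>" by (cases "a \<le> b") simp_all
    finally show ?thesis .
  qed
  have bd_int: "integrable lborel (\<lambda>t. indicator A t *\<^sub>R w t)"
    if [measurable]: "A \<in> sets borel" "w \<in> borel_measurable borel" and "A \<subseteq> {a..b}" "\<And>t. \<bar>w t\<bar> \<le> C"
    for A a b and w :: "real \<Rightarrow> real"
    by (rule integrableI_bounded_set_indicator[where B = C]) (use that fin[OF that(3)] in auto)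
  have main: "(LINT t:{0..T}|lborel. u t) - K \<le> (LINT t:{0..T} \<inter> N|lborel. v t)"
    if T: "T \<ge> t0 + s" for T
  proof -
    have "(LINT t:{0..T}|lborel. u t) = (LBINT t. indicator {0..T} (t - s) * u (t - s))"
      unfolding set_lebesgue_integral_def
      by (subst lborel_integral_real_affine[where c = 1 and t = "- s"]) (simp_all add: algebra_simps)
    also have "\<dots> = (LBINT t. indicator {s..T + s} t *\<^sub>R u (t - s))"
      by (intro Bochner_Integration.integral_cong) (auto simp: indicator_def)
    also have "\<dots> \<le> (LBINT t. indicator ({0..T} \<inter> N) t *\<^sub>R v t + (2 * C) * indicator {0..t0 + s} t
        + C * indicator {T..T + s} t)"
    proof (rule integral_mono)
      show "integrable lborel (\<lambda>t. indicator {s..T + s} t *\<^sub>R u (t - s))"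
        by (rule bd_int) (use C in auto)
      show "integrable lborel (\<lambda>t. indicator ({0..T} \<inter> N) t *\<^sub>R v t + (2 * C) * indicator {0..t0 + s} t
        + C * indicator {T..T + s} t)"
        by (intro Bochner_Integration.integrable_add bd_int[where a = 0 and b = T] integrable_mult_right
            integrable_real_indicator fin) (use C in auto)
      fix t :: real
      consider "t < s" | "s \<le> t" "t < t0 + s" | "t0 + s \<le> t" "t \<le> T" | "T < t" "t \<le> T + s" | "T + s < t"
        by linarith
      then show "indicator {s..T + s} t *\<^sub>R u (t - s)
        \<le> indicator ({0..T} \<inter> N) t *\<^sub>R v t + (2 * C) * indicator {0..t0 + s} t + C * indicator {T..T + s} t"
      proof cases
        case 1
        then show ?thesis using C(2)[of t] C0 T t0 s by (auto simp: indicator_def)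
      next
        case 2
        then show ?thesis using C(2)[of t] C(1)[of "t - s"] C0 T t0 s by (auto simp: indicator_def)
      next
        case 3
        then have "t \<in> N" using N s by auto
        then show ?thesis using 3 uv[of "t - s"] C0 T t0 s by (auto simp: indicator_def)
      next
        case 4
        then show ?thesis using C(1)[of "t - s"] C0 T t0 s by (auto simp: indicator_def)
      next
        case 5
        then show ?thesis using C0 T t0 s by (auto simp: indicator_def)
      qed
    qed
    also have "\<dots> = (LINT t:{0..T} \<inter> N|lborel. v t) + 2 * C * (t0 + s) + C * s"
    proof -
      have "integrable lborel (\<lambda>t. indicator ({0..T} \<inter> N) t *\<^sub>R v t)"
        by (rule bd_int[where a = 0 and b = T]) (use C in auto)
      then show ?thesis
        using t0 s by (simp add: set_lebesgue_integral_def)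
    qed
    finally show ?thesis by (simp add: K_def algebra_simps)
  qed
  have J_bd: "\<bar>LINT t:{0..T}|lborel. u t\<bar> \<le> C * T" if "T \<ge> 0" for T
  proof -
    have "\<bar>LINT t:{0..T}|lborel. u t\<bar> \<le> (LBINT t. \<bar>indicator {0..T} t *\<^sub>R u t\<bar>)"
      unfolding set_lebesgue_integral_def by (rule integral_abs_bound)
    also have "\<dots> \<le> (LBINT t. C * indicator {0..T} t)"
    proof (rule integral_mono)
      show "integrable lborel (\<lambda>t. \<bar>indicator {0..T} t *\<^sub>R u t\<bar>)"
        by (intro integrable_abs bd_int[where a = 0 and b = T]) (use C in auto)
      show "integrable lborel (\<lambda>t. C * indicator {0..T} t)"
        by (intro integrable_mult_right integrable_real_indicator fin[where a = 0 and b = T]) auto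
    qed (use C in \<open>auto simp: indicator_def\<close>)
    finally have "\<bar>LINT t:{0..T}|lborel. u t\<bar> \<le> (LBINT t. C * indicator {0..T} t)" .
    then show ?thesis using that by simp
  qed
  have m_bd: "T - t0 \<le> measure lborel ({0..T} \<inter> N)" "measure lborel ({0..T} \<inter> N) \<le> T"
    if "T \<ge> t0" for T
  proof -
    have "measure lborel {t0..T} \<le> measure lborel ({0..T} \<inter> N)"
      by (rule measure_mono_fmeasurable)
        (use N t0 in \<open>auto simp: fmeasurable_def intro!: fin[where a = 0 and b = T, unfolded infinity_ennreal_def]\<close>)
    then show "T - t0 \<le> measure lborel ({0..T} \<inter> N)" using that by simp
    have "measure lborel ({0..T} \<inter> N) \<le> measure lborel {0..T}"
      by (rule measure_mono_fmeasurable)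
        (auto simp: fmeasurable_def intro!: fin[where a = 0 and b = T, unfolded infinity_ennreal_def])
    then show "measure lborel ({0..T} \<inter> N) \<le> T" using that t0 by simp
  qed
  have "\<forall>\<^sub>F i in F. T i \<ge> t0 + s + 1 + 2 * (C * t0 + K) / \<epsilon>"
    using T by (simp add: filterlim_at_top)
  moreover have "\<forall>\<^sub>F i in F. L - \<epsilon> / 2 < (LINT t:{0..T i}|lborel. u t) / T i"
    using L \<epsilon> by (intro order_tendstoD) auto
  ultimately show ?thesis
  proof eventually_elim
    case (elim i)
    define J where "J = (LINT t:{0..T i}|lborel. u t)"
    define I where "I = (LINT t:{0..T i} \<inter> N|lborel. v t)"
    define m where "m = measure lborel ({0..T i} \<inter> N)"
    \<comment> \<open>The threshold on \<open>T i\<close> makes the total error at most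
      \<open>\<epsilon> / 2\<close> times the length \<open>m\<close>: \<open>K\<close> comes from
      the comparison of the integrals, and \<open>C * t0\<close> from replacing \<open>T i\<close>
      by \<open>m\<close>, which differ by at most \<open>t0\<close>. The summand \<open>1\<close>
      keeps \<open>m\<close> positive.\<close>
    have "2 * (C * t0 + K) / \<epsilon> \<ge> 0" using C0 t0 K0 \<epsilon> by simp
    then have Ti: "T i \<ge> t0 + s" "T i \<ge> t0" "T i > 0" "T i - t0 \<ge> 1"
      "T i - t0 \<ge> 2 * (C * t0 + K) / \<epsilon>" using elim(1) t0 s by linarith+
    have m: "T i - t0 \<le> m" "m \<le> T i" "m > 0" using m_bd[OF Ti(2)] Ti(4) by (auto simp: m_def)
    have "J - K \<le> I" using main[OF Ti(1)] by (simp add: I_def J_def)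
    have "\<bar>J / T i\<bar> \<le> C" using J_bd[of "T i"] Ti(3) by (simp add: J_def field_simps abs_le_iff)
    have "J = J / T i * m + J / T i * (T i - m)" using Ti(3) by (simp add: field_simps)
    also have "\<dots> \<ge> J / T i * m - C * t0"
    proof -
      have "\<bar>J / T i * (T i - m)\<bar> \<le> C * t0"
        unfolding abs_mult using \<open>\<bar>J / T i\<bar> \<le> C\<close> m C0 by (intro mult_mono) auto
      then show ?thesis by linarith
    qed
    finally have 1: "I \<ge> J / T i * m - (C * t0 + K)" using \<open>J - K \<le> I\<close> by linarith
    have "2 * (C * t0 + K) / \<epsilon> \<le> m" using Ti(5) m(1) by linarith
    then have 2: "C * t0 + K \<le> \<epsilon> / 2 * m" using \<epsilon> by (simp add: field_simps)
    have "(L - \<epsilon> / 2) * m \<le> J / T i * m" using elim(2) m(3) by (intro mult_right_mono) (auto simp: J_def)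
    then have "(L - \<epsilon>) * m \<le> I" using 1 2 by (simp add: algebra_simps)
    then show ?case using m(3) by (simp add: field_simps I_def m_def)
  qed
qed

lemma integral_uniform_measure:
  fixes f :: "'a \<Rightarrow> real"
  assumes [measurable]: "f \<in> borel_measurable M" "A \<in> sets M"
    and A: "emeasure M A \<noteq> 0" "emeasure M A \<noteq> \<infinity>"
  shows "integral\<^sup>L (uniform_measure M A) f = (LINT x:A|M. f x) / measure M A"
proof -
  have m: "measure M A > 0" "emeasure M A = ennreal (measure M A)"
    using A by (auto simp: emeasure_eq_ennreal_measure measure_nonneg zero_less_measure_iff top_unique)
  have "uniform_measure M A = density M (\<lambda>x. ennreal (indicator A x / measure M A))"
    unfolding uniform_measure_def using m
    by (intro density_cong) (auto simp: indicator_def divide_ennreal[symmetric] ennreal_1)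
  also have "integral\<^sup>L \<dots> f = (\<integral>x. (indicator A x / measure M A) *\<^sub>R f x \<partial>M)"
    by (rule integral_density) (auto simp: m(1) less_imp_le)
  also have "\<dots> = (\<integral>x. indicator A x * f x / measure M A \<partial>M)" by simp
  also have "\<dots> = (LINT x:A|M. f x) / measure M A"
    unfolding set_lebesgue_integral_def by (simp del: times_divide_eq_left)
  finally show ?thesis .
qed

section \<open>Restriction and normalization\<close>

lemma B1_iff: "z \<in> B1 \<longleftrightarrow> infnorm z \<le> 1"
  by (simp add: sup_cball_def)

lemma closed_infnorm_le [simp]: "closed {z :: 'a::euclidean_space. infnorm z \<le> r}"
  by (intro closed_Collect_le continuous_intros)

lemma compact_infnorm_le [simp]: "compact {z :: 'a::euclidean_space. infnorm z \<le> r}"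
proof -
  have "norm z \<le> sqrt DIM('a) * r" if "infnorm z \<le> r" for z :: 'a
    using norm_le_infnorm[of z] mult_left_mono[OF that, of "sqrt DIM('a)"] by (meson order_trans real_sqrt_ge_zero of_nat_0_le_iff)
  then have "bounded {z :: 'a. infnorm z \<le> r}" unfolding bounded_iff by blast
  then show ?thesis by (simp add: compact_eq_bounded_closed)
qed

lemma B1_alt: "B1 = {z. infnorm z \<le> 1}"
  by (simp add: sup_cball_def)

lemma compact_B1 [simp]: "compact (B1 :: (real ^ 'd) set)" and closed_B1 [simp]: "closed (B1 :: (real ^ 'd) set)"
  by (simp_all add: B1_alt)

lemma borel_B1 [measurable, simp]: "(B1 :: (real ^ 'd) set) \<in> sets borel"
  by (simp add: borel_closed)

lemma zero_in_B1 [simp]: "0 \<in> (B1 :: (real ^ 'd) set)"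
  by (simp add: B1_alt infnorm_0)

lemma convex_B1: "convex (B1 :: (real ^ 'd) set)"
  unfolding B1_alt
proof (rule convexI)
  fix x y :: "real ^ 'd" and u v :: real
  assume xy: "x \<in> {z. infnorm z \<le> 1}" "y \<in> {z. infnorm z \<le> 1}" and uv: "0 \<le> u" "0 \<le> v" "u + v = 1"
  have "infnorm (u *\<^sub>R x + v *\<^sub>R y) \<le> u * infnorm x + v * infnorm y"
    using infnorm_triangle[of "u *\<^sub>R x" "v *\<^sub>R y"] uv by (simp add: infnorm_mul)
  also have "\<dots> \<le> u * 1 + v * 1" using xy uv by (intro add_mono mult_left_mono) auto
  finally show "u *\<^sub>R x + v *\<^sub>R y \<in> {z. infnorm z \<le> 1}" using uv by simp
qed

lemma measurable_infnorm [measurable]: "infnorm \<in> borel_measurable (borel :: (real ^ 'd) measure)"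
  by (intro borel_measurable_continuous_onI continuous_intros)

lemma sets_star [simp]: "sets M = sets borel \<Longrightarrow> sets (star M) = sets borel"
  by (simp add: star_def)

lemma space_of_sets_borel: "sets M = sets borel \<Longrightarrow> space M = UNIV"
  using sets_eq_imp_space_eq[of M borel] by simp

lemma emeasure_star:
  assumes "normalizable M"
  shows "emeasure (star M) E = inverse (emeasure M B1) * emeasure M E"
  using assms by (simp add: star_def)

text \<open>No side condition is needed, as the default Dirac mass at \<open>0\<close> is carried by
  \<open>B1\<close>.\<close>

lemma emeasure_star_B1:
  fixes M :: "(real ^ 'd) measure"
  shows "emeasure (star M) B1 = 1"
proof (cases "normalizable M")
  case True
  then show ?thesis
    unfolding emeasure_star[OF True] normalizable_def
    by (auto simp: ennreal_inverse_positive mult.commute ennreal_divide_self divide_ennreal_def[symmetric] less_top)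
next
  case False
  then show ?thesis by (simp add: star_def)
qed

lemma topspace_Mstar: "topspace Mstar = {\<mu> \<in> radon. emeasure \<mu> B1 = 1}"
  by (auto simp: Mstar_def radon_topology_def)

lemma star_in_Mstar:
  assumes "M \<in> radon"
  shows "star M \<in> topspace Mstar"
proof -
  have "emeasure (star M) K < \<infinity>" if K: "compact K" for K
  proof (cases "normalizable M")
    case True
    then have "inverse (emeasure M B1) < \<infinity>" "emeasure M K < \<infinity>"
      using assms K by (auto simp: normalizable_def radon_def less_top[symmetric] ennreal_inverse_eq_top_iff)
    then show ?thesis by (simp add: emeasure_star[OF True] ennreal_mult_less_top)
  next
    case False
    then show ?thesis
      using K by (auto simp: star_def compact_imp_closed borel_closed indicator_def)
  qed
  moreover have "sets M = sets borel" using assms by (simp add: radon_def)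
  ultimately show ?thesis by (simp add: topspace_Mstar radon_def emeasure_star_B1)
qed

lemma topspace_Mbox: "topspace (Mbox :: (real ^ 'd) measure topology)
    = {\<theta>. sets \<theta> = sets (restrict_space borel B1) \<and> prob_space \<theta>}"
  by (simp add: Mbox_def weak_topology_def prob_measures_def sets_borel_of_top_of_set)

lemma emeasure_box:
  fixes M :: "(real ^ 'd) measure"
  assumes "sets M = sets borel" "normalizable M" "E \<subseteq> B1"
  shows "emeasure (box M) E = inverse (emeasure M B1) * emeasure M E"
  unfolding box_def
  using assms by (subst emeasure_restrict_space) (simp_all add: emeasure_star space_of_sets_borel)

lemma sets_box: "sets M = sets borel \<Longrightarrow> sets (box M) = sets (restrict_space borel B1)"
  unfolding box_def by (rule sets_restrict_space_cong) simp

lemma space_box: "sets M = sets borel \<Longrightarrow> space (box M) = B1"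
  using sets_eq_imp_space_eq[OF sets_box] by (simp add: space_restrict_space)

lemma box_in_Mbox:
  fixes M :: "(real ^ 'd) measure"
  assumes M: "sets M = sets borel"
  shows "box M \<in> topspace Mbox"
proof -
  have "emeasure (box M) (space (box M)) = emeasure (star M) B1"
    unfolding space_box[OF M] unfolding box_def using M
    by (subst emeasure_restrict_space) (simp_all add: space_of_sets_borel)
  then have "prob_space (box M)" by (intro prob_spaceI) (simp add: emeasure_star_B1)
  then show ?thesis using M by (simp add: topspace_Mbox sets_box)
qed

text \<open>\<open>box\<close> sees a measure only on \<open>B1\<close> and only up to a constant.
  Identities between sceneries can thus be proved set by set inside \<open>B1\<close>, without
  tracking normalizations; if one measure cannot be normalized, neither can the other, and both give
  the default value.\<close>

lemma box_cong_scaled: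
  fixes M N :: "(real ^ 'd) measure"
  assumes M: "sets M = sets borel" and N: "sets N = sets borel" and c: "c \<noteq> 0" "c \<noteq> \<infinity>"
    and eq: "\<And>E. E \<in> sets borel \<Longrightarrow> E \<subseteq> B1 \<Longrightarrow> emeasure M E = c * emeasure N E"
  shows "box M = box N"
proof (cases "normalizable N")
  case True
  have eB: "emeasure M B1 = c * emeasure N B1" by (rule eq) auto
  then have nM: "normalizable M"
    using True c by (auto simp: normalizable_def ennreal_zero_less_mult_iff ennreal_mult_less_top less_top zero_less_iff_neq_zero)
  have B: "emeasure N B1 \<noteq> 0" "emeasure N B1 \<noteq> \<infinity>" using True by (auto simp: normalizable_def)
  show ?thesis
  proof (rule measure_eqI)
    show "sets (box M) = sets (box N)" using M N by (simp add: sets_box)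
    fix E assume "E \<in> sets (box M)"
    then have E: "E \<in> sets borel" "E \<subseteq> B1" using M by (auto simp: sets_box sets_restrict_space_iff)
    have "emeasure (box M) E = inverse (c * emeasure N B1) * (c * emeasure N E)"
      using M E nM by (simp add: emeasure_box eq eB)
    also have "\<dots> = (inverse c * c) * (inverse (emeasure N B1) * emeasure N E)"
      using c B by (subst ennreal_inverse_mult) (auto simp: less_top ac_simps)
    also have "inverse c * c = 1"
      using c by (metis ennreal_divide_self divide_ennreal_def infinity_ennreal_def less_top mult.commute zero_less_iff_neq_zero)
    finally show "emeasure (box M) E = emeasure (box N) E"
      using N E True by (simp add: emeasure_box)
  qed
next
  case False
  have eB: "emeasure M B1 = c * emeasure N B1" by (rule eq) auto
  then have "\<not> normalizable M"
    using False c by (auto simp: normalizable_def ennreal_zero_less_mult_iff ennreal_mult_less_top zero_less_iff_neq_zero less_top)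
  with False show ?thesis by (simp add: box_def star_def)
qed

lemma integral_box:
  fixes M :: "(real ^ 'd) measure" and \<psi> :: "real ^ 'd \<Rightarrow> real"
  assumes M: "sets M = sets borel" "normalizable M" and \<psi>: "continuous_on B1 \<psi>"
  shows "integral\<^sup>L (box M) \<psi> = (LINT z:B1|M. \<psi> z) / measure M B1"
proof -
  have meas: "(\<lambda>z. indicator B1 z *\<^sub>R \<psi> z) \<in> borel_measurable borel"
    by (intro borel_measurable_continuous_on_indicator \<psi>) simp
  have B: "emeasure M B1 = ennreal (measure M B1)" "measure M B1 > 0"
    using M(2) by (auto simp: normalizable_def emeasure_eq_ennreal_measure zero_less_measure_iff top_unique less_top)
  have "star M = density M (\<lambda>_. ennreal (inverse (measure M B1)))"
  proof (rule measure_eqI)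
    fix E assume "E \<in> sets (star M)"
    then have "E \<in> sets M" using M by simp
    then show "emeasure (star M) E = emeasure (density M (\<lambda>_. ennreal (inverse (measure M B1)))) E"
      using B by (simp add: emeasure_star M(2) emeasure_density_const inverse_ennreal)
  qed (simp add: M)
  moreover have "integral\<^sup>L (box M) \<psi> = (\<integral>z. indicator B1 z *\<^sub>R \<psi> z \<partial>star M)"
    unfolding box_def using M by (subst integral_restrict_space) (simp_all add: space_of_sets_borel)
  moreover have "(\<integral>z. indicator B1 z *\<^sub>R \<psi> z \<partial>density M (\<lambda>_. ennreal (inverse (measure M B1))))
      = (\<integral>z. inverse (measure M B1) *\<^sub>R (indicator B1 z *\<^sub>R \<psi> z) \<partial>M)"
    using B M meas by (intro integral_density) (simp_all cong: measurable_cong_sets)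
  ultimately show ?thesis
    by (simp only: set_lebesgue_integral_def integral_scaleR_right) (simp add: field_simps)
qed

section \<open>Measurability of normalization\<close>

lemma radonD:
  assumes "\<mu> \<in> radon"
  shows "sets \<mu> = sets borel" "compact K \<Longrightarrow> emeasure \<mu> K < \<infinity>" "space \<mu> = UNIV"
  using assms by (auto simp: radon_def space_of_sets_borel)

lemma integrable_C_compact:
  fixes \<mu> :: "(real ^ 'd) measure"
  assumes \<mu>: "\<mu> \<in> radon" and \<phi>: "\<phi> \<in> C_compact"
  shows "integrable \<mu> \<phi>"
proof -
  obtain N C where N: "\<And>z. norm z > real N \<Longrightarrow> \<phi> z = 0" and C: "\<And>z. \<bar>\<phi> z\<bar> \<le> C"
    by (rule C_compact_bounds[OF \<phi>]) blast
  have "\<phi> \<in> borel_measurable \<mu>"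
    using \<phi> radonD(1)[OF \<mu>]
    by (auto simp: C_compact_def cong: measurable_cong_sets intro: borel_measurable_continuous_onI)
  then show ?thesis
    using radonD[OF \<mu>] C N
    by (intro integrableI_bounded_set[where A = "cball 0 (real N)" and B = C]) (auto simp: not_le)
qed

lemma radon_topology_pullback:
  assumes \<psi>: "test_sequence \<psi>"
  shows "radon_topology = pullback_topology radon (\<lambda>\<mu> k. integral\<^sup>L \<mu> (\<psi> k)) euclidean"
  unfolding radon_topology_def C_compact_def[symmetric]
proof (rule test_topology_eq_pullback)
  fix \<phi> :: "real ^ 'a \<Rightarrow> real" assume "\<phi> \<in> C_compact"
  then have "\<exists>m. \<forall>\<epsilon>>0. \<exists>k. \<forall>z. \<bar>\<phi> z - \<psi> k z\<bar> \<le> \<epsilon> * \<psi> m z"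
    using \<psi> by (simp add: test_sequence_def)
  then show "\<exists>m. \<forall>\<epsilon>>0. \<exists>k. \<forall>\<mu>\<in>radon. \<forall>z\<in>space \<mu>. \<bar>\<phi> z - \<psi> k z\<bar> \<le> \<epsilon> * \<psi> m z"
    by meson
qed (use \<psi> in \<open>auto simp: test_sequence_def integrable_C_compact\<close>)

lemma openin_Mstar_pullback:
  assumes \<psi>: "test_sequence \<psi>" and W: "openin Mstar W"
  shows "\<exists>G. open G \<and> W = (\<lambda>\<mu> k. integral\<^sup>L \<mu> (\<psi> k)) -` G \<inter> topspace Mstar"
proof -
  obtain W' where W': "openin radon_topology W'" "W = W' \<inter> {\<mu>. emeasure \<mu> B1 = 1}"
    using W unfolding Mstar_def openin_subtopology by blast
  then obtain G where "open G" "W' = (\<lambda>\<mu> k. integral\<^sup>L \<mu> (\<psi> k)) -` G \<inter> radon"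
    unfolding radon_topology_pullback[OF \<psi>] openin_pullback_topology open_openin[symmetric] by blast
  then show ?thesis using W'(2) by (intro exI[of _ G]) (auto simp: topspace_Mstar)
qed

section \<open>Topology and test functions on the restricted measures\<close>

lemma Mbox_spaceD:
  fixes \<theta> :: "(real ^ 'd) measure"
  assumes "\<theta> \<in> topspace Mbox"
  shows "prob_space \<theta>" "sets \<theta> = sets (restrict_space borel B1)" "space \<theta> = B1"
  using assms sets_eq_imp_space_eq[of \<theta> "restrict_space borel B1"]
  by (auto simp: topspace_Mbox space_restrict_space)

lemma bounded_continuous_on_B1:
  fixes \<phi> :: "real ^ 'd \<Rightarrow> real"
  assumes "continuous_on B1 \<phi>"
  shows "\<exists>C. \<forall>z\<in>B1. \<bar>\<phi> z\<bar> \<le> C"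
proof -
  have "bounded (\<phi> ` B1)"
    by (intro compact_imp_bounded compact_continuous_image assms compact_B1)
  then obtain C where "\<forall>x\<in>\<phi> ` B1. norm x \<le> C" unfolding bounded_iff ..
  then show ?thesis by (intro exI[of _ C]) auto
qed

lemma integrable_Mbox:
  fixes \<theta> :: "(real ^ 'd) measure"
  assumes \<theta>: "\<theta> \<in> topspace Mbox" and \<phi>: "continuous_on B1 \<phi>"
  shows "integrable \<theta> (\<phi> :: _ \<Rightarrow> real)"
proof -
  interpret prob_space \<theta> using \<theta> by (rule Mbox_spaceD)
  obtain C where C: "\<forall>z\<in>B1. \<bar>\<phi> z\<bar> \<le> C" using bounded_continuous_on_B1[OF \<phi>] ..
  have "\<phi> \<in> borel_measurable \<theta>"
    using borel_measurable_continuous_on_restrict[OF \<phi>] Mbox_spaceD(2)[OF \<theta>]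
    by (simp cong: measurable_cong_sets)
  then show ?thesis
    using C Mbox_spaceD(3)[OF \<theta>] by (intro integrable_const_bound[of _ C]) auto
qed

text \<open>Boundedness in the definition of the weak topology is automatic because
  \<open>B1\<close> is compact.\<close>

lemma Mbox_eq_test_topology:
  "Mbox = test_topology (topspace Mbox) {\<phi> :: real ^ 'd \<Rightarrow> real. continuous_on B1 \<phi>}"
proof -
  have "{\<phi> :: real ^ 'd \<Rightarrow> real. continuous_map (top_of_set B1) euclideanreal \<phi> \<and> bounded (\<phi> ` topspace (top_of_set B1))}
      = {\<phi>. continuous_on B1 \<phi>}"
    using compact_imp_bounded[OF compact_continuous_image[OF _ compact_B1]] by auto
  then show ?thesis
    unfolding Mbox_def weak_topology_def by simp
qed

lemma limitin_Mbox:
  "limitin Mbox \<tau> (\<theta> :: (real ^ 'd) measure) F \<longleftrightarrow> \<theta> \<in> topspace Mbox \<and> (\<forall>\<^sub>F i in F. \<tau> i \<in> topspace Mbox) \<and>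
     (\<forall>\<phi> :: real ^ 'd \<Rightarrow> real. continuous_on B1 \<phi> \<longrightarrow> ((\<lambda>i. integral\<^sup>L (\<tau> i) \<phi>) \<longlongrightarrow> integral\<^sup>L \<theta> \<phi>) F)"
  by (subst Mbox_eq_test_topology, subst limitin_test_topology) simp

text \<open>As \<open>B1\<close> is convex and closed, the closest-point map is a Lipschitz
  retraction onto it, and \<open>\<phi>\<close> is uniformly continuous on the compact set
  \<open>B1\<close>. The extension allows test functions on \<open>B1\<close> to be composed with
  maps whose values leave \<open>B1\<close>.\<close>

lemma B1_extension:
  fixes \<phi> :: "real ^ 'd \<Rightarrow> real"
  assumes \<phi>: "continuous_on B1 \<phi>"
  shows "uniformly_continuous_on UNIV (\<lambda>z. \<phi> (closest_point B1 z))"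
    "\<And>z :: real ^ 'd. z \<in> B1 \<Longrightarrow> closest_point B1 z = z"
    "\<And>z :: real ^ 'd. closest_point B1 z \<in> B1"
proof -
  have ne: "(B1 :: (real ^ 'd) set) \<noteq> {}" using zero_in_B1 by blast
  show in_B1: "closest_point B1 z \<in> B1" for z :: "real ^ 'd"
    by (rule closest_point_in_set) (use ne in auto)
  show "closest_point B1 z = z" if "z \<in> B1" for z :: "real ^ 'd" using that by (rule closest_point_self)
  have "uniformly_continuous_on UNIV (closest_point (B1 :: (real ^ 'd) set))"
    unfolding uniformly_continuous_on_def
    using closest_point_lipschitz[OF convex_B1 closed_B1 ne] by (meson le_less_trans)
  moreover have "uniformly_continuous_on (closest_point B1 ` UNIV) \<phi>"
    using compact_uniformly_continuous[OF \<phi> compact_B1] in_B1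
    unfolding uniformly_continuous_on_def by (metis imageE)
  ultimately show "uniformly_continuous_on UNIV (\<lambda>z. \<phi> (closest_point B1 z))"
    by (rule uniformly_continuous_on_compose)
qed

text \<open>Extending \<open>\<phi>\<close> by the retraction and multiplying by a cutoff equal to
  \<open>1\<close> on \<open>B1\<close> gives a function in \<open>C_compact\<close> that agrees
  with \<open>\<phi>\<close> on \<open>B1\<close>. Hence one test sequence serves both spaces of
  measures.\<close>

lemma Mbox_pullback:
  assumes \<psi>: "test_sequence \<psi>"
  shows "Mbox = pullback_topology (topspace Mbox) (\<lambda>\<mu> k. integral\<^sup>L \<mu> (\<psi> k :: real ^ 'd \<Rightarrow> real)) euclidean"
proof -
  have "test_topology (topspace Mbox) {\<phi> :: real ^ 'd \<Rightarrow> real. continuous_on B1 \<phi>}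
    = pullback_topology (topspace Mbox) (\<lambda>\<mu> k. integral\<^sup>L \<mu> (\<psi> k)) euclidean"
  proof (rule test_topology_eq_pullback)
    show "\<psi> k \<in> {\<phi>. continuous_on B1 \<phi>}" for k
      using \<psi> by (auto simp: test_sequence_def C_compact_def intro: continuous_on_subset)
    fix \<phi> :: "real ^ 'd \<Rightarrow> real" assume "\<phi> \<in> {\<phi>. continuous_on B1 \<phi>}"
    then have \<phi>: "continuous_on B1 \<phi>" by simp
    obtain r where r: "\<And>z :: real ^ 'd. z \<in> B1 \<Longrightarrow> norm z \<le> r"
      using compact_imp_bounded[OF compact_B1] unfolding bounded_iff by blast
    define \<phi>' where "\<phi>' z = \<phi> (closest_point B1 z) * cutoff r z" for z
    have "\<phi>' \<in> C_compact"
      unfolding \<phi>'_def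
      by (intro C_compactI[of _ "r + 1"] continuous_intros
          uniformly_continuous_imp_continuous[OF B1_extension(1)[OF \<phi>]]) (simp add: cutoff_simps)
    then have "\<exists>m. \<forall>\<epsilon>>0. \<exists>k. \<forall>z. \<bar>\<phi>' z - \<psi> k z\<bar> \<le> \<epsilon> * \<psi> m z"
      using \<psi> by (simp add: test_sequence_def)
    moreover have "\<phi>' z = \<phi> z" if "\<theta> \<in> topspace Mbox" "z \<in> space \<theta>" for \<theta> z
      using that r[of z] B1_extension(2)[OF \<phi>, of z]
      by (simp add: \<phi>'_def Mbox_spaceD(3) cutoff_simps)
    ultimately show "\<exists>m. \<forall>\<epsilon>>0. \<exists>k. \<forall>\<theta>\<in>topspace Mbox. \<forall>z\<in>space \<theta>. \<bar>\<phi> z - \<psi> k z\<bar> \<le> \<epsilon> * \<psi> m z"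
      by metis
  qed (simp add: integrable_Mbox)
  then show ?thesis using Mbox_eq_test_topology by metis
qed

text \<open>Measurability of the kernel is expressed through its masses of sets, so the measures
  \<open>\<kappa> m\<close> may be infinite. The claim extends from indicators by linearity and
  monotone limits.\<close>

lemma nn_integral_kernel_measurable:
  assumes sets: "\<And>m. m \<in> space M \<Longrightarrow> sets (\<kappa> m) = sets N"
    and emeas: "\<And>E. E \<in> sets N \<Longrightarrow> (\<lambda>m. emeasure (\<kappa> m) E) \<in> borel_measurable M"
    and f: "f \<in> borel_measurable N"
  shows "(\<lambda>m. \<integral>\<^sup>+z. f z \<partial>\<kappa> m) \<in> borel_measurable M"
  using f
proof (induction f rule: borel_measurable_induct)
  case (cong f g)
  have "(\<integral>\<^sup>+z. f z \<partial>\<kappa> m) = (\<integral>\<^sup>+z. g z \<partial>\<kappa> m)" if "m \<in> space M" for m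
    using cong(3) sets_eq_imp_space_eq[OF sets[OF that]] by (intro nn_integral_cong) simp
  then show ?case using cong(4) by (simp cong: measurable_cong)
next
  case (set A)
  then show ?case using emeas[of A] sets by (simp cong: measurable_cong)
next
  case (mult u c)
  have "(\<integral>\<^sup>+z. c * u z \<partial>\<kappa> m) = c * (\<integral>\<^sup>+z. u z \<partial>\<kappa> m)" if "m \<in> space M" for m
    using mult sets[OF that] by (intro nn_integral_cmult) (simp cong: measurable_cong_sets)
  then show ?case using mult by (simp cong: measurable_cong)
next
  case (add u v)
  have "(\<integral>\<^sup>+z. v z + u z \<partial>\<kappa> m) = (\<integral>\<^sup>+z. v z \<partial>\<kappa> m) + (\<integral>\<^sup>+z. u z \<partial>\<kappa> m)" if "m \<in> space M" for m
    using add sets[OF that] by (intro nn_integral_add) (simp_all cong: measurable_cong_sets)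
  then show ?case using add by (simp cong: measurable_cong)
next
  case (seq U)
  have "(\<integral>\<^sup>+z. (SUP i. U i) z \<partial>\<kappa> m) = (SUP i. \<integral>\<^sup>+z. U i z \<partial>\<kappa> m)" if "m \<in> space M" for m
    unfolding SUP_apply using seq sets[OF that]
    by (intro nn_integral_monotone_convergence_SUP) (simp_all cong: measurable_cong_sets)
  then show ?case using seq by (simp cong: measurable_cong)
qed

lemma integral_kernel_measurable:
  fixes f :: "'b \<Rightarrow> real"
  assumes sets: "\<And>m. m \<in> space M \<Longrightarrow> sets (\<kappa> m) = sets N"
    and emeas: "\<And>E. E \<in> sets N \<Longrightarrow> (\<lambda>m. emeasure (\<kappa> m) E) \<in> borel_measurable M"
    and f: "f \<in> borel_measurable N"
    and int: "\<And>m. m \<in> space M \<Longrightarrow> integrable (\<kappa> m) f"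
  shows "(\<lambda>m. integral\<^sup>L (\<kappa> m) f) \<in> borel_measurable M"
proof -
  have "(\<lambda>m. enn2real (\<integral>\<^sup>+z. ennreal (f z) \<partial>\<kappa> m) - enn2real (\<integral>\<^sup>+z. ennreal (- f z) \<partial>\<kappa> m))
      \<in> borel_measurable M"
    using f by (intro borel_measurable_diff borel_measurable_enn2real
        nn_integral_kernel_measurable[OF sets emeas]) auto
  then show ?thesis using int by (simp add: real_lebesgue_integral_def cong: measurable_cong)
qed

lemma normalizable_measurable:
  assumes "(\<lambda>m. emeasure (\<kappa> m) B1) \<in> borel_measurable M"
  shows "{m \<in> space M. normalizable (\<kappa> m)} \<in> sets M"
  using assms unfolding normalizable_def by measurable

lemma star_emeasure_measurable:
  assumes emeas: "\<And>E. E \<in> sets borel \<Longrightarrow> (\<lambda>m. emeasure (\<kappa> m) E) \<in> borel_measurable M"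
    and E: "E \<in> sets borel"
  shows "(\<lambda>m. emeasure (star (\<kappa> m)) E) \<in> borel_measurable M"
proof -
  have "emeasure (star (\<kappa> m)) E = (if normalizable (\<kappa> m)
      then inverse (emeasure (\<kappa> m) B1) * emeasure (\<kappa> m) E else indicator E 0)" for m
    using E by (simp add: emeasure_star) (simp add: star_def)
  moreover have "(\<lambda>m. if normalizable (\<kappa> m)
      then inverse (emeasure (\<kappa> m) B1) * emeasure (\<kappa> m) E else indicator E 0) \<in> borel_measurable M"
  proof (rule measurable_If)
    note [measurable] = emeas[OF E] emeas[OF borel_B1]
    show "(\<lambda>m. inverse (emeasure (\<kappa> m) B1) * emeasure (\<kappa> m) E) \<in> borel_measurable M"
      by measurable
  qed (simp_all add: normalizable_measurable emeas)
  ultimately show ?thesis by presburger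
qed

text \<open>Measurable masses make every integral of \<open>\<psi> k\<close> measurable, and these
  countably many integrals determine the open sets of \<open>Mstar\<close>.\<close>

lemma star_measurable:
  fixes \<kappa> :: "'a \<Rightarrow> (real ^ 'd) measure"
  assumes \<kappa>: "\<And>m. m \<in> space M \<Longrightarrow> \<kappa> m \<in> radon"
    and emeas: "\<And>E. E \<in> sets borel \<Longrightarrow> (\<lambda>m. emeasure (\<kappa> m) E) \<in> borel_measurable M"
  shows "(\<lambda>m. star (\<kappa> m)) \<in> measurable M (borel_of Mstar)"
proof -
  obtain \<psi> :: "nat \<Rightarrow> real ^ 'd \<Rightarrow> real" where \<psi>: "test_sequence \<psi>" using test_sequence_exists ..
  then have \<psi>C: "\<psi> k \<in> C_compact" for k by (simp add: test_sequence_def)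
  have rad: "star (\<kappa> m) \<in> radon" if "m \<in> space M" for m
    using star_in_Mstar[OF \<kappa>[OF that]] by (simp add: topspace_Mstar)
  show ?thesis
  proof (rule measurable_borel_of_pullback[OF openin_Mstar_pullback[OF \<psi>]])
    show "(\<lambda>m k. integral\<^sup>L (star (\<kappa> m)) (\<psi> k)) \<in> borel_measurable M"
      by (intro measurable_coordinatewise_then_product integral_kernel_measurable[where N = borel]
          star_emeasure_measurable emeas integrable_C_compact \<psi>C radonD(1) rad)
        (use \<psi>C in \<open>auto simp: C_compact_def intro: borel_measurable_continuous_onI\<close>)
  qed (use star_in_Mstar \<kappa> in auto)
qed

lemma openin_Mbox_pullback:
  assumes \<psi>: "test_sequence \<psi>" and W: "openin Mbox W"
  shows "\<exists>G. open G \<and> W = (\<lambda>\<mu> k. integral\<^sup>L \<mu> (\<psi> k :: real ^ 'd \<Rightarrow> real)) -` G \<inter> topspace Mbox"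
  using W by (subst (asm) Mbox_pullback[OF \<psi>]) (simp add: openin_pullback_topology)

lemma box_measurable:
  fixes \<kappa> :: "'a \<Rightarrow> (real ^ 'd) measure"
  assumes \<kappa>: "\<And>m. m \<in> space M \<Longrightarrow> sets (\<kappa> m) = sets borel"
    and emeas: "\<And>E. E \<in> sets borel \<Longrightarrow> (\<lambda>m. emeasure (\<kappa> m) E) \<in> borel_measurable M"
  shows "(\<lambda>m. box (\<kappa> m)) \<in> measurable M (borel_of Mbox)"
proof -
  obtain \<psi> :: "nat \<Rightarrow> real ^ 'd \<Rightarrow> real" where \<psi>: "test_sequence \<psi>" using test_sequence_exists ..
  then have cont: "continuous_on B1 (\<psi> k)" for k
    by (auto simp: test_sequence_def C_compact_def intro: continuous_on_subset)
  show ?thesis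
  proof (rule measurable_borel_of_pullback[OF openin_Mbox_pullback[OF \<psi>]])
    show "(\<lambda>m k. integral\<^sup>L (box (\<kappa> m)) (\<psi> k)) \<in> borel_measurable M"
    proof (intro measurable_coordinatewise_then_product
        integral_kernel_measurable[where N = "restrict_space borel B1"])
      fix E assume "E \<in> sets (restrict_space borel (B1 :: (real ^ 'd) set))"
      then have E: "E \<in> sets borel" "E \<subseteq> B1" by (auto simp: sets_restrict_space_iff)
      have "emeasure (box (\<kappa> m)) E = emeasure (star (\<kappa> m)) E" if "m \<in> space M" for m
        unfolding box_def using \<kappa>[OF that] E
        by (subst emeasure_restrict_space) (simp_all add: space_of_sets_borel)
      then show "(\<lambda>m. emeasure (box (\<kappa> m)) E) \<in> borel_measurable M"
        using star_emeasure_measurable[OF emeas E(1)] by (simp cong: measurable_cong)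
    qed (use \<kappa> in \<open>simp_all add: integrable_Mbox box_in_Mbox cont sets_box
        borel_measurable_continuous_on_restrict\<close>)
  qed (use box_in_Mbox \<kappa> in auto)
qed

section \<open>Measurability of evaluations and of linear images\<close>

text \<open>The indicator of \<open>K\<close> is a pointwise limit of compactly supported continuous
  functions dominated by one cutoff, and integrals of such functions are continuous in
  \<open>\<theta>\<close>.\<close>

lemma Mstar_emeasure_compact_measurable:
  fixes K :: "(real ^ 'd) set"
  assumes K: "compact K"
  shows "(\<lambda>\<theta>. emeasure \<theta> K) \<in> borel_measurable (borel_of Mstar)"
proof (cases "K = {}")
  \<comment> \<open>The empty set is treated separately: \<open>infdist\<close> to it is
    \<open>0\<close> by convention, and the approximants would not tend to its indicator.\<close>
  case False
  obtain r where r: "\<And>z. z \<in> K \<Longrightarrow> norm z \<le> r"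
    using compact_imp_bounded[OF K] unfolding bounded_iff by blast
  define \<rho> where "\<rho> n z = max 0 (1 - real n * infdist z K) * cutoff r z" for n z
  have \<rho>C: "\<rho> n \<in> C_compact" for n
    unfolding \<rho>_def by (intro C_compactI[of _ "r + 1"] continuous_intros) (simp add: cutoff_simps)
  have lim: "(\<lambda>n. integral\<^sup>L \<theta> (\<rho> n)) \<longlonglongrightarrow> measure \<theta> K" if \<theta>: "\<theta> \<in> radon" for \<theta>
  proof -
    have [simp]: "K \<in> sets \<theta>" using radonD(1)[OF \<theta>] K by (simp add: compact_imp_closed borel_closed)
    have "(\<lambda>n. integral\<^sup>L \<theta> (\<rho> n)) \<longlonglongrightarrow> integral\<^sup>L \<theta> (indicator K)"
    proof (rule integral_dominated_convergence[where w = "cutoff r"])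
      show "integrable \<theta> (cutoff r)"
        by (intro integrable_C_compact[OF \<theta>] C_compactI[of _ "r + 1"] continuous_intros) (simp add: cutoff_simps)
      show "AE z in \<theta>. (\<lambda>n. \<rho> n z) \<longlonglongrightarrow> indicator K z"
      proof (rule AE_I2)
        fix z
        show "(\<lambda>n. \<rho> n z) \<longlonglongrightarrow> indicator K z"
        proof (cases "z \<in> K")
          case True
          then show ?thesis using r by (simp add: \<rho>_def cutoff_simps)
        next
          case z: False
          then have pos: "infdist z K > 0"
            using in_closed_iff_infdist_zero[OF compact_imp_closed[OF K] False] infdist_nonneg[of z K]
            by (simp add: less_le)
          have "\<forall>\<^sub>F n in sequentially. real n \<ge> 1 / infdist z K"
            using filterlim_real_sequentially by (simp add: filterlim_at_top)
          then have "\<forall>\<^sub>F n in sequentially. \<rho> n z = 0"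
            by eventually_elim (use pos in \<open>simp add: \<rho>_def field_simps max_def\<close>)
          then show ?thesis using z by (simp add: tendsto_eventually)
        qed
      qed
      show "AE z in \<theta>. norm (\<rho> n z) \<le> cutoff r z" for n
      proof (rule AE_I2)
        fix z
        have "\<bar>max 0 (1 - real n * infdist z K)\<bar> \<le> 1" by (simp add: infdist_nonneg)
        then have "\<bar>max 0 (1 - real n * infdist z K)\<bar> * cutoff r z \<le> 1 * cutoff r z"
          by (intro mult_right_mono cutoff_simps)
        then show "norm (\<rho> n z) \<le> cutoff r z"
          by (simp add: \<rho>_def abs_mult cutoff_simps)
      qed
      show "\<rho> n \<in> borel_measurable \<theta>" for n
        using integrable_C_compact[OF \<theta> \<rho>C] by (rule borel_measurable_integrable)
    qed (auto intro: borel_measurable_indicator)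
    then show ?thesis by simp
  qed
  have "(\<lambda>\<theta>. measure \<theta> K) \<in> borel_measurable (borel_of Mstar)"
  proof (rule borel_measurable_LIMSEQ_real)
    show "(\<lambda>n. integral\<^sup>L \<theta> (\<rho> n)) \<longlonglongrightarrow> measure \<theta> K" if "\<theta> \<in> space (borel_of Mstar)" for \<theta>
      using that by (simp add: topspace_Mstar lim)
    show "(\<lambda>\<theta>. integral\<^sup>L \<theta> (\<rho> n)) \<in> borel_measurable (borel_of Mstar)" for n
    proof (rule continuous_map_borel_of_measurable)
      show "continuous_map Mstar euclideanreal (\<lambda>\<theta>. integral\<^sup>L \<theta> (\<rho> n))"
        unfolding Mstar_def radon_topology_def
        by (intro continuous_map_from_subtopology continuous_map_test_topology_eval)
          (use \<rho>C in \<open>simp add: C_compact_def\<close>)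
    qed
  qed
  moreover have "emeasure \<theta> K = ennreal (measure \<theta> K)" if "\<theta> \<in> topspace Mstar" for \<theta>
    using that radonD(2)[OF _ K, of \<theta>] by (simp add: topspace_Mstar emeasure_eq_ennreal_measure)
  ultimately show ?thesis
    by (subst measurable_cong[where g = "\<lambda>\<theta>. ennreal (measure \<theta> K)"]) simp_all
qed simp

text \<open>The direction opposite to \<open>star_measurable\<close>. Intersecting with a ball makes
  closed sets compact and masses finite, so complements in the induction over disjoint unions are
  handled by subtraction; growing balls then exhaust the set.\<close>

lemma Mstar_emeasure_measurable:
  fixes E :: "(real ^ 'd) set"
  assumes "E \<in> sets borel"
  shows "(\<lambda>\<theta>. emeasure \<theta> E) \<in> borel_measurable (borel_of Mstar)"
proof -
  have E: "E \<in> sigma_sets UNIV (Collect closed)"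
    using assms by (simp add: borel_eq_closed)
  have borel: "A \<in> sets borel" if "A \<in> sigma_sets UNIV (Collect closed)" for A :: "(real ^ 'd) set"
    using that by (simp add: borel_eq_closed)
  have fin: "emeasure \<theta> (A \<inter> cball 0 (real n)) \<noteq> \<infinity>" if "\<theta> \<in> topspace Mstar" "A \<in> sets borel"
    for \<theta> :: "(real ^ 'd) measure" and A n
  proof -
    have "\<theta> \<in> radon" using that by (simp add: topspace_Mstar)
    then have "emeasure \<theta> (A \<inter> cball 0 (real n)) \<le> emeasure \<theta> (cball 0 (real n))"
      using radonD(1)[OF \<open>\<theta> \<in> radon\<close>] by (intro emeasure_mono) auto
    also have "\<dots> < \<infinity>" by (rule radonD(2)[OF \<open>\<theta> \<in> radon\<close>]) simp
    finally show ?thesis by simp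
  qed
  have st: "sets \<theta> = sets borel" if "\<theta> \<in> topspace Mstar" for \<theta> :: "(real ^ 'd) measure"
    using that by (simp add: topspace_Mstar radonD)
  have stable: "Int_stable (Collect closed :: (real ^ 'd) set set)" by (auto simp: Int_stable_def)
  have Pow: "Collect closed \<subseteq> Pow (UNIV :: (real ^ 'd) set)" by simp
  have loc: "(\<lambda>\<theta>. emeasure \<theta> (E \<inter> cball 0 (real n))) \<in> borel_measurable (borel_of Mstar)" for n
    using stable Pow E
  proof (induction rule: sigma_sets_induct_disjoint)
    case (basic A)
    then show ?case by (intro Mstar_emeasure_compact_measurable) (auto intro: closed_Int_compact)
  next
    case (compl A)
    have "emeasure \<theta> ((UNIV - A) \<inter> cball 0 (real n))
        = emeasure \<theta> (cball 0 (real n)) - emeasure \<theta> (A \<inter> cball 0 (real n))" if "\<theta> \<in> topspace Mstar" for \<theta>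
    proof -
      have "(UNIV - A) \<inter> cball 0 (real n) = cball 0 (real n) - A \<inter> cball 0 (real n)" by blast
      then show ?thesis
        using fin[OF that borel[OF compl(1)], of n] borel[OF compl(1)]
        by (simp add: emeasure_Diff st[OF that])
    qed
    moreover have "(\<lambda>\<theta> :: (real ^ 'd) measure. emeasure \<theta> (cball 0 (real n))) \<in> borel_measurable (borel_of Mstar)"
      by (rule Mstar_emeasure_compact_measurable) simp
    ultimately show ?case using compl(2)
      by (subst measurable_cong[where g =
          "\<lambda>\<theta>. emeasure \<theta> (cball 0 (real n)) - emeasure \<theta> (A \<inter> cball 0 (real n))"])
        (simp_all add: borel_measurable_minus_ennreal)
  next
    case (union A)
    have "emeasure \<theta> (\<Union> (range A) \<inter> cball 0 (real n)) = (\<Sum>i. emeasure \<theta> (A i \<inter> cball 0 (real n)))"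
      if "\<theta> \<in> topspace Mstar" for \<theta>
    proof -
      have "range (\<lambda>i. A i \<inter> cball 0 (real n)) \<subseteq> sets \<theta>" using union(2) borel st[OF that] by auto
      moreover have "disjoint_family (\<lambda>i. A i \<inter> cball 0 (real n))"
        using union(1) by (auto simp: disjoint_family_on_def)
      ultimately show ?thesis by (simp add: suminf_emeasure)
    qed
    then show ?case using union(3)
      by (subst measurable_cong[where g = "\<lambda>\<theta>. \<Sum>i. emeasure \<theta> (A i \<inter> cball 0 (real n))"]) simp_all
  qed simp
  have "emeasure \<theta> E = (SUP n. emeasure \<theta> (E \<inter> cball 0 (real n)))" if "\<theta> \<in> topspace Mstar" for \<theta>
  proof -
    have "(SUP n. emeasure \<theta> (E \<inter> cball 0 (real n))) = emeasure \<theta> (\<Union>n. E \<inter> cball 0 (real n))"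
    proof (rule SUP_emeasure_incseq)
      show "range (\<lambda>n. E \<inter> cball 0 (real n)) \<subseteq> sets \<theta>"
        unfolding st[OF that] using assms by (intro image_subsetI sets.Int) simp_all
      show "incseq (\<lambda>n. E \<inter> cball 0 (real n))"
        by (intro monoI Int_mono subset_cball) simp_all
    qed
    moreover have "E \<subseteq> (\<Union>n. E \<inter> cball 0 (real n))"
    proof
      fix x assume "x \<in> E"
      moreover obtain n where "norm x \<le> real n" using real_arch_simple by blast
      ultimately show "x \<in> (\<Union>n. E \<inter> cball 0 (real n))" by (intro UN_I[of n]) auto
    qed
    then have "(\<Union>n. E \<inter> cball 0 (real n)) = E" by (intro equalityI UN_least) simp_all
    ultimately show ?thesis by simp
  qed
  then show ?thesis using loc
    by (subst measurable_cong[where g = "\<lambda>\<theta>. SUP n. emeasure \<theta> (E \<inter> cball 0 (real n))"]) simp_all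
qed

text \<open>An injective linear map is bounded below, so preimages of compact sets are compact and
  the image stays locally finite.\<close>

lemma distr_radon:
  fixes g :: "real ^ 'd \<Rightarrow> real ^ 'd"
  assumes \<theta>: "\<theta> \<in> radon" and g: "linear g" "inj g"
  shows "distr \<theta> borel g \<in> radon"
proof -
  have cont: "continuous_on UNIV g" using g(1) by (simp add: linear_continuous_on linear_conv_bounded_linear)
  then have meas: "g \<in> measurable \<theta> borel"
    using radonD(1)[OF \<theta>] borel_measurable_continuous_onI[OF cont] by (simp cong: measurable_cong_sets)
  have "compact (g -` K)" if "compact K" for K
  proof -
    obtain c where c: "c > 0" "\<And>x. c * norm x \<le> norm (g x)"
      using linear_inj_bounded_below_pos[OF g] by blast
    obtain r where r: "\<And>z. z \<in> K \<Longrightarrow> norm z \<le> r"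
      using compact_imp_bounded[OF \<open>compact K\<close>] unfolding bounded_iff by blast
    have "norm x \<le> r / c" if "x \<in> g -` K" for x
    proof -
      have "c * norm x \<le> r" using c(2)[of x] r[of "g x"] that by simp
      then show ?thesis using c(1) by (simp add: field_simps)
    qed
    then have "bounded (g -` K)" unfolding bounded_iff by blast
    moreover have "closed (g -` K)"
      using cont \<open>compact K\<close> by (simp add: continuous_closed_vimage compact_imp_closed continuous_on_eq_continuous_at)
    ultimately show ?thesis by (simp add: compact_eq_bounded_closed)
  qed
  then show ?thesis
    using radonD[OF \<theta>] meas by (auto simp: radon_def emeasure_distr compact_imp_closed borel_closed)
qed

lemma linear_borel_measurable:
  fixes g :: "real ^ 'd \<Rightarrow> real ^ 'd"
  assumes "linear g"
  shows "g \<in> borel_measurable borel"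
  by (intro borel_measurable_continuous_onI linear_continuous_on)
    (use assms in \<open>simp add: linear_conv_bounded_linear\<close>)

lemma distr_emeasure_measurable:
  fixes g :: "real ^ 'd \<Rightarrow> real ^ 'd"
  assumes g: "linear g" and E: "E \<in> sets borel"
  shows "(\<lambda>\<theta>. emeasure (distr \<theta> borel g) E) \<in> borel_measurable (borel_of Mstar)"
proof -
  have "emeasure (distr \<theta> borel g) E = emeasure \<theta> (g -` E)" if "\<theta> \<in> topspace Mstar" for \<theta>
    using that E linear_borel_measurable[OF g]
    by (subst emeasure_distr) (simp_all add: topspace_Mstar radonD cong: measurable_cong_sets)
  moreover have "g -` E \<in> sets borel"
    using measurable_sets[OF linear_borel_measurable[OF g] E] by simp
  ultimately show ?thesis
    using Mstar_emeasure_measurable[of "g -` E"]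
    by (subst measurable_cong[where g = "\<lambda>\<theta>. emeasure \<theta> (g -` E)"]) simp_all
qed

lemma star_distr_measurable:
  fixes g :: "real ^ 'd \<Rightarrow> real ^ 'd"
  assumes "linear g" "inj g"
  shows "(\<lambda>\<theta>. star (distr \<theta> borel g)) \<in> measurable (borel_of Mstar) (borel_of Mstar)"
  using assms by (intro star_measurable distr_emeasure_measurable distr_radon) (auto simp: topspace_Mstar)

lemma box_distr_measurable:
  fixes g :: "real ^ 'd \<Rightarrow> real ^ 'd"
  assumes "linear g"
  shows "(\<lambda>\<theta>. box (distr \<theta> borel g)) \<in> measurable (borel_of Mstar) (borel_of Mbox)"
  using assms by (intro box_measurable distr_emeasure_measurable) auto

lemma box_measurable_Mstar: "box \<in> measurable (borel_of Mstar) (borel_of (Mbox :: (real ^ 'd) measure topology))"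
  using Mstar_emeasure_measurable
  by (intro box_measurable[of _ "\<lambda>\<theta>. \<theta>"]) (auto simp: topspace_Mstar radonD)

lemma box_star: "box (star M) = box M"
proof -
  have "normalizable (star M)" by (simp add: normalizable_def emeasure_star_B1)
  then have "star (star M) = star M" by (simp add: star_def[of "star M"] emeasure_star_B1)
  then show ?thesis by (simp add: box_def)
qed

text \<open>A second normalization changes nothing, so convergence to \<open>linear_box\<close> can
  be read as generation of \<open>linear_star\<close>.\<close>

lemma restricted_version_linear_star:
  fixes A :: "real ^ 'd \<Rightarrow> real ^ 'd"
  assumes P: "P \<in> prob_measures Mstar" and A: "linear A" "inj A"
  shows "restricted_version (linear_star A P) = linear_box A P"
proof -
  have "(\<lambda>\<theta>. star (distr \<theta> borel A)) \<in> measurable P (borel_of Mstar)"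
    using star_distr_measurable[OF A] prob_measuresD(1)[OF P] by (simp cong: measurable_cong_sets)
  then show ?thesis
    unfolding restricted_version_def linear_star_def linear_box_def
    by (subst distr_distr[OF box_measurable_Mstar]) (simp_all add: comp_def box_star)
qed

section \<open>Boundaries of parallelepipeds and sceneries\<close>

lemma ennreal_inverse_le_1:
  fixes x :: ennreal
  assumes "1 \<le> x"
  shows "inverse x \<le> 1"
proof (cases x)
  case (real r)
  then have "1 \<le> r" using assms by simp
  then show ?thesis using real by (simp add: inverse_ennreal inverse_le_1_iff)
qed simp

lemma linear_exp_scale: "linear (\<lambda>z :: 'a::real_vector. exp t *\<^sub>R z)" "inj (\<lambda>z :: 'a. exp t *\<^sub>R z)"
  by (auto intro!: linearI injI simp: scaleR_add_right)

lemma zoom_radon: "\<theta> \<in> radon \<Longrightarrow> zoom t \<theta> \<in> radon"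
  unfolding zoom_def by (rule distr_radon[OF _ linear_exp_scale])

lemma emeasure_zoom:
  assumes "sets \<theta> = sets borel" "E \<in> sets borel"
  shows "emeasure (zoom t \<theta>) E = emeasure \<theta> {z. exp t *\<^sub>R z \<in> E}"
  unfolding zoom_def using assms linear_borel_measurable[OF linear_exp_scale(1), of t]
  by (subst emeasure_distr) (simp_all add: space_of_sets_borel vimage_def cong: measurable_cong_sets)

lemma borel_infnorm_linear:
  fixes B :: "real ^ 'd \<Rightarrow> real ^ 'd"
  assumes "linear B"
  shows "(\<lambda>z. infnorm (B z)) \<in> borel_measurable borel"
  using measurable_compose[OF linear_borel_measurable[OF assms] measurable_infnorm] by simp

text \<open>Rescaling by \<open>e\<^sup>r\<close> pushes the parallelepiped boundary to \<open>infnorm (B z) = e\<^sup>r\<close>, and these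
  surfaces lie in shells that shrink to the empty set as \<open>r\<close> decreases to \<open>0\<close>; by invariance
  the expected mass does not depend on \<open>r\<close>, so it vanishes.\<close>

lemma zoom_invariant_boundary_null:
  fixes P :: "(real ^ 'd) measure measure" and B :: "real ^ 'd \<Rightarrow> real ^ 'd"
  assumes P: "P \<in> prob_measures Mstar" and inv: "zoom_invariant P" and B: "linear B" "inj B"
  shows "AE \<theta> in P. emeasure \<theta> {z. infnorm (B z) = 1} = 0"
proof -
  interpret prob_space P using P by (rule prob_measuresD)
  have setsP: "sets P = sets (borel_of Mstar)" using P by (rule prob_measuresD)
  have spP: "space P = topspace Mstar" using sets_eq_imp_space_eq[OF setsP] by simp
  note [measurable] = borel_infnorm_linear[OF B(1)]
  define bd where "bd = {z. infnorm (B z) = 1}"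
  have bd: "bd \<in> sets borel" unfolding bd_def by measurable
  \<comment> \<open>The expected mass of the boundary may be infinite. Truncation at
    \<open>1\<close> supplies a constant dominating function and does not change when the value is
    \<open>0\<close>.\<close>
  define W where "W \<theta> = min 1 (emeasure \<theta> bd)" for \<theta>
  have W: "W \<in> borel_measurable (borel_of Mstar)"
    unfolding W_def using Mstar_emeasure_measurable[OF bd] by (intro borel_measurable_min) simp_all
  define r where "r k = inverse (real (Suc k))" for k
  have r: "r k > 0" "r k \<le> 1" for k by (auto simp: r_def inverse_le_1_iff)
  \<comment> \<open>The shells are half-open: the surface at height \<open>1\<close> is left out,
    which makes their intersection empty, while each contains its outer surface at height
    \<open>exp (r k)\<close>.\<close>
  define A where "A k = {z. 1 < infnorm (B z) \<and> infnorm (B z) \<le> exp (r k)}" for k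
  have A: "A k \<in> sets borel" for k unfolding A_def by measurable
  \<comment> \<open>Zooming out is the right direction: the preimage of \<open>B1\<close> then
    contains \<open>B1\<close>, the normalizing mass is at least \<open>1\<close>, and normalization
    cannot increase the mass of the boundary.\<close>
  let ?Z = "\<lambda>k \<theta>. star (zoom (- r k) \<theta>)"
  have Z: "?Z k \<in> measurable (borel_of Mstar) (borel_of Mstar)" for k
    unfolding zoom_def by (rule star_distr_measurable[OF linear_exp_scale])
  have W_le: "W (?Z k \<theta>) \<le> emeasure \<theta> (A k)" if \<theta>: "\<theta> \<in> topspace Mstar" for k and \<theta> :: "(real ^ 'd) measure"
  proof -
    have rad: "\<theta> \<in> radon" and B1: "emeasure \<theta> B1 = 1" using \<theta> by (auto simp: topspace_Mstar)
    have e: "emeasure (zoom (- r k) \<theta>) E = emeasure \<theta> {z. exp (- r k) *\<^sub>R z \<in> E}" if "E \<in> sets borel" for E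
      using emeasure_zoom[OF radonD(1)[OF rad] that] .
    have "emeasure \<theta> B1 \<le> emeasure \<theta> {z. exp (- r k) *\<^sub>R z \<in> B1}"
    proof (rule emeasure_mono)
      show "B1 \<subseteq> {z :: real ^ 'd. exp (- r k) *\<^sub>R z \<in> B1}"
      proof clarify
        fix z :: "real ^ 'd" assume "z \<in> B1"
        then have "exp (- r k) * infnorm z \<le> 1 * 1"
          using r(1)[of k] by (intro mult_mono) (auto simp: B1_iff infnorm_pos_le)
        then show "exp (- r k) *\<^sub>R z \<in> B1" by (simp add: B1_iff infnorm_mul)
      qed
      have "{z :: real ^ 'd. exp (- r k) *\<^sub>R z \<in> B1} = (\<lambda>z. exp (- r k) *\<^sub>R z) -` B1 \<inter> space borel" by auto
      then show "{z. exp (- r k) *\<^sub>R z \<in> B1} \<in> sets \<theta>"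
        using measurable_sets[OF linear_borel_measurable[OF linear_exp_scale(1)] borel_B1] radonD(1)[OF rad]
        by simp
    qed
    then have ge1: "1 \<le> emeasure (zoom (- r k) \<theta>) B1" by (simp add: e B1)
    then have norm: "normalizable (zoom (- r k) \<theta>)"
      using radonD(2)[OF zoom_radon[OF rad] compact_B1] less_le_trans[OF zero_less_one ge1]
      by (simp add: normalizable_def)
    have "emeasure (?Z k \<theta>) bd \<le> 1 * emeasure (zoom (- r k) \<theta>) bd"
      unfolding emeasure_star[OF norm] using ennreal_inverse_le_1[OF ge1]
      by (intro mult_right_mono) auto
    also have "\<dots> = emeasure \<theta> {z. exp (- r k) *\<^sub>R z \<in> bd}" by (simp add: e bd)
    also have "\<dots> \<le> emeasure \<theta> (A k)"
    proof (rule emeasure_mono)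
      show "{z. exp (- r k) *\<^sub>R z \<in> bd} \<subseteq> A k"
      proof clarify
        fix z assume "exp (- r k) *\<^sub>R z \<in> bd"
        then have "infnorm (B z) = exp (r k)"
          by (simp add: bd_def linear_cmul[OF B(1)] infnorm_mul exp_minus field_simps)
        moreover have "1 < exp (r k)" using r(1) by simp
        ultimately show "z \<in> A k" by (simp add: A_def)
      qed
    qed (use A radonD(1)[OF rad] in simp)
    finally show ?thesis by (simp add: W_def min.coboundedI2)
  qed
  have lim: "(\<lambda>k. W (?Z k \<theta>)) \<longlonglongrightarrow> 0" if \<theta>: "\<theta> \<in> topspace Mstar" for \<theta>
  proof -
    have rad: "\<theta> \<in> radon" using \<theta> by (auto simp: topspace_Mstar)
    have "(\<lambda>k. emeasure \<theta> (A k)) \<longlonglongrightarrow> emeasure \<theta> (\<Inter>k. A k)"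
    proof (rule Lim_emeasure_decseq)
      show "range A \<subseteq> sets \<theta>" using A radonD(1)[OF rad] by auto
      have "r n \<le> r m" if "m \<le> n" for m n using that by (simp add: r_def field_simps)
      then show "decseq A" by (intro monoI antimonoI) (fastforce simp: A_def intro: order_trans)
      \<comment> \<open>Continuity from above needs finite masses. Since \<open>r k \<le> 1\<close>,
        all shells lie in the preimage under \<open>B\<close> of the sup-ball of radius
        \<open>exp 1\<close>.\<close>
      show "emeasure \<theta> (A k) \<noteq> \<infinity>" for k
      proof -
        have "A k \<subseteq> B -` {z. infnorm z \<le> exp 1}"
          using r(2)[of k] by (auto simp: A_def intro: order_trans)
        then have "emeasure \<theta> (A k) \<le> emeasure (distr \<theta> borel B) {z. infnorm z \<le> exp 1}"
          using linear_borel_measurable[OF B(1)] radonD[OF rad]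
          by (subst emeasure_distr) (auto intro!: emeasure_mono borel_closed
              measurable_sets_borel simp: borel_closed cong: measurable_cong_sets)
        also have "\<dots> < \<infinity>" by (rule radonD(2)[OF distr_radon[OF rad B] compact_infnorm_le])
        finally show ?thesis by simp
      qed
    qed
    moreover have "(\<Inter>k. A k) = {}"
    proof (rule ccontr)
      assume "(\<Inter>k. A k) \<noteq> {}"
      then obtain z where z: "\<And>k. z \<in> A k" by blast
      have "(\<lambda>k. exp (r k)) \<longlonglongrightarrow> exp 0"
        unfolding r_def by (intro tendsto_exp LIMSEQ_inverse_real_of_nat)
      then have "infnorm (B z) \<le> exp 0"
        by (rule LIMSEQ_le_const) (use z in \<open>auto simp: A_def\<close>)
      then show False using z[of 0] by (simp add: A_def)
    qed
    ultimately have "(\<lambda>k. emeasure \<theta> (A k)) \<longlonglongrightarrow> 0" by simp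
    then show ?thesis
      by (rule tendsto_sandwich[OF _ _ tendsto_const, rotated 2]) (use W_le[OF \<theta>] in auto)
  qed
  have "(\<integral>\<^sup>+\<theta>. W (?Z k \<theta>) \<partial>P) = (\<integral>\<^sup>+\<theta>. W \<theta> \<partial>P)" for k
  proof -
    have "(\<integral>\<^sup>+\<theta>. W \<theta> \<partial>distr P (borel_of Mstar) (?Z k)) = (\<integral>\<^sup>+\<theta>. W (?Z k \<theta>) \<partial>P)"
      using W Z[of k] by (intro nn_integral_distr) (simp_all add: setsP cong: measurable_cong_sets)
    then show ?thesis using inv by (simp add: zoom_invariant_def)
  qed
  moreover have "(\<lambda>k. \<integral>\<^sup>+\<theta>. W (?Z k \<theta>) \<partial>P) \<longlonglongrightarrow> (\<integral>\<^sup>+\<theta>. 0 \<partial>P)"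
  proof (rule nn_integral_dominated_convergence[where w = "\<lambda>_. 1"])
    show "(\<lambda>\<theta>. W (?Z k \<theta>)) \<in> borel_measurable P" for k
      using measurable_compose[OF Z[of k] W] by (simp add: setsP cong: measurable_cong_sets)
    show "AE \<theta> in P. (\<lambda>k. W (?Z k \<theta>)) \<longlonglongrightarrow> 0" using lim spP by auto
  qed (auto simp: W_def emeasure_space_1)
  ultimately have "(\<integral>\<^sup>+\<theta>. W \<theta> \<partial>P) = 0" by (simp add: LIMSEQ_const_iff)
  then have "AE \<theta> in P. W \<theta> = 0"
    using W by (subst (asm) nn_integral_0_iff_AE) (simp_all add: setsP cong: measurable_cong_sets)
  then show ?thesis by (rule AE_mp) (auto simp: W_def bd_def min_def split: if_splits)
qed

text \<open>The open parallelepiped is a neighbourhood of \<open>0\<close>. Positive mass here is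
  what permits normalization after applying \<open>B\<close>.\<close>

lemma supp_linear_pos:
  fixes \<theta> :: "(real ^ 'd) measure" and B :: "real ^ 'd \<Rightarrow> real ^ 'd"
  assumes \<theta>: "sets \<theta> = sets borel" "0 \<in> supp \<theta>" and B: "linear B"
  shows "emeasure \<theta> {z. infnorm (B z) \<le> 1} > 0"
proof -
  note [measurable] = borel_infnorm_linear[OF B]
  have "continuous_on UNIV B" using B by (simp add: linear_continuous_on linear_conv_bounded_linear)
  then have "open {z. infnorm (B z) < 1}" by (intro open_Collect_less continuous_intros)
  moreover have "0 \<in> {z. infnorm (B z) < 1}" using linear_0[OF B] by (simp add: infnorm_0)
  ultimately have "0 < emeasure \<theta> {z. infnorm (B z) < 1}" using \<theta>(2) by (simp add: supp_def)
  also have "\<dots> \<le> emeasure \<theta> {z. infnorm (B z) \<le> 1}"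
  proof (rule emeasure_mono)
    have "{z. infnorm (B z) \<le> 1} \<in> sets borel" by measurable
    then show "{z. infnorm (B z) \<le> 1} \<in> sets \<theta>" using \<theta>(1) by simp
  qed auto
  finally show ?thesis .
qed

section \<open>Measurable dependence of sceneries on time\<close>

lemma radon_sigma_finite:
  fixes \<mu> :: "(real ^ 'd) measure"
  assumes "\<mu> \<in> radon"
  shows "sigma_finite_measure \<mu>"
proof
  have "(\<Union>n. cball (0 :: real ^ 'd) (real n)) = UNIV"
  proof (intro equalityI subsetI)
    fix z :: "real ^ 'd"
    obtain n where "norm z \<le> real n" using real_arch_simple by blast
    then show "z \<in> (\<Union>n. cball 0 (real n))" by (intro UN_I[of n]) auto
  qed simp
  then show "\<exists>A. countable A \<and> A \<subseteq> sets \<mu> \<and> \<Union> A = space \<mu> \<and> (\<forall>a\<in>A. emeasure \<mu> a \<noteq> \<infinity>)"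
    using radonD[OF assms]
    by (intro exI[of _ "range (\<lambda>n. cball 0 (real n))"]) (auto simp: less_top)
qed

lemma zoom_translate_push_on:
  fixes \<mu> :: "(real ^ 'd) measure"
  assumes "sets \<mu> = sets borel" and "f \<in> borel_measurable (restrict_space borel U)"
  shows "zoom t (translate y (push_on U f \<mu>)) = distr (restrict_space \<mu> U) borel (\<lambda>z. exp t *\<^sub>R (f z - y))"
proof -
  have "f \<in> borel_measurable (restrict_space \<mu> U)"
    using assms by (simp cong: measurable_cong_sets sets_restrict_space_cong)
  then show ?thesis
    unfolding zoom_def translate_def push_on_def
    by (simp add: distr_distr comp_def)
qed

text \<open>Tonelli's theorem for an indicator that is jointly measurable in time and space. The
  integral runs over \<open>\<mu>\<close> restricted to \<open>U\<close>, which is sigma-finite, and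
  not over the push-forward, which need not be locally finite.\<close>

lemma zoom_translate_measurable:
  fixes \<mu> :: "(real ^ 'd) measure"
  assumes \<mu>: "\<mu> \<in> radon" and U: "U \<in> sets borel" and f: "f \<in> borel_measurable (restrict_space borel U)"
    and E: "E \<in> sets borel"
  shows "(\<lambda>t. emeasure (zoom t (translate y (push_on U f \<mu>))) E) \<in> borel_measurable borel"
proof -
  have f\<mu>: "f \<in> borel_measurable (restrict_space \<mu> U)"
    using f radonD(1)[OF \<mu>] by (simp cong: measurable_cong_sets sets_restrict_space_cong)
  interpret sigma_finite_measure "restrict_space \<mu> U"
    using U radonD(1)[OF \<mu>] by (intro sigma_finite_measure_restrict_space radon_sigma_finite \<mu>) simp
  have "(\<lambda>(t, z). indicator E (exp t *\<^sub>R (f z - y)) :: ennreal) \<in> borel_measurable (borel \<Otimes>\<^sub>M restrict_space \<mu> U)"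
    using f\<mu> E by measurable
  then have "(\<lambda>t. \<integral>\<^sup>+z. indicator E (exp t *\<^sub>R (f z - y)) \<partial>restrict_space \<mu> U) \<in> borel_measurable borel"
    by (rule borel_measurable_nn_integral)
  moreover have "emeasure (zoom t (translate y (push_on U f \<mu>))) E
      = (\<integral>\<^sup>+z. indicator E (exp t *\<^sub>R (f z - y)) \<partial>restrict_space \<mu> U)" for t
  proof -
    have meas: "(\<lambda>z. exp t *\<^sub>R (f z - y)) \<in> borel_measurable (restrict_space \<mu> U)" using f\<mu> by measurable
    show ?thesis
      unfolding zoom_translate_push_on[OF radonD(1)[OF \<mu>] f]
      using E meas by (subst nn_integral_indicator[symmetric], simp, subst nn_integral_distr) simp_all
  qed
  ultimately show ?thesis by simp
qed

lemma scenery_measurable: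
  fixes \<mu> :: "(real ^ 'd) measure"
  assumes "\<mu> \<in> radon" "U \<in> sets borel" "f \<in> borel_measurable (restrict_space borel U)"
  shows "scenery (push_on U f \<mu>) y \<in> measurable borel (borel_of Mbox)"
    and "{t. normalizable (zoom t (translate y (push_on U f \<mu>)))} \<in> sets borel"
proof -
  show "scenery (push_on U f \<mu>) y \<in> measurable borel (borel_of Mbox)"
    unfolding scenery_def[abs_def]
    by (intro box_measurable zoom_translate_measurable assms) (simp add: zoom_def)
  show "{t. normalizable (zoom t (translate y (push_on U f \<mu>)))} \<in> sets borel"
    using normalizable_measurable[OF zoom_translate_measurable[OF assms borel_B1]] by simp
qed

section \<open>Continuity of restricted images\<close>

text \<open>A tent of half-width \<open>1 / k\<close> around the unit sphere of the sup-norm. It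
  bounds the error of replacing the indicator of \<open>B1\<close> by the continuous function
  \<open>B1_tent k\<close>.\<close>

definition sphere_tent :: "nat \<Rightarrow> real ^ 'd \<Rightarrow> real" where
  "sphere_tent k w = max 0 (1 - real k * \<bar>infnorm w - 1\<bar>)"

definition B1_tent :: "nat \<Rightarrow> real ^ 'd \<Rightarrow> real" where
  "B1_tent k w = max 0 (min 1 (1 - real k * (infnorm w - 1)))"

lemma tent_bounds: "\<bar>sphere_tent k w\<bar> \<le> 1" "\<bar>B1_tent k w\<bar> \<le> 1" "0 \<le> sphere_tent k w"
  by (auto simp: sphere_tent_def B1_tent_def)

lemma tent_continuous [continuous_intros]: "continuous_on S (sphere_tent k)" "continuous_on S (B1_tent k)"
  unfolding sphere_tent_def B1_tent_def by (intro continuous_intros)+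

lemma indicator_B1_tent: "\<bar>indicator B1 w - B1_tent k w\<bar> \<le> sphere_tent k w"
proof (cases "infnorm w \<le> 1")
  case True
  then have "real k * (infnorm w - 1) \<le> 0" by (intro mult_nonneg_nonpos) auto
  then show ?thesis using True by (simp add: B1_tent_def sphere_tent_def indicator_def B1_iff)
next
  case False
  then have "real k * (infnorm w - 1) \<ge> 0" by (intro mult_nonneg_nonneg) auto
  then show ?thesis using False by (simp add: B1_tent_def sphere_tent_def indicator_def B1_iff)
qed

lemma Mbox_measurable:
  fixes \<theta> :: "(real ^ 'd) measure"
  assumes "\<theta> \<in> topspace Mbox"
  shows "measurable \<theta> N = measurable (restrict_space borel B1) N"
  using Mbox_spaceD(2)[OF assms] by (rule measurable_cong_sets) simp

lemma Mbox_integrable_bounded: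
  fixes \<theta> :: "(real ^ 'd) measure"
  assumes \<theta>: "\<theta> \<in> topspace Mbox" and G: "G \<in> borel_measurable (restrict_space borel B1)"
    and \<Xi>: "\<Xi> \<in> borel_measurable borel" "\<And>w. \<bar>\<Xi> w :: real\<bar> \<le> C"
  shows "integrable \<theta> (\<lambda>z. \<Xi> (G z))"
proof -
  interpret prob_space \<theta> using \<theta> by (rule Mbox_spaceD)
  have "G \<in> borel_measurable \<theta>" using G \<theta> by (simp add: Mbox_measurable)
  then have "(\<lambda>z. \<Xi> (G z)) \<in> borel_measurable \<theta>" using \<Xi>(1) by (rule measurable_compose)
  then show ?thesis using \<Xi>(2) by (intro integrable_const_bound[of _ C]) auto
qed

text \<open>For the fixed integrand built from \<open>g\<close> this is weak convergence. The error
  of using \<open>G n\<close> instead is uniformly small on \<open>B1\<close>, and every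
  \<open>\<theta> n\<close> has total mass \<open>1\<close>.\<close>

lemma Mbox_integral_compose_tendsto:
  fixes \<theta> :: "nat \<Rightarrow> (real ^ 'd) measure" and g :: "real ^ 'd \<Rightarrow> real ^ 'd"
  assumes lim: "limitin Mbox \<theta> \<theta>' sequentially" and \<theta>: "\<And>n. \<theta> n \<in> topspace Mbox"
    and G: "\<And>n. G n \<in> borel_measurable (restrict_space borel B1)"
    and g: "continuous_on B1 g" and unif: "uniform_limit B1 G g sequentially"
    and \<Xi>: "continuous_on UNIV \<Xi>" "\<And>w. \<bar>\<Xi> w :: real\<bar> \<le> C"
  shows "(\<lambda>n. \<integral>z. \<Xi> (G n z) \<partial>\<theta> n) \<longlonglongrightarrow> (\<integral>z. \<Xi> (g z) \<partial>\<theta>')"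
proof -
  have \<Xi>m: "\<Xi> \<in> borel_measurable borel" using \<Xi>(1) by (rule borel_measurable_continuous_onI)
  have gm: "g \<in> borel_measurable (restrict_space borel B1)"
    using g by (rule borel_measurable_continuous_on_restrict)
  have 1: "(\<lambda>n. \<integral>z. \<Xi> (g z) \<partial>\<theta> n) \<longlonglongrightarrow> (\<integral>z. \<Xi> (g z) \<partial>\<theta>')"
    using lim continuous_on_compose2[OF \<Xi>(1) g] by (simp add: limitin_Mbox)
  have 2: "(\<lambda>n. (\<integral>z. \<Xi> (G n z) \<partial>\<theta> n) - (\<integral>z. \<Xi> (g z) \<partial>\<theta> n)) \<longlonglongrightarrow> 0"
  proof (rule tendstoI)
    fix \<epsilon> :: real assume \<epsilon>: "\<epsilon> > 0"
    obtain R where R: "\<And>z. z \<in> B1 \<Longrightarrow> norm (g z) \<le> R"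
      using compact_imp_bounded[OF compact_continuous_image[OF g compact_B1]] unfolding bounded_iff by auto
    \<comment> \<open>\<open>g\<close> maps \<open>B1\<close> into the ball of radius
      \<open>R\<close>; once \<open>G n\<close> is within \<open>1\<close> of \<open>g\<close>, its
      values lie in the ball of radius \<open>R + 1\<close>.\<close>
    have "uniformly_continuous_on (cball 0 (R + 1)) \<Xi>"
      by (intro compact_uniformly_continuous continuous_on_subset[OF \<Xi>(1)]) auto
    then obtain \<delta> where \<delta>: "\<delta> > 0" "\<And>w w'. w \<in> cball 0 (R + 1) \<Longrightarrow> w' \<in> cball 0 (R + 1) \<Longrightarrow>
        dist w' w < \<delta> \<Longrightarrow> dist (\<Xi> w') (\<Xi> w) < \<epsilon> / 2"
      using \<epsilon> unfolding uniformly_continuous_on_def by (meson half_gt_zero)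
    have "\<forall>\<^sub>F n in sequentially. \<forall>z\<in>B1. dist (G n z) (g z) < min 1 \<delta>"
      using unif \<delta>(1) by (intro uniform_limitD) auto
    then show "\<forall>\<^sub>F n in sequentially. dist ((\<integral>z. \<Xi> (G n z) \<partial>\<theta> n) - (\<integral>z. \<Xi> (g z) \<partial>\<theta> n)) 0 < \<epsilon>"
    proof eventually_elim
      case (elim n)
      interpret prob_space "\<theta> n" using \<theta> by (rule Mbox_spaceD)
      have int: "integrable (\<theta> n) (\<lambda>z. \<Xi> (G n z))" "integrable (\<theta> n) (\<lambda>z. \<Xi> (g z))"
        using \<theta> G gm \<Xi>m \<Xi>(2) by (auto intro: Mbox_integrable_bounded)
      have close: "\<bar>\<Xi> (G n z) - \<Xi> (g z)\<bar> \<le> \<epsilon> / 2" if z: "z \<in> B1" for z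
      proof -
        have d: "dist (G n z) (g z) < 1" "dist (G n z) (g z) < \<delta>" using elim z by auto
        have "norm (G n z) \<le> R + 1"
          using R[OF z] d(1) norm_triangle_ineq2[of "G n z" "g z"] by (simp add: dist_norm)
        then have "dist (\<Xi> (G n z)) (\<Xi> (g z)) < \<epsilon> / 2" using R[OF z] d(2) by (intro \<delta>(2)) auto
        then show ?thesis by (simp add: dist_real_def)
      qed
      have "\<bar>(\<integral>z. \<Xi> (G n z) \<partial>\<theta> n) - (\<integral>z. \<Xi> (g z) \<partial>\<theta> n)\<bar> = \<bar>\<integral>z. \<Xi> (G n z) - \<Xi> (g z) \<partial>\<theta> n\<bar>"
        using int by simp
      also have "\<dots> \<le> (\<integral>z. \<bar>\<Xi> (G n z) - \<Xi> (g z)\<bar> \<partial>\<theta> n)" by (rule integral_abs_bound)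
      also have "\<dots> \<le> (\<integral>z. \<epsilon> / 2 \<partial>\<theta> n)"
        using int close Mbox_spaceD(3)[OF \<theta>[of n]] by (intro integral_mono) auto
      also have "\<dots> = \<epsilon> / 2" by (simp add: prob_space)
      finally show ?case using \<epsilon> by (simp add: dist_real_def)
    qed
  qed
  show ?thesis using tendsto_add[OF 2 1] by simp
qed

text \<open>With a tent in place of the indicator the previous lemma applies, and the error is at
  most \<open>C\<close> times the integral of \<open>sphere_tent k\<close>. This is small for the
  limit measure when \<open>k\<close> is large, because the boundary is null.\<close>

lemma Mbox_integral_indicator_compose_tendsto:
  fixes \<theta> :: "nat \<Rightarrow> (real ^ 'd) measure" and g :: "real ^ 'd \<Rightarrow> real ^ 'd"
  assumes lim: "limitin Mbox \<theta> \<theta>' sequentially" and \<theta>: "\<And>n. \<theta> n \<in> topspace Mbox"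
    and G: "\<And>n. G n \<in> borel_measurable (restrict_space borel B1)"
    and g: "continuous_on B1 g" and unif: "uniform_limit B1 G g sequentially"
    and null: "emeasure \<theta>' {z \<in> B1. infnorm (g z) = 1} = 0"
    and \<Psi>: "continuous_on UNIV \<Psi>" "\<And>w. \<bar>\<Psi> w :: real\<bar> \<le> C"
  shows "(\<lambda>n. \<integral>z. indicator B1 (G n z) * \<Psi> (G n z) \<partial>\<theta> n) \<longlonglongrightarrow> (\<integral>z. indicator B1 (g z) * \<Psi> (g z) \<partial>\<theta>')"
proof (rule tendstoI)
  fix \<epsilon> :: real assume \<epsilon>: "\<epsilon> > 0"
  have C0: "C \<ge> 0" using \<Psi>(2)[of 0] by linarith
  have \<theta>': "\<theta>' \<in> topspace Mbox" using lim by (rule limitin_topspace)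
  interpret P': prob_space \<theta>' using \<theta>' by (rule Mbox_spaceD)
  have gm: "g \<in> borel_measurable (restrict_space borel B1)"
    using g by (rule borel_measurable_continuous_on_restrict)
  have cont: "continuous_on UNIV (\<lambda>w. \<Psi> w * B1_tent k w)" for k
    using \<Psi>(1) by (intro continuous_intros)
  have bd: "\<bar>\<Psi> w * B1_tent k w\<bar> \<le> C" for k w
    using mult_mono[OF \<Psi>(2)[of w] tent_bounds(2)[of k w] C0] by (simp add: abs_mult)
  have meas: "(\<lambda>w. \<Psi> w * B1_tent k w) \<in> borel_measurable borel" "sphere_tent k \<in> borel_measurable borel"
    "(\<lambda>w. indicator B1 w * \<Psi> w) \<in> borel_measurable borel" for k
    using borel_measurable_continuous_onI[OF cont[of k]] borel_measurable_continuous_onI[OF \<Psi>(1)]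
      borel_measurable_continuous_onI[OF tent_continuous(1)[of UNIV k]]
    by (simp_all add: borel_measurable_times)
  have approx: "\<bar>(\<integral>z. indicator B1 (G' z) * \<Psi> (G' z) \<partial>\<eta>) - (\<integral>z. \<Psi> (G' z) * B1_tent k (G' z) \<partial>\<eta>)\<bar>
      \<le> C * (\<integral>z. sphere_tent k (G' z) \<partial>\<eta>)"
    if \<eta>: "\<eta> \<in> topspace Mbox" and G': "G' \<in> borel_measurable (restrict_space borel B1)" for \<eta> G' k
  proof -
    have int: "integrable \<eta> (\<lambda>z. indicator B1 (G' z) * \<Psi> (G' z))"
      "integrable \<eta> (\<lambda>z. \<Psi> (G' z) * B1_tent k (G' z))" "integrable \<eta> (\<lambda>z. sphere_tent k (G' z))"
    proof -
      show "integrable \<eta> (\<lambda>z. indicator B1 (G' z) * \<Psi> (G' z))"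
        by (rule Mbox_integrable_bounded[OF \<eta> G' meas(3), of C]) (use \<Psi>(2) C0 in \<open>auto simp: indicator_def\<close>)
      show "integrable \<eta> (\<lambda>z. \<Psi> (G' z) * B1_tent k (G' z))"
        by (rule Mbox_integrable_bounded[OF \<eta> G' meas(1) bd])
      show "integrable \<eta> (\<lambda>z. sphere_tent k (G' z))"
        by (rule Mbox_integrable_bounded[OF \<eta> G' meas(2) tent_bounds(1)])
    qed
    have "\<bar>(\<integral>z. indicator B1 (G' z) * \<Psi> (G' z) \<partial>\<eta>) - (\<integral>z. \<Psi> (G' z) * B1_tent k (G' z) \<partial>\<eta>)\<bar>
        = \<bar>\<integral>z. indicator B1 (G' z) * \<Psi> (G' z) - \<Psi> (G' z) * B1_tent k (G' z) \<partial>\<eta>\<bar>"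
      using int by simp
    also have "\<dots> \<le> (\<integral>z. \<bar>indicator B1 (G' z) * \<Psi> (G' z) - \<Psi> (G' z) * B1_tent k (G' z)\<bar> \<partial>\<eta>)"
      by (rule integral_abs_bound)
    also have "\<dots> \<le> (\<integral>z. C * sphere_tent k (G' z) \<partial>\<eta>)"
    proof (rule integral_mono)
      fix z
      have "\<bar>indicator B1 (G' z) * \<Psi> (G' z) - \<Psi> (G' z) * B1_tent k (G' z)\<bar>
          = \<bar>\<Psi> (G' z)\<bar> * \<bar>indicator B1 (G' z) - B1_tent k (G' z)\<bar>"
        by (simp add: abs_mult[symmetric] algebra_simps)
      also have "\<dots> \<le> C * sphere_tent k (G' z)"
        by (intro mult_mono \<Psi>(2) indicator_B1_tent C0) auto
      finally show "\<bar>indicator B1 (G' z) * \<Psi> (G' z) - \<Psi> (G' z) * B1_tent k (G' z)\<bar> \<le> C * sphere_tent k (G' z)" .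
    qed (use int in auto)
    finally show ?thesis using int by simp
  qed
  have "(\<lambda>k. \<integral>z. sphere_tent k (g z) \<partial>\<theta>') \<longlonglongrightarrow> (\<integral>z. 0 \<partial>\<theta>')"
  proof (rule integral_dominated_convergence[where w = "\<lambda>_. 1"])
    have "{z \<in> B1. infnorm (g z) = 1} \<in> sets \<theta>'"
    proof -
      have "(\<lambda>z. infnorm (g z)) \<in> borel_measurable (restrict_space borel B1)"
        by (rule measurable_compose[OF gm measurable_infnorm])
      then have "{z \<in> space (restrict_space borel B1). infnorm (g z) = 1} \<in> sets (restrict_space borel B1)"
        by measurable
      then show ?thesis using Mbox_spaceD(2)[OF \<theta>'] by (simp add: space_restrict_space)
    qed
    then have "AE z in \<theta>'. z \<notin> {z \<in> B1. infnorm (g z) = 1}"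
      using null by (intro AE_not_in) (simp add: null_sets_def)
    then show "AE z in \<theta>'. (\<lambda>k. sphere_tent k (g z)) \<longlonglongrightarrow> 0"
      using AE_space
    proof eventually_elim
      case (elim z)
      then have "\<bar>infnorm (g z) - 1\<bar> > 0" using Mbox_spaceD(3)[OF \<theta>'] by auto
      moreover have "\<forall>\<^sub>F k in sequentially. real k \<ge> 1 / \<bar>infnorm (g z) - 1\<bar>"
        using filterlim_real_sequentially by (simp add: filterlim_at_top)
      ultimately have "\<forall>\<^sub>F k in sequentially. sphere_tent k (g z) = 0"
        by (elim eventually_mono) (simp add: sphere_tent_def field_simps)
      then show ?case by (rule tendsto_eventually)
    qed
    show "(\<lambda>z. sphere_tent k (g z)) \<in> borel_measurable \<theta>'" for k
      using Mbox_integrable_bounded[OF \<theta>' gm meas(2) tent_bounds(1)] by (rule borel_measurable_integrable)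
    show "AE z in \<theta>'. norm (sphere_tent k (g z)) \<le> 1" for k by (simp add: tent_bounds(1))
  qed auto
  then have "(\<lambda>k. C * (\<integral>z. sphere_tent k (g z) \<partial>\<theta>')) \<longlonglongrightarrow> C * 0"
    by (intro tendsto_mult_left) simp
  then have "\<forall>\<^sub>F k in sequentially. C * (\<integral>z. sphere_tent k (g z) \<partial>\<theta>') < \<epsilon> / 4"
    using \<epsilon> by (intro order_tendstoD(2)) auto
  then obtain k where k: "C * (\<integral>z. sphere_tent k (g z) \<partial>\<theta>') < \<epsilon> / 4"
    by (auto simp: eventually_sequentially)
  \<comment> \<open>With \<open>k\<close> fixed, \<open>sphere_tent k\<close> is continuous, so the
    smallness of the error passes from the limit measure to \<open>\<theta> n\<close> for large
    \<open>n\<close>.\<close>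
  have "(\<lambda>n. C * (\<integral>z. sphere_tent k (G n z) \<partial>\<theta> n)) \<longlonglongrightarrow> C * (\<integral>z. sphere_tent k (g z) \<partial>\<theta>')"
    by (intro tendsto_mult_left Mbox_integral_compose_tendsto[OF lim \<theta> G g unif _ tent_bounds(1)] tent_continuous)
  then have "\<forall>\<^sub>F n in sequentially. C * (\<integral>z. sphere_tent k (G n z) \<partial>\<theta> n) < \<epsilon> / 4"
    using k by (intro order_tendstoD(2)) auto
  moreover have "\<forall>\<^sub>F n in sequentially. dist (\<integral>z. \<Psi> (G n z) * B1_tent k (G n z) \<partial>\<theta> n)
      (\<integral>z. \<Psi> (g z) * B1_tent k (g z) \<partial>\<theta>') < \<epsilon> / 4"
    by (rule tendstoD[OF Mbox_integral_compose_tendsto[OF lim \<theta> G g unif cont bd]]) (use \<epsilon> in auto)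
  ultimately show "\<forall>\<^sub>F n in sequentially. dist (\<integral>z. indicator B1 (G n z) * \<Psi> (G n z) \<partial>\<theta> n)
      (\<integral>z. indicator B1 (g z) * \<Psi> (g z) \<partial>\<theta>') < \<epsilon>"
  proof eventually_elim
    case (elim n)
    show ?case
      using approx[OF \<theta>' gm, of k] approx[OF \<theta> G, of n n k] k elim unfolding dist_real_def by linarith
  qed
qed

text \<open>Integrals over \<open>B1\<close> of the images converge because the boundary is null.
  The constant function \<open>1\<close> gives convergence of the normalizing masses, whose limit is
  positive, so the quotients converge as well.\<close>

lemma limitin_Mbox_box_distr:
  fixes \<theta> :: "nat \<Rightarrow> (real ^ 'd) measure" and g :: "real ^ 'd \<Rightarrow> real ^ 'd"
  assumes lim: "limitin Mbox \<theta> \<theta>' sequentially" and \<theta>: "\<And>n. \<theta> n \<in> topspace Mbox"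
    and G: "\<And>n. G n \<in> borel_measurable (restrict_space borel B1)"
    and g: "continuous_on B1 g" and unif: "uniform_limit B1 G g sequentially"
    and null: "emeasure \<theta>' {z \<in> B1. infnorm (g z) = 1} = 0"
    and pos: "emeasure \<theta>' {z \<in> B1. infnorm (g z) \<le> 1} > 0"
  shows "limitin Mbox (\<lambda>n. box (distr (\<theta> n) borel (G n))) (box (distr \<theta>' borel g)) sequentially"
proof -
  have \<theta>': "\<theta>' \<in> topspace Mbox" using lim by (rule limitin_topspace)
  have gm: "g \<in> borel_measurable (restrict_space borel B1)"
    using g by (rule borel_measurable_continuous_on_restrict)
  define M where "M n = distr (\<theta> n) borel (G n)" for n
  define M' where "M' = distr \<theta>' borel g"
  have sets: "sets (M n) = sets borel" "sets M' = sets borel" for n by (simp_all add: M_def M'_def)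
  have prob: "prob_space (distr \<eta> borel G')"
    if "\<eta> \<in> topspace Mbox" "G' \<in> borel_measurable (restrict_space borel B1)"
    for \<eta> and G' :: "real ^ 'd \<Rightarrow> real ^ 'd"
    using that Mbox_spaceD(1)[OF that(1)] by (intro prob_space.prob_space_distr) (simp_all add: Mbox_measurable)
  \<comment> \<open>\<open>\<psi>\<close> is continuous on \<open>B1\<close> only; the retraction
    makes it continuous everywhere, and the indicator discards the points where the value was
    changed.\<close>
  have integral: "(LINT w:B1|distr \<eta> borel G'. \<psi> w)
      = (\<integral>z. indicator B1 (G' z) * \<psi> (closest_point B1 (G' z)) \<partial>\<eta>)"
    if "\<eta> \<in> topspace Mbox" "G' \<in> borel_measurable (restrict_space borel B1)" and \<psi>: "continuous_on B1 \<psi>"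
    for \<eta> G' and \<psi> :: "real ^ 'd \<Rightarrow> real"
  proof -
    have "(LINT w:B1|distr \<eta> borel G'. \<psi> w) = (\<integral>z. indicator B1 (G' z) *\<^sub>R \<psi> (G' z) \<partial>\<eta>)"
      unfolding set_lebesgue_integral_def using that
      by (intro integral_distr borel_measurable_continuous_on_indicator) (simp_all add: Mbox_measurable)
    also have "\<dots> = (\<integral>z. indicator B1 (G' z) * \<psi> (closest_point B1 (G' z)) \<partial>\<eta>)"
      using B1_extension(2)[OF \<psi>] by (intro Bochner_Integration.integral_cong) (auto simp: indicator_def)
    finally show ?thesis .
  qed
  have lim_int: "(\<lambda>n. LINT w:B1|M n. \<psi> w) \<longlonglongrightarrow> (LINT w:B1|M'. \<psi> w)"
    if \<psi>: "continuous_on B1 \<psi>" for \<psi> :: "real ^ 'd \<Rightarrow> real"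
  proof -
    obtain C where C: "\<forall>z\<in>B1. \<bar>\<psi> z\<bar> \<le> C" using bounded_continuous_on_B1[OF \<psi>] ..
    have "continuous_on UNIV (\<lambda>w. \<psi> (closest_point B1 w))"
      using B1_extension(1)[OF \<psi>] by (rule uniformly_continuous_imp_continuous)
    moreover have "\<bar>\<psi> (closest_point B1 w)\<bar> \<le> C" for w using C B1_extension(3)[OF \<psi>] by simp
    ultimately show ?thesis
      unfolding M_def M'_def integral[OF \<theta> G \<psi>] integral[OF \<theta>' gm \<psi>]
      by (rule Mbox_integral_indicator_compose_tendsto[OF lim \<theta> G g unif null])
  qed
  have meas: "(LINT w:B1|N. 1 :: real) = measure N B1" if "sets N = sets borel" for N :: "(real ^ 'd) measure"
    using that by (simp add: set_lebesgue_integral_def)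
  have lim_meas: "(\<lambda>n. measure (M n) B1) \<longlonglongrightarrow> measure M' B1"
    using lim_int[of "\<lambda>_. 1"] by (simp add: meas sets)
  have pM': "prob_space M'" using prob[OF \<theta>' gm] by (simp only: M'_def)
  interpret M': prob_space M' by (rule pM')
  have "g -` B1 \<inter> space \<theta>' = {z \<in> B1. infnorm (g z) \<le> 1}"
    unfolding Mbox_spaceD(3)[OF \<theta>'] by (simp add: B1_alt vimage_def Int_def conj_commute)
  then have "emeasure M' B1 = emeasure \<theta>' {z \<in> B1. infnorm (g z) \<le> 1}"
    unfolding M'_def using gm \<theta>' by (subst emeasure_distr) (simp_all add: Mbox_measurable)
  then have "emeasure M' B1 > 0" using pos by simp
  then have nM': "normalizable M'" and mM': "measure M' B1 > 0"
    by (simp_all add: normalizable_def M'.emeasure_eq_measure)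
  \<comment> \<open>Normalizability holds only eventually. The finitely many exceptions take the
    default value and do not affect the limit.\<close>
  have nM: "\<forall>\<^sub>F n in sequentially. normalizable (M n)"
    using order_tendstoD(1)[OF lim_meas mM']
  proof eventually_elim
    case (elim n)
    have pM: "prob_space (M n)" using prob[OF \<theta> G] by (simp only: M_def)
    interpret prob_space "M n" by (rule pM)
    show ?case using elim by (simp add: normalizable_def emeasure_eq_measure)
  qed
  have "(\<lambda>n. integral\<^sup>L (box (M n)) \<psi>) \<longlonglongrightarrow> integral\<^sup>L (box M') \<psi>"
    if \<psi>: "continuous_on B1 \<psi>" for \<psi> :: "real ^ 'd \<Rightarrow> real"
  proof -
    have "(\<lambda>n. (LINT w:B1|M n. \<psi> w) / measure (M n) B1) \<longlonglongrightarrow> (LINT w:B1|M'. \<psi> w) / measure M' B1"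
      using mM' by (intro tendsto_divide lim_int[OF \<psi>] lim_meas) simp
    moreover have "\<forall>\<^sub>F n in sequentially. (LINT w:B1|M n. \<psi> w) / measure (M n) B1 = integral\<^sup>L (box (M n)) \<psi>"
      using nM by eventually_elim (simp add: integral_box sets \<psi>)
    ultimately show ?thesis
      unfolding integral_box[OF sets(2) nM' \<psi>] by (rule Lim_transform_eventually)
  qed
  then show ?thesis
    unfolding limitin_Mbox M_def[symmetric] M'_def[symmetric]
    using box_in_Mbox[OF sets(1)] box_in_Mbox[OF sets(2)] by (simp add: always_eventually)
qed

section \<open>Blow-ups of a diffeomorphism\<close>

text \<open>Statements about push-forwards thereby specialize to \<open>\<mu>\<close>
  itself.\<close>

lemma push_on_id: "sets \<mu> = sets borel \<Longrightarrow> push_on UNIV (\<lambda>z. z) \<mu> = (\<mu> :: (real ^ 'd) measure)"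
  unfolding push_on_def
  by (rule measure_eqI)
    (auto simp: emeasure_distr emeasure_restrict_space space_restrict_space space_of_sets_borel
      measurable_ident_sets sets_restrict_space)

lemma infnorm_le_exp_iff: "infnorm (exp t *\<^sub>R w) \<le> 1 \<longleftrightarrow> infnorm w \<le> exp (- t)"
  by (simp add: infnorm_mul exp_minus field_simps)

text \<open>The chain rule makes the derivative of the inverse at \<open>f x\<close> a left inverse
  of \<open>A\<close>. The first-order expansion of the inverse there gives the Lipschitz bound; it
  holds for every \<open>z \<in> U\<close> whose image is near \<open>f x\<close>, so no distant
  part of \<open>U\<close> is mapped close to \<open>f x\<close>.\<close>

lemma C1_diffeomorphism_derivative:
  fixes f :: "real ^ 'd \<Rightarrow> real ^ 'd"
  assumes f: "C1_diffeomorphism U V f" and U: "open U" "x \<in> U" and V: "open V"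
  defines "A \<equiv> frechet_derivative f (at x)"
  shows "continuous_on U f" "(f has_derivative A) (at x)" "linear A" "inj A"
    and "\<exists>L \<delta>. L > 0 \<and> \<delta> > 0 \<and> (\<forall>z\<in>U. infnorm (f z - f x) \<le> \<delta> \<longrightarrow> infnorm (z - x) \<le> L * infnorm (f z - f x))"
proof -
  let ?g = "the_inv_into U f"
  have bij: "bij_betw f U V" using f by (simp add: C1_diffeomorphism_def)
  obtain D where D: "\<And>z. z \<in> U \<Longrightarrow> (f has_derivative blinfun_apply (D z)) (at z)"
    using f unfolding C1_diffeomorphism_def C1_on_def by blast
  obtain D' where D': "\<And>w. w \<in> V \<Longrightarrow> (?g has_derivative blinfun_apply (D' w)) (at w)"
    using f unfolding C1_diffeomorphism_def C1_on_def by blast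
  have y: "f x \<in> V" using bij U(2) by (auto dest: bij_betwE)
  have gf: "?g (f z) = z" if "z \<in> U" for z
    using that bij by (intro the_inv_into_f_f) (auto simp: bij_betw_def)
  show "continuous_on U f"
    using D has_derivative_continuous continuous_at_imp_continuous_on by blast
  show A: "(f has_derivative A) (at x)"
    unfolding A_def using D[OF U(2)] frechet_derivative_works differentiableI by blast
  then show "linear A" by (rule has_derivative_linear)
  have "((\<lambda>z. ?g (f z)) has_derivative (\<lambda>v. blinfun_apply (D' (f x)) (A v))) (at x)"
    using has_derivative_compose[OF A D'[OF y]] by simp
  moreover have "((\<lambda>z. ?g (f z)) has_derivative (\<lambda>v. v)) (at x)"
    by (rule has_derivative_transform_within_open[OF has_derivative_ident U]) (simp add: gf)
  ultimately have "blinfun_apply (D' (f x)) (A v) = v" for v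
    using has_derivative_unique by metis
  then show "inj A" by (metis injI)
  let ?n = "sqrt (real DIM(real ^ 'd))"
  have "\<exists>d>0. \<forall>w. norm (w - f x) < d \<longrightarrow>
      norm (?g w - ?g (f x) - blinfun_apply (D' (f x)) (w - f x)) \<le> 1 * norm (w - f x)"
    using D'[OF y] zero_less_one unfolding has_derivative_at_alt by blast
  then obtain d where d: "d > 0" "\<And>w. norm (w - f x) < d \<Longrightarrow>
      norm (?g w - ?g (f x) - blinfun_apply (D' (f x)) (w - f x)) \<le> 1 * norm (w - f x)"
    by blast
  \<comment> \<open>The summand \<open>1\<close> is the tolerance in the expansion of the inverse,
    the other summand is the operator norm of its derivative.\<close>
  define K where "K = 1 + norm (D' (f x))"
  have K: "K > 0" using norm_ge_zero[of "D' (f x)"] unfolding K_def by linarith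
  have n: "?n > 0" by simp
  show "\<exists>L \<delta>. L > 0 \<and> \<delta> > 0 \<and> (\<forall>z\<in>U. infnorm (f z - f x) \<le> \<delta> \<longrightarrow> infnorm (z - x) \<le> L * infnorm (f z - f x))"
  proof (intro exI conjI ballI impI)
    show "K * ?n > 0" using K n by (rule mult_pos_pos)
    \<comment> \<open>\<open>?n\<close> converts the sup-norm to the Euclidean norm, and the factor
      \<open>2\<close> turns a weak inequality into the strict one required by
      \<open>d\<close>.\<close>
    show "d / (2 * ?n) > 0" using d(1) n by simp
    fix z assume z: "z \<in> U" "infnorm (f z - f x) \<le> d / (2 * ?n)"
    have "norm (f z - f x) \<le> ?n * infnorm (f z - f x)" by (rule norm_le_infnorm)
    also have "\<dots> \<le> ?n * (d / (2 * ?n))" using z(2) n by (intro mult_left_mono) auto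
    also have "\<dots> < d" using d(1) n by simp
    finally have "norm (z - x - blinfun_apply (D' (f x)) (f z - f x)) \<le> norm (f z - f x)"
      using d(2)[of "f z"] gf z(1) U(2) by simp
    moreover have "norm (blinfun_apply (D' (f x)) (f z - f x)) \<le> norm (D' (f x)) * norm (f z - f x)"
      by (rule norm_blinfun)
    ultimately have "norm (z - x) \<le> K * norm (f z - f x)"
      using norm_triangle_sub[of "z - x" "blinfun_apply (D' (f x)) (f z - f x)"]
      unfolding K_def distrib_right by linarith
    then have "infnorm (z - x) \<le> K * norm (f z - f x)" using infnorm_le_norm order_trans by blast
    also have "\<dots> \<le> K * (?n * infnorm (f z - f x))"
      using K norm_le_infnorm[of "f z - f x"] by (intro mult_left_mono) auto
    finally show "infnorm (z - x) \<le> K * ?n * infnorm (f z - f x)" by (simp add: mult.assoc)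
  qed
qed

text \<open>The outer scale runs ahead of the inner one by \<open>s\<close>, matching the time shift
  between the two sceneries. Outside \<open>U\<close> the value is set to \<open>0\<close>, which
  keeps the map total and measurable; for large \<open>u\<close> no point of \<open>B1\<close> is
  affected.\<close>

definition blow_up :: "(real ^ 'd) set \<Rightarrow> (real ^ 'd \<Rightarrow> real ^ 'd) \<Rightarrow> real ^ 'd \<Rightarrow> real \<Rightarrow> real \<Rightarrow> real ^ 'd \<Rightarrow> real ^ 'd" where
  "blow_up U f x s u v =
     exp (u + s) *\<^sub>R ((if x + exp (- u) *\<^sub>R v \<in> U then f (x + exp (- u) *\<^sub>R v) else f x) - f x)"

lemma blow_up_measurable:
  fixes f :: "real ^ 'd \<Rightarrow> real ^ 'd"
  assumes "open U" "continuous_on U f"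
  shows "blow_up U f x s u \<in> borel_measurable borel"
proof -
  have "f \<in> borel_measurable (restrict_space borel U)"
    using assms(2) by (rule borel_measurable_continuous_on_restrict)
  then have [measurable]: "(\<lambda>z. if z \<in> U then f z else f x) \<in> borel_measurable borel"
    using assms(1) by (subst measurable_restrict_space_iff[symmetric]) (auto intro: borel_open)
  have "(\<lambda>v. x + exp (- u) *\<^sub>R v) \<in> borel_measurable borel" by measurable
  then show ?thesis
    unfolding blow_up_def[abs_def]
    using measurable_compose[of "\<lambda>v. x + exp (- u) *\<^sub>R v" borel borel "\<lambda>z. if z \<in> U then f z else f x"]
    by (intro borel_measurable_scaleR borel_measurable_diff) simp_all
qed

lemma eventually_exp_neg_less:
  assumes "(e :: real) > 0"
  shows "\<forall>\<^sub>F u in at_top. exp (- u) < e"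
proof -
  have "((\<lambda>u :: real. exp (- u)) \<longlongrightarrow> 0) at_top"
    by (intro filterlim_compose[OF exp_at_bot] filterlim_uminus_at_bot_at_top)
  then show ?thesis using assms by (rule order_tendstoD)
qed

lemma eventually_scaled_B1:
  assumes "(e :: real) > 0"
  shows "\<forall>\<^sub>F u in at_top. \<forall>v\<in>B1. norm (exp (- u) *\<^sub>R (v :: real ^ 'd)) < e"
proof -
  obtain R where R: "\<And>v :: real ^ 'd. v \<in> B1 \<Longrightarrow> norm v \<le> R"
    using compact_imp_bounded[OF compact_B1] unfolding bounded_iff by blast
  have R0: "R \<ge> 0" using R[OF zero_in_B1] by simp
  have "\<forall>\<^sub>F u :: real in at_top. exp (- u) < e / (R + 1)"
    using assms R0 by (intro eventually_exp_neg_less) simp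
  then show ?thesis
  proof eventually_elim
    case (elim u)
    show ?case
    proof
      fix v :: "real ^ 'd" assume "v \<in> B1"
      then have "norm v \<le> R + 1" using R[of v] by linarith
      then have "exp (- u) * norm v \<le> exp (- u) * (R + 1)" by (intro mult_left_mono) auto
      also have "\<dots> < e" using elim R0 by (simp add: field_simps)
      finally show "norm (exp (- u) *\<^sub>R v) < e" by simp
    qed
  qed
qed

text \<open>The error of the linear approximation at \<open>x\<close> is a small multiple of
  \<open>exp (- u) * norm v\<close>. The outer scale cancels this factor up to \<open>exp s\<close>,
  and \<open>v\<close> is bounded on \<open>B1\<close>.\<close>

lemma blow_up_uniform_limit:
  fixes f :: "real ^ 'd \<Rightarrow> real ^ 'd"
  assumes U: "open U" "x \<in> U" and A: "(f has_derivative A) (at x)"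
  shows "uniform_limit B1 (blow_up U f x s) (\<lambda>v. exp s *\<^sub>R A v) at_top"
proof (rule uniform_limitI)
  fix \<epsilon> :: real assume \<epsilon>: "\<epsilon> > 0"
  have lin: "linear A" using A by (rule has_derivative_linear)
  obtain R where R: "\<And>v :: real ^ 'd. v \<in> B1 \<Longrightarrow> norm v \<le> R"
    using compact_imp_bounded[OF compact_B1] unfolding bounded_iff by blast
  have R0: "R \<ge> 0" using R[OF zero_in_B1] by simp
  \<comment> \<open>Chosen so that \<open>exp s * e * (R + 1)\<close> is
    \<open>\<epsilon> / 2\<close>; adding \<open>1\<close> to \<open>R\<close> guarantees a positive
    divisor.\<close>
  define e where "e = \<epsilon> / (2 * exp s * (R + 1))"
  have e: "e > 0" using \<epsilon> R0 by (simp add: e_def)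
  have "\<exists>d>0. \<forall>z. norm (z - x) < d \<longrightarrow> norm (f z - f x - A (z - x)) \<le> e * norm (z - x)"
    using A e unfolding has_derivative_at_alt by blast
  then obtain d where d: "d > 0" "\<And>z. norm (z - x) < d \<Longrightarrow> norm (f z - f x - A (z - x)) \<le> e * norm (z - x)"
    by blast
  obtain d' where d': "d' > 0" "ball x d' \<subseteq> U" using U openE by blast
  have near: "\<forall>\<^sub>F u in at_top. \<forall>v\<in>B1. norm (exp (- u) *\<^sub>R (v :: real ^ 'd)) < r" if "r > 0" for r
    using that by (rule eventually_scaled_B1)
  show "\<forall>\<^sub>F u in at_top. \<forall>v\<in>B1. dist (blow_up U f x s u v) (exp s *\<^sub>R A v) < \<epsilon>"
    using near[OF d(1)] near[OF d'(1)]
  proof eventually_elim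
    case (elim u)
    show ?case
    proof
      fix v :: "real ^ 'd" assume v: "v \<in> B1"
      define z where "z = x + exp (- u) *\<^sub>R v"
      have zx: "z - x = exp (- u) *\<^sub>R v" by (simp add: z_def)
      have "z \<in> U" using d'(2) elim(2) v by (auto simp: z_def dist_norm subset_iff)
      have "v = exp u *\<^sub>R (z - x)" by (simp add: zx exp_minus)
      then have "A v = exp u *\<^sub>R A (z - x)" by (metis lin linear_cmul)
      then have "blow_up U f x s u v - exp s *\<^sub>R A v = exp (u + s) *\<^sub>R (f z - f x - A (z - x))"
        using \<open>z \<in> U\<close> by (simp add: blow_up_def z_def[symmetric] scaleR_diff_right exp_add mult.commute)
      then have "dist (blow_up U f x s u v) (exp s *\<^sub>R A v) = exp (u + s) * norm (f z - f x - A (z - x))"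
        by (simp add: dist_norm)
      also have "\<dots> \<le> exp (u + s) * (e * norm (z - x))"
        using d(2)[of z] elim(1) v by (intro mult_left_mono) (auto simp: zx)
      also have "\<dots> = exp s * e * norm v" by (simp add: zx exp_add exp_minus field_simps)
      also have "\<dots> \<le> exp s * e * (R + 1)"
        using R[OF v] e by (intro mult_left_mono) auto
      also have "\<dots> = \<epsilon> / 2"
      proof -
        have "exp s * (\<epsilon> / (2 * exp s * q)) * q = \<epsilon> / 2" if "q > 0" for q using that by simp
        from this[of "R + 1"] show ?thesis using R0 by (simp add: e_def)
      qed
      also have "\<dots> < \<epsilon>" using \<epsilon> by simp
      finally show "dist (blow_up U f x s u v) (exp s *\<^sub>R A v) < \<epsilon>" .
    qed
  qed
qed

section \<open>Sceneries of the push-forward in terms of sceneries of the measure\<close>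

lemma emeasure_zoom_translate:
  fixes \<mu> :: "(real ^ 'd) measure"
  assumes \<mu>: "sets \<mu> = sets borel" and U: "U \<in> sets borel" and f: "f \<in> borel_measurable (restrict_space borel U)"
    and E: "E \<in> sets borel"
  shows "emeasure (zoom t (translate y (push_on U f \<mu>))) E = emeasure \<mu> {z \<in> U. exp t *\<^sub>R (f z - y) \<in> E}"
proof -
  have sp: "space \<mu> = UNIV" using \<mu> by (rule space_of_sets_borel)
  have "(\<lambda>z. exp t *\<^sub>R (f z - y)) \<in> borel_measurable (restrict_space borel U)" using f by measurable
  then have "(\<lambda>z. exp t *\<^sub>R (f z - y)) \<in> borel_measurable (restrict_space \<mu> U)"
    using \<mu> by (simp cong: measurable_cong_sets sets_restrict_space_cong)
  then have "emeasure (zoom t (translate y (push_on U f \<mu>))) E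
      = emeasure (restrict_space \<mu> U) ((\<lambda>z. exp t *\<^sub>R (f z - y)) -` E \<inter> U)"
    unfolding zoom_translate_push_on[OF \<mu> f] using E sp
    by (subst emeasure_distr) (simp_all add: space_restrict_space)
  also have "\<dots> = emeasure \<mu> ((\<lambda>z. exp t *\<^sub>R (f z - y)) -` E \<inter> U)"
    using U \<mu> sp by (subst emeasure_restrict_space) simp_all
  also have "(\<lambda>z. exp t *\<^sub>R (f z - y)) -` E \<inter> U = {z \<in> U. exp t *\<^sub>R (f z - y) \<in> E}" by auto
  finally show ?thesis .
qed

text \<open>The preimage of \<open>B1\<close> contains an open neighbourhood of \<open>x\<close>, so
  its mass is positive, and \<open>L\<close> confines it to a bounded set, so its mass is finite.
  Finiteness is the delicate half, since a push-forward need not be locally finite.\<close>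

lemma normalizable_zoom_translate:
  fixes \<mu> :: "(real ^ 'd) measure"
  assumes \<mu>: "\<mu> \<in> radon" and U: "open U" and f: "continuous_on U f" and x: "x \<in> U" "x \<in> supp \<mu>"
    and L: "\<And>z. z \<in> U \<Longrightarrow> infnorm (f z - f x) \<le> exp (- t) \<Longrightarrow> infnorm (z - x) \<le> r"
  shows "normalizable (zoom t (translate (f x) (push_on U f \<mu>)))"
proof -
  note st = radonD(1)[OF \<mu>]
  have fm: "f \<in> borel_measurable (restrict_space borel U)"
    using f by (rule borel_measurable_continuous_on_restrict)
  have eq: "emeasure (zoom t (translate (f x) (push_on U f \<mu>))) B1
      = emeasure \<mu> {z \<in> U. infnorm (f z - f x) \<le> exp (- t)}"
    using U fm by (subst emeasure_zoom_translate[OF st]) (simp_all add: B1_iff infnorm_le_exp_iff borel_open)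
  have cl: "closedin (top_of_set U) {z \<in> U. infnorm (f z - f x) \<le> exp (- t)}"
  proof -
    have "continuous_on U (\<lambda>z. infnorm (f z - f x))" using f by (intro continuous_intros)
    from continuous_closedin_preimage[OF this closed_atMost[of "exp (- t)"]]
    show ?thesis by (simp add: vimage_def Int_def)
  qed
  then obtain T where "closed T" "{z \<in> U. infnorm (f z - f x) \<le> exp (- t)} = U \<inter> T"
    unfolding closedin_closed by blast
  then have m: "{z \<in> U. infnorm (f z - f x) \<le> exp (- t)} \<in> sets \<mu>"
    using U st by (simp add: borel_open borel_closed)
  have "open {z \<in> U. infnorm (f z - f x) < exp (- t)}"
  proof -
    have "continuous_on U (\<lambda>z. infnorm (f z - f x))" using f by (intro continuous_intros)
    from continuous_open_preimage[OF this U open_lessThan[of "exp (- t)"]]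
    show ?thesis by (simp add: vimage_def Int_def)
  qed
  then have "0 < emeasure \<mu> {z \<in> U. infnorm (f z - f x) < exp (- t)}"
    using x by (simp add: supp_def infnorm_0)
  also have "\<dots> \<le> emeasure \<mu> {z \<in> U. infnorm (f z - f x) \<le> exp (- t)}"
    using m by (intro emeasure_mono) auto
  finally have pos: "0 < emeasure \<mu> {z \<in> U. infnorm (f z - f x) \<le> exp (- t)}" .
  have comp: "compact ((\<lambda>w. x + w) ` {w. infnorm w \<le> r})"
    by (rule compact_continuous_image) (auto intro: continuous_intros)
  have "emeasure \<mu> {z \<in> U. infnorm (f z - f x) \<le> exp (- t)} \<le> emeasure \<mu> ((\<lambda>w. x + w) ` {w. infnorm w \<le> r})"
  proof (rule emeasure_mono)
    show "{z \<in> U. infnorm (f z - f x) \<le> exp (- t)} \<subseteq> (\<lambda>w. x + w) ` {w. infnorm w \<le> r}"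
    proof clarify
      fix z assume "z \<in> U" "infnorm (f z - f x) \<le> exp (- t)"
      then show "z \<in> (\<lambda>w. x + w) ` {w. infnorm w \<le> r}"
        using L by (intro image_eqI[of _ _ "z - x"]) auto
    qed
  qed (use comp st in \<open>simp add: compact_imp_closed borel_closed\<close>)
  also have "\<dots> < \<infinity>" using radonD(2)[OF \<mu> comp] .
  finally show ?thesis unfolding normalizable_def eq using pos by simp
qed

text \<open>By \<open>L\<close>, every point that \<open>f\<close> brings into the window of size
  \<open>exp (- (u + s))\<close> around \<open>f x\<close> lies within \<open>exp (- u)\<close> of
  \<open>x\<close>. So restricting to \<open>B1\<close> at time \<open>u\<close> loses no mass that
  is visible at time \<open>u + s\<close>, and the two measures agree on \<open>B1\<close> up to the
  normalizing factor of the first.\<close>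

lemma scenery_push_on_eq:
  fixes \<mu> :: "(real ^ 'd) measure"
  assumes \<mu>: "\<mu> \<in> radon" and U: "open U" and f: "continuous_on U f" and x: "x \<in> supp \<mu>"
    and L: "\<And>z. z \<in> U \<Longrightarrow> infnorm (f z - f x) \<le> \<delta> \<Longrightarrow> infnorm (z - x) \<le> exp s * infnorm (f z - f x)"
    and \<delta>: "exp (- (u + s)) \<le> \<delta>" and inU: "\<And>v. v \<in> B1 \<Longrightarrow> x + exp (- u) *\<^sub>R v \<in> U"
  shows "scenery (push_on U f \<mu>) (f x) (u + s) = box (distr (scenery \<mu> x u) borel (blow_up U f x s u))"
proof -
  note st = radonD(1)[OF \<mu>]
  define Z where "Z = zoom u (translate x \<mu>)"
  let ?g = "blow_up U f x s u"
  have fm: "f \<in> borel_measurable (restrict_space borel U)"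
    using f by (rule borel_measurable_continuous_on_restrict)
  have gm: "?g \<in> borel_measurable borel" by (rule blow_up_measurable[OF U f])
  have stZ: "sets Z = sets borel" by (simp add: Z_def zoom_def)
  have eZ: "emeasure Z E = emeasure \<mu> {z. exp u *\<^sub>R (z - x) \<in> E}" if "E \<in> sets borel" for E
    using emeasure_zoom_translate[OF st, of UNIV "\<lambda>z. z" E u x] that
    by (simp add: Z_def push_on_id st)
  have nZ: "normalizable Z"
    using normalizable_zoom_translate[OF \<mu> open_UNIV continuous_on_id UNIV_I x, of u "exp (- u)"]
    by (simp add: Z_def push_on_id st)
  then have c: "emeasure Z B1 \<noteq> 0" "emeasure Z B1 \<noteq> \<infinity>" by (auto simp: normalizable_def)
  have boxZ: "box Z \<in> topspace Mbox" using stZ by (rule box_in_Mbox)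
  have "box (zoom (u + s) (translate (f x) (push_on U f \<mu>))) = box (distr (box Z) borel ?g)"
  proof (rule box_cong_scaled[OF _ _ c])
    fix E :: "(real ^ 'd) set" assume E: "E \<in> sets borel" "E \<subseteq> B1"
    have gE: "?g -` E \<in> sets borel" using measurable_sets[OF gm E(1)] by simp
    have "emeasure (distr (box Z) borel ?g) E = emeasure (box Z) (?g -` E \<inter> B1)"
      using E gm Mbox_spaceD(3)[OF boxZ]
      by (subst emeasure_distr) (auto simp: Mbox_measurable[OF boxZ] intro: measurable_restrict_space1)
    also have "\<dots> = inverse (emeasure Z B1) * emeasure Z (?g -` E \<inter> B1)"
      by (rule emeasure_box[OF stZ nZ]) simp
    finally have "emeasure Z B1 * emeasure (distr (box Z) borel ?g) E = emeasure Z (?g -` E \<inter> B1)"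
      using c by (simp add: mult.assoc[symmetric] divide_ennreal_def[symmetric] ennreal_divide_self less_top zero_less_iff_neq_zero)
    moreover have "emeasure Z (?g -` E \<inter> B1) = emeasure \<mu> {z. exp u *\<^sub>R (z - x) \<in> ?g -` E \<inter> B1}"
      using gE by (intro eZ) simp
    \<comment> \<open>From left to right, \<open>inU\<close> puts the point in \<open>U\<close>,
      where \<open>blow_up\<close> does not take its default value; from right to left,
      \<open>L\<close> puts the rescaled point in \<open>B1\<close>.\<close>
    moreover have "{z. exp u *\<^sub>R (z - x) \<in> ?g -` E \<inter> B1} = {z \<in> U. exp (u + s) *\<^sub>R (f z - f x) \<in> E}"
    proof (intro set_eqI)
      fix z
      let ?v = "exp u *\<^sub>R (z - x)"
      have xv: "x + exp (- u) *\<^sub>R ?v = z" by (simp add: exp_minus)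
      have g: "?g ?v = exp (u + s) *\<^sub>R (f z - f x)" if "z \<in> U" using that unfolding blow_up_def xv by simp
      have "?v \<in> B1" if z: "z \<in> U" and fz: "exp (u + s) *\<^sub>R (f z - f x) \<in> E"
      proof -
        have fz': "infnorm (f z - f x) \<le> exp (- (u + s))"
          using fz E(2) infnorm_le_exp_iff[of "u + s" "f z - f x"] by (auto simp: B1_alt)
        then have "infnorm (z - x) \<le> exp s * infnorm (f z - f x)" using L[OF z] \<delta> by linarith
        also have "\<dots> \<le> exp s * exp (- (u + s))" using fz' by (intro mult_left_mono) auto
        also have "\<dots> = exp (- u)" by (simp add: exp_add[symmetric])
        finally show ?thesis unfolding B1_iff infnorm_le_exp_iff .
      qed
      moreover have "z \<in> U" if "?v \<in> B1" using inU[OF that] xv by simp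
      ultimately show "z \<in> {z. exp u *\<^sub>R (z - x) \<in> ?g -` E \<inter> B1}
          \<longleftrightarrow> z \<in> {z \<in> U. exp (u + s) *\<^sub>R (f z - f x) \<in> E}"
        using g by auto
    qed
    ultimately show "emeasure (zoom (u + s) (translate (f x) (push_on U f \<mu>))) E
        = emeasure Z B1 * emeasure (distr (box Z) borel ?g) E"
      using emeasure_zoom_translate[OF st _ fm E(1)] U by (simp add: borel_open)
  qed (simp_all add: zoom_def)
  then show ?thesis by (simp add: scenery_def Z_def)
qed

section \<open>Linear images of restricted and rescaled measures\<close>

text \<open>The preimage of \<open>B1\<close> under \<open>B\<close> lies in \<open>B1\<close>, so
  restricting to \<open>B1\<close> before applying \<open>B\<close> discards nothing that the final
  restriction keeps.\<close>

lemma box_distr_box: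
  fixes B :: "real ^ 'd \<Rightarrow> real ^ 'd"
  assumes \<theta>: "\<theta> \<in> topspace Mstar" and B: "linear B" "\<And>z. infnorm (B z) \<le> 1 \<Longrightarrow> z \<in> B1"
  shows "box (distr (box \<theta>) borel B) = box (distr \<theta> borel B)"
proof (rule box_cong_scaled[where c = 1])
  have st: "sets \<theta> = sets borel" and \<theta>1: "emeasure \<theta> B1 = 1" using \<theta> by (auto simp: topspace_Mstar radonD)
  have nm: "normalizable \<theta>" by (simp add: normalizable_def \<theta>1)
  have Bm: "B \<in> borel_measurable borel" using B(1) by (rule linear_borel_measurable)
  fix E :: "(real ^ 'd) set" assume E: "E \<in> sets borel" "E \<subseteq> B1"
  have BE: "B -` E \<inter> B1 = B -` E" using E(2) B(2) by (auto simp: B1_alt)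
  have "emeasure (distr (box \<theta>) borel B) E = emeasure (box \<theta>) (B -` E \<inter> B1)"
    using E Bm space_box[OF st] box_in_Mbox[OF st]
    by (subst emeasure_distr) (auto simp: Mbox_measurable intro: measurable_restrict_space1)
  also have "\<dots> = emeasure \<theta> (B -` E)"
    unfolding BE using BE emeasure_box[OF st nm, of "B -` E"] by (auto simp: \<theta>1)
  also have "\<dots> = emeasure (distr \<theta> borel B) E"
    using E Bm st by (subst emeasure_distr) (simp_all add: space_of_sets_borel cong: measurable_cong_sets)
  finally show "emeasure (distr (box \<theta>) borel B) E = 1 * emeasure (distr \<theta> borel B) E" by simp
qed auto

lemma box_distr_star:
  fixes B :: "real ^ 'd \<Rightarrow> real ^ 'd"
  assumes st: "sets M = sets borel" and nm: "normalizable M" and B: "linear B"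
  shows "box (distr (star M) borel B) = box (distr M borel B)"
proof (rule box_cong_scaled[where c = "inverse (emeasure M B1)"])
  have Bm: "B \<in> borel_measurable borel" using B by (rule linear_borel_measurable)
  fix E :: "(real ^ 'd) set" assume E: "E \<in> sets borel" "E \<subseteq> B1"
  show "emeasure (distr (star M) borel B) E = inverse (emeasure M B1) * emeasure (distr M borel B) E"
    using E Bm st sets_star[OF st]
    by (subst (1 2) emeasure_distr) (simp_all add: space_of_sets_borel emeasure_star[OF nm] cong: measurable_cong_sets)
qed (use nm in \<open>auto simp: normalizable_def\<close>)

text \<open>\<open>P\<close> is its own image under the normalized zoom by \<open>s\<close>. The
  zoom composed with \<open>A\<close> is \<open>exp s\<close> times \<open>A\<close>, and the inner
  normalization is absorbed by the outer one; it is a genuine normalization because almost every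
  \<open>\<theta>\<close> has \<open>0\<close> in its support.\<close>

lemma linear_box_scale:
  fixes A :: "real ^ 'd \<Rightarrow> real ^ 'd"
  assumes P: "P \<in> prob_measures Mstar" and inv: "zoom_invariant P" and A: "linear A"
  shows "linear_box A P = linear_box (\<lambda>v. exp s *\<^sub>R A v) P"
proof -
  have setsP: "sets P = sets (borel_of Mstar)" using P by (rule prob_measuresD)
  have spP: "space P = topspace Mstar" using sets_eq_imp_space_eq[OF setsP] by simp
  have Z: "(\<lambda>\<theta>. star (zoom s \<theta>)) \<in> measurable P (borel_of Mstar)"
    using star_distr_measurable[OF linear_exp_scale, of s]
    unfolding zoom_def by (simp add: setsP cong: measurable_cong_sets)
  have lin: "linear (\<lambda>v. exp s *\<^sub>R A v)" using A by (rule linear_compose_scale_right)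
  have eq: "box (distr (star (zoom s \<theta>)) borel A) = box (distr \<theta> borel (\<lambda>v. exp s *\<^sub>R A v))"
    if \<theta>: "\<theta> \<in> topspace Mstar" "0 \<in> supp \<theta>" for \<theta>
  proof -
    have rad: "\<theta> \<in> radon" using \<theta> by (simp add: topspace_Mstar)
    have "0 < emeasure \<theta> {z. infnorm (exp s *\<^sub>R z) \<le> 1}"
      by (rule supp_linear_pos[OF radonD(1)[OF rad] \<theta>(2) linear_exp_scale(1)])
    then have "normalizable (zoom s \<theta>)"
      using radonD(2)[OF zoom_radon[OF rad] compact_B1] radonD(1)[OF rad]
      by (simp add: normalizable_def emeasure_zoom B1_iff)
    then have "box (distr (star (zoom s \<theta>)) borel A) = box (distr (zoom s \<theta>) borel A)"
      by (intro box_distr_star A) (simp add: zoom_def)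
    also have "distr (zoom s \<theta>) borel A = distr \<theta> borel (\<lambda>v. exp s *\<^sub>R A v)"
      unfolding zoom_def using linear_borel_measurable[OF A] linear_borel_measurable[OF linear_exp_scale(1)]
        radonD(1)[OF rad]
      by (subst distr_distr) (simp_all add: comp_def linear_cmul[OF A] cong: measurable_cong_sets)
    finally show ?thesis .
  qed
  have "linear_box A P = distr (distr P (borel_of Mstar) (\<lambda>\<theta>. star (zoom s \<theta>))) (borel_of Mbox) (\<lambda>\<theta>. box (distr \<theta> borel A))"
    using inv by (simp add: linear_box_def zoom_invariant_def)
  also have "\<dots> = distr P (borel_of Mbox) (\<lambda>\<theta>. box (distr (star (zoom s \<theta>)) borel A))"
    by (subst distr_distr[OF box_distr_measurable[OF A] Z]) (simp add: comp_def)
  also have "\<dots> = linear_box (\<lambda>v. exp s *\<^sub>R A v) P"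
    unfolding linear_box_def
  proof (rule distr_cong_AE)
    have "AE \<theta> in P. 0 \<in> supp \<theta>" using inv by (simp add: zoom_invariant_def)
    then show "AE \<theta> in P. box (distr (star (zoom s \<theta>)) borel A) = box (distr \<theta> borel (\<lambda>v. exp s *\<^sub>R A v))"
      using AE_space by eventually_elim (use eq spP in blast)
    show "(\<lambda>\<theta>. box (distr (star (zoom s \<theta>)) borel A)) \<in> measurable P (borel_of Mbox)"
      using measurable_compose[OF Z box_distr_measurable[OF A]] .
    show "(\<lambda>\<theta>. box (distr \<theta> borel (\<lambda>v. exp s *\<^sub>R A v))) \<in> measurable P (borel_of Mbox)"
      using box_distr_measurable[OF lin] by (simp add: setsP cong: measurable_cong_sets)
  qed simp_all
  finally show ?thesis .
qed

text \<open>For \<open>T > t0\<close> the set of admissible times contains \<open>{t0..T}\<close>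
  and has positive finite length, so the uniform measure on it is a probability measure and
  integrals become honest averages.\<close>

lemma scenery_distribution_average:
  fixes \<mu> :: "(real ^ 'd) measure"
  assumes \<mu>: "\<mu> \<in> radon" and U: "U \<in> sets borel" and f: "f \<in> borel_measurable (restrict_space borel U)"
    and N: "N = {t. normalizable (zoom t (translate y (push_on U f \<mu>)))}" "{t0..} \<subseteq> N"
    and T: "t0 \<ge> 0" "T > t0"
  shows "scenery_distribution (push_on U f \<mu>) y T \<in> prob_measures Mbox"
    and "\<phi> \<in> borel_measurable (borel_of Mbox) \<Longrightarrow>
      integral\<^sup>L (scenery_distribution (push_on U f \<mu>) y T) \<phi>
      = (LINT t:{0..T} \<inter> N|lborel. \<phi> (scenery (push_on U f \<mu>) y t)) / measure lborel ({0..T} \<inter> N)"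
proof -
  have Nm: "{0..T} \<inter> N \<in> sets lborel"
    using scenery_measurable(2)[OF \<mu> U f] N(1) by simp
  have eq: "scenery_distribution (push_on U f \<mu>) y T
      = distr (uniform_measure lborel ({0..T} \<inter> N)) (borel_of Mbox) (scenery (push_on U f \<mu>) y)"
    unfolding scenery_distribution_def N(1) by (simp add: Int_def)
  have S: "scenery (push_on U f \<mu>) y \<in> measurable (uniform_measure lborel ({0..T} \<inter> N)) (borel_of Mbox)"
    using scenery_measurable(1)[OF \<mu> U f, of y] by (simp cong: measurable_cong_sets)
  have "emeasure lborel {t0..T} \<le> emeasure lborel ({0..T} \<inter> N)"
    using Nm N(2) T by (intro emeasure_mono) auto
  then have "0 < emeasure lborel ({0..T} \<inter> N)" using T by (auto intro: less_le_trans[rotated])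
  moreover have "emeasure lborel ({0..T} \<inter> N) \<le> emeasure lborel {0..T}"
    by (intro emeasure_mono) auto
  ultimately have e: "emeasure lborel ({0..T} \<inter> N) \<noteq> 0" "emeasure lborel ({0..T} \<inter> N) \<noteq> \<infinity>"
    using T by (auto simp: top_unique)
  interpret prob_space "uniform_measure lborel ({0..T} \<inter> N)"
    by (rule prob_space_uniform_measure[OF e])
  show "scenery_distribution (push_on U f \<mu>) y T \<in> prob_measures Mbox"
    unfolding eq prob_measures_def using prob_space_distr[OF S] by simp
  assume \<phi>: "\<phi> \<in> borel_measurable (borel_of Mbox)"
  have "(\<lambda>t. \<phi> (scenery (push_on U f \<mu>) y t)) \<in> borel_measurable lborel"
    using measurable_compose[OF scenery_measurable(1)[OF \<mu> U f] \<phi>] by simp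
  then show "integral\<^sup>L (scenery_distribution (push_on U f \<mu>) y T) \<phi>
      = (LINT t:{0..T} \<inter> N|lborel. \<phi> (scenery (push_on U f \<mu>) y t)) / measure lborel ({0..T} \<inter> N)"
    unfolding eq using S \<phi> Nm e by (simp add: integral_distr integral_uniform_measure)
qed

section \<open>Proof of the theorem\<close>

lemma exp_scale_dominates:
  assumes "L > 0"
  obtains s :: real where "s \<ge> 0" "L \<le> exp s"
proof
  show "max 0 (ln L) \<ge> 0" by simp
  have "L = exp (ln L)" using assms by simp
  also have "\<dots> \<le> exp (max 0 (ln L))" by simp
  finally show "L \<le> exp (max 0 (ln L))" .
qed

lemma linear_infnorm_bounded_below:
  fixes A :: "real ^ 'd \<Rightarrow> real ^ 'd"
  assumes A: "linear A" "inj A"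
  obtains L where "L > 0" "\<And>v. infnorm v \<le> L * infnorm (A v)"
proof -
  obtain c where c: "c > 0" "\<And>v. c * norm v \<le> norm (A v)"
    using linear_inj_bounded_below_pos[OF A] by blast
  let ?n = "sqrt (real DIM(real ^ 'd))"
  have "infnorm v \<le> ?n / c * infnorm (A v)" for v
  proof -
    have "c * infnorm v \<le> c * norm v" using c(1) infnorm_le_norm[of v] by (intro mult_left_mono) auto
    also have "\<dots> \<le> ?n * infnorm (A v)" using c(2)[of v] norm_le_infnorm[of "A v"] by linarith
    finally show ?thesis using c(1) by (simp add: field_simps)
  qed
  then show thesis using c(1) by (intro that[of "?n / c"]) auto
qed

text \<open>Only one inequality is claimed because the approximant lies below the functions it
  approximates. Applied to the negated test function, the bound gives the matching upper
  estimate.\<close>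

lemma scenery_push_on_average_lower_bound:
  fixes \<mu> :: "(real ^ 'd) measure" and f :: "real ^ 'd \<Rightarrow> real ^ 'd"
  assumes \<mu>: "\<mu> \<in> radon" and U: "open U" and V: "open V" and f: "C1_diffeomorphism U V f"
    and x: "x \<in> U" "x \<in> supp \<mu>"
    and P: "P \<in> prob_measures Mstar" and inv: "zoom_invariant P"
    and T: "filterlim T at_top F"
    and lim: "limitin (weak_topology Mbox) (\<lambda>i. scenery_distribution \<mu> x (T i)) (restricted_version P) F"
    and \<phi>: "continuous_map Mbox euclideanreal \<phi>" "\<And>\<theta>. \<theta> \<in> topspace Mbox \<Longrightarrow> \<bar>\<phi> \<theta>\<bar> \<le> C"
    and \<epsilon>: "\<epsilon> > 0"
  defines "A \<equiv> frechet_derivative f (at x)"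
  shows "\<forall>\<^sub>F i in F. scenery_distribution (push_on U f \<mu>) (f x) (T i) \<in> prob_measures Mbox"
    and "\<forall>\<^sub>F i in F. integral\<^sup>L (linear_box A P) \<phi> - \<epsilon>
      \<le> integral\<^sup>L (scenery_distribution (push_on U f \<mu>) (f x) (T i)) \<phi>"
proof -
  note st = radonD(1)[OF \<mu>]
  note D = C1_diffeomorphism_derivative[OF f U x(1) V, folded A_def]
  have fm: "f \<in> borel_measurable (restrict_space borel U)"
    using D(1) by (rule borel_measurable_continuous_on_restrict)
  obtain L \<delta> where L: "L > 0" "\<delta> > 0"
    "\<And>z. z \<in> U \<Longrightarrow> infnorm (f z - f x) \<le> \<delta> \<Longrightarrow> infnorm (z - x) \<le> L * infnorm (f z - f x)"
    using D(5) by blast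
  obtain L' where L': "L' > 0" "\<And>v. infnorm v \<le> L' * infnorm (A v)"
    using linear_infnorm_bounded_below[OF D(3,4)] by blast
  \<comment> \<open>One \<open>s\<close> serves two purposes: \<open>L \<le> exp s\<close> keeps the
    mass seen by \<open>b\<close> inside the window of \<open>a\<close>, and
    \<open>L' \<le> exp s\<close> puts the parallelepiped of \<open>B\<close> inside
    \<open>B1\<close>. That \<open>s \<ge> 0\<close> is used in the time shift.\<close>
  obtain s where s: "s \<ge> 0" "max L L' \<le> exp s"
    using exp_scale_dominates[of "max L L'"] L(1) by (metis less_max_iff_disj)
  define B where "B v = exp s *\<^sub>R A v" for v
  have B: "linear B" "inj B"
    using linear_compose_scale_right[OF D(3)] D(4) by (auto simp: B_def[abs_def] inj_on_def)
  have B_le: "z \<in> B1" if "infnorm (B z) \<le> 1" for z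
  proof -
    have "infnorm z \<le> L' * infnorm (A z)" by (rule L')
    also have "\<dots> \<le> exp s * infnorm (A z)" using s(2) by (intro mult_right_mono) (auto simp: infnorm_pos_le)
    also have "\<dots> \<le> 1" using that by (simp add: B_def infnorm_mul)
    finally show ?thesis by (simp add: B1_iff)
  qed
  let ?G = "blow_up U f x s"
  let ?a = "scenery \<mu> x" and ?b = "scenery (push_on U f \<mu>) (f x)"
  have Gm: "?G u \<in> borel_measurable (restrict_space borel B1)" for u
    using blow_up_measurable[OF U D(1)] by (rule measurable_restrict_space1)
  have "\<forall>\<^sub>F u in at_top. \<forall>v\<in>B1. x + exp (- u) *\<^sub>R v \<in> U"
  proof -
    obtain d where d: "d > 0" "ball x d \<subseteq> U" using U x(1) openE by blast
    have "\<forall>\<^sub>F u in at_top. \<forall>v\<in>B1. norm (exp (- u) *\<^sub>R (v :: real ^ 'd)) < d"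
      using d(1) by (rule eventually_scaled_B1)
    then show ?thesis by (rule eventually_mono) (use d(2) in \<open>auto simp: dist_norm subset_iff\<close>)
  qed
  moreover have "\<forall>\<^sub>F u in at_top. exp (- u) < \<delta>" using L(2) by (rule eventually_exp_neg_less)
  ultimately have "\<forall>\<^sub>F u in at_top. (\<forall>v\<in>B1. x + exp (- u) *\<^sub>R v \<in> U) \<and> exp (- u) < \<delta>"
    by (rule eventually_conj)
  then obtain u1 where u1: "\<And>u v. u \<ge> u1 \<Longrightarrow> v \<in> B1 \<Longrightarrow> x + exp (- u) *\<^sub>R v \<in> U" "\<And>u. u \<ge> u1 \<Longrightarrow> exp (- u) < \<delta>"
    unfolding eventually_at_top_linorder by blast
  have ab: "?b (u + s) = box (distr (?a u) borel (?G u))" if u: "u \<ge> u1" for u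
  proof (rule scenery_push_on_eq[OF \<mu> U D(1) x(2)])
    fix z assume "z \<in> U" "infnorm (f z - f x) \<le> \<delta>"
    then have "infnorm (z - x) \<le> L * infnorm (f z - f x)" by (rule L)
    also have "\<dots> \<le> exp s * infnorm (f z - f x)" using s(2) by (intro mult_right_mono) (auto simp: infnorm_pos_le)
    finally show "infnorm (z - x) \<le> exp s * infnorm (f z - f x)" .
  next
    show "exp (- (u + s)) \<le> \<delta>" using u1(2)[of "u + s"] u s(1) by simp
  qed (use u1 u in auto)
  define N where "N = {t. normalizable (zoom t (translate (f x) (push_on U f \<mu>)))}"
  have N: "t \<in> N" if "t \<ge> u1" for t
  proof -
    have "normalizable (zoom t (translate (f x) (push_on U f \<mu>)))"
    proof (rule normalizable_zoom_translate[OF \<mu> U D(1) x])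
      fix z assume z: "z \<in> U" "infnorm (f z - f x) \<le> exp (- t)"
      then have "infnorm (f z - f x) \<le> \<delta>" using u1(2)[OF that] by linarith
      then have "infnorm (z - x) \<le> L * infnorm (f z - f x)" using L(3) z(1) by blast
      also have "\<dots> \<le> L * exp (- t)" using z(2) L(1) by (intro mult_left_mono) auto
      finally show "infnorm (z - x) \<le> L * exp (- t)" .
    qed
    then show ?thesis by (simp add: N_def)
  qed
  \<comment> \<open>\<open>\<mu>\<close> is viewed as its own image under the identity. All times
    are then admissible, so its scenery distribution is the plain average over
    \<open>{0..T i}\<close>.\<close>
  define N0 where "N0 = {t. normalizable (zoom t (translate x (push_on UNIV (\<lambda>z. z) \<mu>)))}"
  have N0: "N0 = UNIV"
    using normalizable_zoom_translate[OF \<mu> open_UNIV continuous_on_id UNIV_I x(2)]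
    by (auto simp: N0_def)
  have borelU: "U \<in> sets borel" using U by (rule borel_open)
  have Nm: "N \<in> sets borel" unfolding N_def by (rule scenery_measurable(2)[OF \<mu> borelU fm])
  note b_avg = scenery_distribution_average[OF \<mu> borelU fm N_def]
  show "\<forall>\<^sub>F i in F. scenery_distribution (push_on U f \<mu>) (f x) (T i) \<in> prob_measures Mbox"
  proof -
    have "\<forall>\<^sub>F i in F. T i > max 0 u1" using T unfolding filterlim_at_top_dense by blast
    then show ?thesis by (rule eventually_mono) (rule b_avg(1)[of "max 0 u1"], use N in auto)
  qed
  obtain \<psi> :: "nat \<Rightarrow> real ^ 'd \<Rightarrow> real" where \<psi>: "test_sequence \<psi>" using test_sequence_exists ..
  have Q: "prob_space P" and setsP: "sets P = sets (borel_of Mstar)" using P by (auto dest: prob_measuresD)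
  have spP: "space P = topspace Mstar" using sets_eq_imp_space_eq[OF setsP] by simp
  have boxP: "box \<in> measurable P (borel_of Mbox)"
    using box_measurable_Mstar by (simp add: setsP cong: measurable_cong_sets)
  have linP: "(\<lambda>\<theta>. box (distr \<theta> borel B)) \<in> measurable P (borel_of Mbox)"
    using box_distr_measurable[OF B(1)] by (simp add: setsP cong: measurable_cong_sets)
  have \<phi>m: "\<phi> \<in> borel_measurable (borel_of Mbox)" using \<phi>(1) by (rule continuous_map_borel_of_measurable)
  have gm: "(\<lambda>\<theta>. \<phi> (box (distr \<theta> borel B))) \<in> borel_measurable P"
    using measurable_compose[OF linP \<phi>m] .
  \<comment> \<open>One half of \<open>\<epsilon>\<close> is spent on the continuous approximant,
    the other on the passage to time averages.\<close>
  have "\<epsilon> / 2 > 0" using \<epsilon> by simp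
  \<comment> \<open>Continuous convergence in the form the approximant requires: the times and the
    measures vary together along arbitrary sequences. It holds where \<open>0\<close> is in the
    support and the boundary of the parallelepiped is null.\<close>
  have AE: "AE \<theta> in P. \<forall>t \<tau>. filterlim t at_top sequentially \<longrightarrow> (\<forall>n. \<tau> n \<in> topspace Mbox) \<longrightarrow>
      limitin Mbox \<tau> (box \<theta>) sequentially \<longrightarrow>
      (\<lambda>n. \<phi> (box (distr (\<tau> n) borel (?G (t n))))) \<longlonglongrightarrow> \<phi> (box (distr \<theta> borel B))"
  proof -
    have "AE \<theta> in P. 0 \<in> supp \<theta>" using inv by (simp add: zoom_invariant_def)
    with zoom_invariant_boundary_null[OF P inv B] AE_space show ?thesis
    proof eventually_elim
      case (elim \<theta>)
      have \<theta>: "\<theta> \<in> topspace Mstar" using elim spP by simp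
      then have st\<theta>: "sets \<theta> = sets borel" and \<theta>1: "emeasure \<theta> B1 = 1" by (auto simp: topspace_Mstar radonD)
      have nm: "normalizable \<theta>" by (simp add: normalizable_def \<theta>1)
      have eB: "emeasure (box \<theta>) {z \<in> B1. infnorm (B z) \<le> 1} = emeasure \<theta> {z. infnorm (B z) \<le> 1}"
        "emeasure (box \<theta>) {z \<in> B1. infnorm (B z) = 1} = emeasure \<theta> {z. infnorm (B z) = 1}"
      proof -
        have box\<theta>: "emeasure (box \<theta>) E = emeasure \<theta> E" if "E \<subseteq> B1" for E
          using emeasure_box[OF st\<theta> nm that] by (simp add: \<theta>1)
        have sub: "{z. infnorm (B z) \<le> 1} \<subseteq> B1" "{z. infnorm (B z) = 1} \<subseteq> B1" using B_le by auto
        then have "{z \<in> B1. infnorm (B z) \<le> 1} = {z. infnorm (B z) \<le> 1}"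
          "{z \<in> B1. infnorm (B z) = 1} = {z. infnorm (B z) = 1}" by auto
        then show "emeasure (box \<theta>) {z \<in> B1. infnorm (B z) \<le> 1} = emeasure \<theta> {z. infnorm (B z) \<le> 1}"
          "emeasure (box \<theta>) {z \<in> B1. infnorm (B z) = 1} = emeasure \<theta> {z. infnorm (B z) = 1}"
          using box\<theta>[OF sub(1)] box\<theta>[OF sub(2)] by (simp_all only:)
      qed
      show ?case
      proof (intro allI impI)
        fix t :: "nat \<Rightarrow> real" and \<tau> :: "nat \<Rightarrow> (real ^ 'd) measure"
        assume t: "filterlim t at_top sequentially" and \<tau>: "\<forall>n. \<tau> n \<in> topspace Mbox"
          and l: "limitin Mbox \<tau> (box \<theta>) sequentially"
        have "limitin Mbox (\<lambda>n. box (distr (\<tau> n) borel (?G (t n)))) (box (distr (box \<theta>) borel B)) sequentially"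
        proof (rule limitin_Mbox_box_distr[OF l _ Gm])
          show "uniform_limit B1 (\<lambda>n. ?G (t n)) B sequentially"
            using filterlim_compose[OF blow_up_uniform_limit[OF U x(1) D(2), of s] t] by (simp add: B_def[abs_def])
          show "continuous_on B1 B" using B(1) by (simp add: linear_continuous_on linear_conv_bounded_linear)
          show "emeasure (box \<theta>) {z \<in> B1. infnorm (B z) = 1} = 0" using elim eB by simp
          show "emeasure (box \<theta>) {z \<in> B1. infnorm (B z) \<le> 1} > 0"
            unfolding eB(1) using elim by (intro supp_linear_pos[OF st\<theta> _ B(1)]) simp
        qed (use \<tau> in simp)
        from continuous_map_limit[OF \<phi>(1) this]
        show "(\<lambda>n. \<phi> (box (distr (\<tau> n) borel (?G (t n))))) \<longlonglongrightarrow> \<phi> (box (distr \<theta> borel B))"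
          using box_distr_box[OF \<theta> B(1) B_le] by (simp add: comp_def)
      qed
    qed
  qed
  have h_bd: "\<bar>\<phi> (box (distr \<theta> borel (?G t)))\<bar> \<le> C" for t \<theta>
    by (intro \<phi>(2) box_in_Mbox) simp
  obtain H t1 where H: "continuous_map Mbox euclideanreal H" "\<And>\<theta>. \<theta> \<in> topspace Mbox \<Longrightarrow> \<bar>H \<theta>\<bar> \<le> C"
    "\<And>\<theta> t. \<theta> \<in> topspace Mbox \<Longrightarrow> t \<ge> t1 \<Longrightarrow> H \<theta> \<le> \<phi> (box (distr \<theta> borel (?G t)))"
    "(\<integral>\<theta>. \<phi> (box (distr \<theta> borel B)) \<partial>P) - \<epsilon> / 2 \<le> (\<integral>\<theta>. H (box \<theta>) \<partial>P)"
    by (rule continuous_lower_approximant[OF Mbox_pullback[OF \<psi>] Q boxP h_bd gm AE \<open>\<epsilon> / 2 > 0\<close>]) blast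
  have Hm: "H \<in> borel_measurable (borel_of Mbox)" using H(1) by (rule continuous_map_borel_of_measurable)
  have a_in: "?a t \<in> topspace Mbox" and b_in: "?b t \<in> topspace Mbox" for t
    unfolding scenery_def by (auto intro!: box_in_Mbox simp: zoom_def)
  have am: "?a \<in> measurable borel (borel_of Mbox)"
    using scenery_measurable(1)[OF \<mu> _ , of UNIV "\<lambda>z. z" x] by (simp add: push_on_id st)
  have bm: "?b \<in> measurable borel (borel_of Mbox)" by (rule scenery_measurable(1)[OF \<mu> borelU fm])
  \<comment> \<open>Beyond \<open>u1\<close> the sceneries are related by the blow-up, and beyond
    \<open>t1\<close> the approximant lies below.\<close>
  define t0 where "t0 = max 0 (max u1 t1)"
  have "((\<lambda>i. (LINT t:{0..T i}|lborel. H (?a t)) / T i) \<longlongrightarrow> (\<integral>\<theta>. H (box \<theta>) \<partial>P)) F"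
  proof -
    have "((\<lambda>i. integral\<^sup>L (scenery_distribution \<mu> x (T i)) H) \<longlongrightarrow> integral\<^sup>L (restricted_version P) H) F"
    proof -
      have "bounded (H ` topspace Mbox)" using H(2) by (intro boundedI[of _ C]) auto
      then show ?thesis using lim H(1) unfolding weak_topology_def limitin_test_topology by blast
    qed
    moreover have "integral\<^sup>L (restricted_version P) H = (\<integral>\<theta>. H (box \<theta>) \<partial>P)"
      unfolding restricted_version_def by (rule integral_distr[OF boxP Hm])
    moreover have "\<forall>\<^sub>F i in F. T i > 0" using T unfolding filterlim_at_top_dense by blast
    then have "\<forall>\<^sub>F i in F. integral\<^sup>L (scenery_distribution \<mu> x (T i)) H = (LINT t:{0..T i}|lborel. H (?a t)) / T i"
    proof eventually_elim
      case (elim i)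
      show ?case
        using scenery_distribution_average(2)[OF \<mu> _ _ N0_def, of 0 "T i" H] N0 Hm elim
        by (simp add: push_on_id st)
    qed
    ultimately show ?thesis by (simp add: filterlim_cong)
  qed
  then have "\<forall>\<^sub>F i in F. (\<integral>\<theta>. H (box \<theta>) \<partial>P) - \<epsilon> / 2
      \<le> (LINT t:{0..T i} \<inter> N|lborel. \<phi> (?b t)) / measure lborel ({0..T i} \<inter> N)"
  proof (intro average_shift_lower_bound[where u = "\<lambda>t. H (?a t)" and v = "\<lambda>t. \<phi> (?b t)" and C = C and s = s and ?t0.0 = t0] T)
    show "H (?a t) \<le> \<phi> (?b (t + s))" if "t \<ge> t0" for t
      using H(3)[OF a_in, of t1 t] ab[of t] H(3)[OF a_in, of t t] that by (simp add: t0_def)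
  qed (use Nm N s(1) \<open>\<epsilon> / 2 > 0\<close> H(2) \<phi>(2) a_in b_in measurable_compose[OF am Hm] measurable_compose[OF bm \<phi>m]
      in \<open>auto simp: t0_def\<close>)
  moreover have "\<forall>\<^sub>F i in F. T i > t0" using T unfolding filterlim_at_top_dense by blast
  ultimately show "\<forall>\<^sub>F i in F. integral\<^sup>L (linear_box A P) \<phi> - \<epsilon>
      \<le> integral\<^sup>L (scenery_distribution (push_on U f \<mu>) (f x) (T i)) \<phi>"
  proof eventually_elim
    case (elim i)
    have "integral\<^sup>L (linear_box A P) \<phi> = integral\<^sup>L (linear_box B P) \<phi>"
      using linear_box_scale[OF P inv D(3), of s] by (simp add: B_def[abs_def])
    also have "\<dots> = (\<integral>\<theta>. \<phi> (box (distr \<theta> borel B)) \<partial>P)"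
      unfolding linear_box_def by (rule integral_distr[OF linP \<phi>m])
    finally have "integral\<^sup>L (linear_box A P) \<phi> - \<epsilon> \<le> (\<integral>\<theta>. H (box \<theta>) \<partial>P) - \<epsilon> / 2" using H(4) by linarith
    moreover have "integral\<^sup>L (scenery_distribution (push_on U f \<mu>) (f x) (T i)) \<phi>
        = (LINT t:{0..T i} \<inter> N|lborel. \<phi> (?b t)) / measure lborel ({0..T i} \<inter> N)"
      by (rule b_avg(2)[of t0, OF _ _ _ \<phi>m]) (use N elim(2) in \<open>auto simp: t0_def\<close>)
    ultimately show ?case using elim(1) by linarith
  qed
qed

text \<open>The lower bounds for \<open>\<phi>\<close> and for its negative squeeze the integrals.
  The filter stays arbitrary so that sequences of times and the full limit are both
  instances.\<close>

lemma scenery_push_on_limit: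
  fixes \<mu> :: "(real ^ 'd) measure" and f :: "real ^ 'd \<Rightarrow> real ^ 'd"
  assumes \<mu>: "\<mu> \<in> radon" and U: "open U" and V: "open V" and f: "C1_diffeomorphism U V f"
    and x: "x \<in> U" "x \<in> supp \<mu>"
    and P: "P \<in> prob_measures Mstar" and inv: "zoom_invariant P"
    and T: "filterlim T at_top F"
    and lim: "limitin (weak_topology Mbox) (\<lambda>i. scenery_distribution \<mu> x (T i)) (restricted_version P) F"
  shows "limitin (weak_topology Mbox) (\<lambda>i. scenery_distribution (push_on U f \<mu>) (f x) (T i))
    (linear_box (frechet_derivative f (at x)) P) F"
proof -
  let ?A = "frechet_derivative f (at x)"
  note bound = scenery_push_on_average_lower_bound[OF \<mu> U V f x P inv T lim]
  have ev: "\<forall>\<^sub>F i in F. scenery_distribution (push_on U f \<mu>) (f x) (T i) \<in> prob_measures Mbox"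
    by (rule bound(1)[of "\<lambda>_. 0" 0 1]) auto
  have setsP: "sets P = sets (borel_of Mstar)" using P by (rule prob_measuresD)
  have lin: "linear ?A" by (rule C1_diffeomorphism_derivative(3)[OF f U x(1) V])
  have "(\<lambda>\<theta>. box (distr \<theta> borel ?A)) \<in> measurable P (borel_of Mbox)"
    using box_distr_measurable[OF lin] by (simp add: setsP cong: measurable_cong_sets)
  then have "linear_box ?A P \<in> prob_measures Mbox"
    unfolding linear_box_def prob_measures_def using prob_measuresD(2)[OF P]
    by (simp add: prob_space.prob_space_distr)
  moreover have "((\<lambda>i. integral\<^sup>L (scenery_distribution (push_on U f \<mu>) (f x) (T i)) \<phi>)
      \<longlongrightarrow> integral\<^sup>L (linear_box ?A P) \<phi>) F"
    if \<phi>: "continuous_map Mbox euclideanreal \<phi>" "bounded (\<phi> ` topspace Mbox)" for \<phi>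
  proof -
    obtain C where C: "\<And>\<theta>. \<theta> \<in> topspace Mbox \<Longrightarrow> \<bar>\<phi> \<theta>\<bar> \<le> C"
      using \<phi>(2) unfolding bounded_iff by auto
    have \<phi>': "continuous_map Mbox euclideanreal (\<lambda>\<theta>. - \<phi> \<theta>)" "\<And>\<theta>. \<theta> \<in> topspace Mbox \<Longrightarrow> \<bar>- \<phi> \<theta>\<bar> \<le> C"
      using \<phi>(1) C by (auto intro: continuous_map_minus)
    show ?thesis
    proof (rule tendstoI)
      fix \<epsilon> :: real assume "\<epsilon> > 0"
      then have e: "\<epsilon> / 2 > 0" by simp
      have lower: "\<forall>\<^sub>F i in F. integral\<^sup>L (linear_box ?A P) \<phi> - \<epsilon> / 2
          \<le> integral\<^sup>L (scenery_distribution (push_on U f \<mu>) (f x) (T i)) \<phi>"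
        by (rule bound(2)[OF \<phi>(1) _ e]) (rule C)
      have upper: "\<forall>\<^sub>F i in F. integral\<^sup>L (linear_box ?A P) (\<lambda>\<theta>. - \<phi> \<theta>) - \<epsilon> / 2
          \<le> integral\<^sup>L (scenery_distribution (push_on U f \<mu>) (f x) (T i)) (\<lambda>\<theta>. - \<phi> \<theta>)"
        by (rule bound(2)[OF \<phi>'(1) _ e]) (rule \<phi>'(2))
      show "\<forall>\<^sub>F i in F. dist (integral\<^sup>L (scenery_distribution (push_on U f \<mu>) (f x) (T i)) \<phi>)
          (integral\<^sup>L (linear_box ?A P) \<phi>) < \<epsilon>"
        using lower upper
      proof eventually_elim
        case (elim i)
        then show ?case using \<open>\<epsilon> > 0\<close> by (simp add: dist_real_def)
      qed
    qed
  qed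
  ultimately show ?thesis using ev unfolding weak_topology_def limitin_test_topology by blast
qed

theorem proposition1p9:
  fixes \<mu> :: "(real ^ 'd) measure"
    and U V :: "(real ^ 'd) set"
    and f :: "real ^ 'd \<Rightarrow> real ^ 'd"
    and x :: "real ^ 'd"
  assumes "\<mu> \<in> radon"
    and "open U" and "emeasure \<mu> (- U) = 0"
    and "open V" and "C1_diffeomorphism U V f"
    and "x \<in> U \<inter> supp \<mu>"
  shows "(\<forall>(T :: nat \<Rightarrow> real) P P'.
            filterlim T at_top sequentially \<longrightarrow>
            fractal_distribution P' \<longrightarrow> P = restricted_version P' \<longrightarrow>
            limitin (weak_topology Mbox) (\<lambda>i. scenery_distribution \<mu> x (T i)) P sequentially \<longrightarrow>
            limitin (weak_topology Mbox)
              (\<lambda>i. scenery_distribution (push_on U f \<mu>) (f x) (T i))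
              (linear_box (frechet_derivative f (at x)) P') sequentially) \<and>
         (\<forall>P. fractal_distribution P \<longrightarrow> generates \<mu> x P \<longrightarrow>
            generates (push_on U f \<mu>) (f x) (linear_star (frechet_derivative f (at x)) P))"
proof -
  have x: "x \<in> U" "x \<in> supp \<mu>" using assms(6) by auto
  note limit = scenery_push_on_limit[OF assms(1,2,4,5) x]
  note A = C1_diffeomorphism_derivative(3,4)[OF assms(5,2) x(1) assms(4)]
  show ?thesis
  proof (intro conjI allI impI)
    fix T :: "nat \<Rightarrow> real" and P P'
    assume "filterlim T at_top sequentially" "fractal_distribution P'" "P = restricted_version P'"
      "limitin (weak_topology Mbox) (\<lambda>i. scenery_distribution \<mu> x (T i)) P sequentially"
    then show "limitin (weak_topology Mbox) (\<lambda>i. scenery_distribution (push_on U f \<mu>) (f x) (T i))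
        (linear_box (frechet_derivative f (at x)) P') sequentially"
      by (intro limit) (auto simp: fractal_distribution_def)
  next
    fix P :: "(real ^ 'd) measure measure"
    assume P: "fractal_distribution P" and gen: "generates \<mu> x P"
    then have "P \<in> prob_measures Mstar" "zoom_invariant P" by (auto simp: fractal_distribution_def)
    \<comment> \<open>Generation is the instance with the filter \<open>at_top\<close> and the
      identity as the family of times.\<close>
    then show "generates (push_on U f \<mu>) (f x) (linear_star (frechet_derivative f (at x)) P)"
      using limit[OF _ _ filterlim_ident] gen A
      by (simp add: generates_def restricted_version_linear_star)
  qed
qed

end
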